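(* There exist a positive absolute constant $\Theta$ and a constant $\eta\in(0,1]$ depending only on $d$ such that the following holds. Let $1<r<\infty$ and let $\Lambda$ be an $L^r(\mathbb R^d)\times L^{r'}(\mathbb R^d)$-bounded bilinear form with kernel $K$ satisfying the single scale condition $(\mathsf{SS})$ for some $1<q\le\infty$ and the truncation condition $(\mathsf T)$ with constant $C_{\mathsf T}(r)$, both stated in the context. Assume that there exist $1\le p_1,p_2<\infty$ and a positive constant $C_{\mathsf L}$ such that the estimates $$|\Lambda_{\mathcal Q,\mu,\nu}(b,h)|\le C_{\mathsf L}|Q|\,\|b\|_{\dot{\mathcal X}_{p_1}(\mathcal Q)}\|h\|_{\mathcal Y_{p_2}(\mathcal Q)}\qquad (b\in\dot{\mathcal X}_{p_1}(\mathcal Q),\ h\in\mathcal Y_{p_2}(\mathcal Q)),$$ $$|\Lambda_{\mathcal Q,\mu,\nu}(h,b)|\le C_{\mathsf L}|Q|\,\|h\|_{\mathcal Y_{\infty}(\mathcal Q)}\|b\|_{\dot{\mathcal X}_{p_2}(\mathcal Q)}\qquad (h\in\mathcal Y_\infty(\mathcal Q),\ b\in\dot{\mathcal X}_{p_2}(\mathcal Q))$$ hold uniformly over all $\mu,\nu\in\mathbb Z$, all dyadic lattices $\mathcal D$, all $Q\in\mathcal D$ and all stopping collections $\mathcal Q\subset\mathcal D$ with top $Q$. Then $$\sup_{\mu,\nu\in\mathbb Z}|\Lambda_\mu^\nu(f_1,f_2)|\le2^{\Theta d}\big[C_{\mathsf T}(r)+C_{\mathsf L}\big]\sup_{\mathcal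 S}\mathsf{PSF}_{\mathcal S;p_1,p_2}(f_1,f_2)$$ for all $f_j\in L^{p_j}(\mathbb R^d)$ with compact support, $j=1,2$, where the supremum on the right is over all $\eta$-sparse collections $\mathcal S$ of cubes.
   Context: Forms and kernels. That $\Lambda$ has kernel $K$ means: $K=K(x,y)$ is a function away from the diagonal of $\mathbb R^d\times\mathbb R^d$ and, whenever $f_1\in L^r$, $f_2\in L^{r'}$ are compactly and disjointly supported, $\Lambda(f_1,f_2)=\int\int K(x,y)f_1(y)\,dy\,f_2(x)\,dx$ with absolute convergence. $(\mathsf{SS})$: there is $1<q\le\infty$ such that $K(x,y)=\sum_{s\in\mathbb Z}K_s(x,y)$, with $\operatorname{supp}K_s\subset\{(x,y):x-y\in A_s\}$, $A_s=\{z\in\mathbb R^d:2^{s-2}<|z|<2^s\}$, and $$[K]_{0,q}:=\sup_{s\in\mathbb Z}2^{sd/q'}\sup_{x\in\mathbb R^d}\big(\|K_s(x,x+\cdot)\|_q+\|K_s(x+\cdot,x)\|_q\big)<\infty.$$ Truncations: $\Lambda_\mu^\nu(h_1,h_2):=\int\sum_{\mu<s\le\nu}K_s(x,y)h_1(y)h_2(x)\,dy\,dx$ (zero if $\mu\ge\nu$). $(\mathsf T)$: $C_{\mathsf T}(r):=\sup_{\mu<\nu}\|\Lambda_\mu^\nu\|_{L^r(\mathbb R^d)\times L^{r'}(\mathbb R^d)\to\mathbb C}<\infty$. Cubes. $\ell(Q)$ is the sidelength of a cube $Q$, $s_Q=\log_2\ell(Q)$, $aQ$ is the concentric $a$-fold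 dilate, $\widehat L=2^5L$. $\langle f\rangle_{p,Q}:=|Q|^{-1/p}\|f\mathbf 1_Q\|_p$ and $\mathrm M_pf(x)=\sup_{Q}\langle f\rangle_{p,Q}\mathbf 1_Q(x)$, the supremum over all cubes $Q\subset\mathbb R^d$. Stopping collections. Let $\mathcal D$ be a dyadic lattice and $Q\in\mathcal D$. A collection $\mathcal Q\subset\mathcal D$ is a stopping collection with top $Q$ if its elements are pairwise disjoint, contained in $3Q$, and: (a) $L,L'\in\mathcal Q$, $|s_L-s_{L'}|\ge8$ imply $7L\cap7L'=\varnothing$; (b) $\bigcup_{L\in\mathcal Q:\,3L\cap2Q\neq\varnothing}9L\subset\mathsf{sh}\,\mathcal Q:=\bigcup_{L\in\mathcal Q}L$. Localized spaces. For $1\le p\le\infty$, $\mathcal Y_p(\mathcal Q)$ is the space of $h\in L^p(\mathbb R^d)$ with $\operatorname{supp}h\subset3Q$ and finite norm $\|h\|_{\mathcal Y_p(\mathcal Q)}:=\max\{\|h\mathbf 1_{\mathbb R^d\setminus\mathsf{sh}\mathcal Q}\|_\infty,\ \sup_{L\in\mathcal Q}\inf_{x\in\widehat L}\mathrm M_ph(x)\}$ if $p<\infty$, and $\|h\|_{\mathcal Y_\infty(\mathcal Q)}:=\|h\|_\infty$. $\mathcal X_p(\mathcal Q)$ is the subspace of $b\in\mathcal Y_p(\mathcal Q)$ of the form $b=\sum_{L\in\mathcal Q}b_L$ with $\operatorname{supp}b_L\subset L$; $\dot{\mathcal X}_p(\mathcal Q)$ is the subspace of those $b$ with $\int_Lb_L=0$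 for all $L\in\mathcal Q$. Both carry the $\mathcal Y_p(\mathcal Q)$ norm. Localized forms. $\Lambda_{Q,\mu,\nu}(h_1,h_2):=\Lambda_\mu^{\min\{s_Q,\nu\}}(h_1\mathbf 1_Q,h_2)$ and $\Lambda_{\mathcal Q,\mu,\nu}(h_1,h_2):=\Lambda_{Q,\mu,\nu}(h_1,h_2)-\sum_{L\in\mathcal Q,\,L\subset Q}\Lambda_{L,\mu,\nu}(h_1,h_2)$. Sparse forms. A countable collection $\mathcal S$ of cubes is $\eta$-sparse if there are measurable $E_I\subset I$, $I\in\mathcal S$, pairwise disjoint, with $|E_I|\ge\eta|I|$. $\mathsf{PSF}_{\mathcal S;p_1,p_2}(f_1,f_2):=\sum_{Q\in\mathcal S}|Q|\langle f_1\rangle_{p_1,Q}\langle f_2\rangle_{p_2,Q}$. *)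

theory Defs
  imports "HOL-Analysis.Analysis" "HOL-Probability.Essential_Supremum"
begin

text \<open>
  The dimension is quantified inside the theorem (one constant serves all dimensions, another is
  chosen per dimension), so it cannot be a type. Points of d-dimensional space are the extensional
  functions on \<open>{..<d}\<close>, with Lebesgue measure obtained by completing the product of one-dimensional
  Lebesgue measures. The topology on \<^typ>\<open>nat \<Rightarrow> real\<close> is the product topology, which on these
  points is the Euclidean one.
\<close>

type_synonym pt = "nat \<Rightarrow> real"
type_synonym cfun = "pt \<Rightarrow> complex"
type_synonym kern = "pt \<Rightarrow> pt \<Rightarrow> complex"

definition Rd :: "nat \<Rightarrow> pt set" where
  "Rd d = {..<d} \<rightarrow>\<^sub>E UNIV"

definition leb :: "nat \<Rightarrow> pt measure" where
  "leb d = completion (Pi\<^sub>M {..<d} (\<lambda>_. lborel))"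

definition leb2 :: "nat \<Rightarrow> (pt \<times> pt) measure" where
  "leb2 d = completion (Pi\<^sub>M {..<d} (\<lambda>_. lborel) \<Otimes>\<^sub>M Pi\<^sub>M {..<d} (\<lambda>_. lborel))"

definition add_pt :: "nat \<Rightarrow> pt \<Rightarrow> pt \<Rightarrow> pt" where
  "add_pt d x z = (\<lambda>i\<in>{..<d}. x i + z i)"

definition edist :: "nat \<Rightarrow> pt \<Rightarrow> pt \<Rightarrow> real" where
  "edist d x y = L2_set (\<lambda>i. x i - y i) {..<d}"


subsection \<open>Lebesgue spaces\<close>

text \<open>Exponents live in \<^typ>\<open>ennreal\<close>, where \<open>1 / \<infinity> = 0\<close> and \<open>1 / 0 = \<infinity>\<close>.\<close>

definition conj_exponent :: "ennreal \<Rightarrow> ennreal" where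
  "conj_exponent p = 1 / (1 - 1 / p)"

definition enn_powr :: "ennreal \<Rightarrow> real \<Rightarrow> ennreal" where
  "enn_powr t a = (if t = top then top else ennreal (enn2real t powr a))"

text \<open>The norm is only used for exponents \<open>p \<ge> 1\<close> and measurable functions.\<close>

definition Lnorm :: "nat \<Rightarrow> ennreal \<Rightarrow> cfun \<Rightarrow> ennreal" where
  "Lnorm d p f =
     (if p = top then esssup (leb d) (\<lambda>x. ennreal (cmod (f x)))
      else enn_powr (\<integral>\<^sup>+x. ennreal (cmod (f x) powr enn2real p) \<partial>leb d) (1 / enn2real p))"

definition Lspace :: "nat \<Rightarrow> ennreal \<Rightarrow> cfun set" where
  "Lspace d p = {f \<in> borel_measurable (leb d). Lnorm d p f < top}"

text \<open>Functions are considered up to null sets, hence so are their supports.\<close>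

definition supported_in :: "nat \<Rightarrow> cfun \<Rightarrow> pt set \<Rightarrow> bool" where
  "supported_in d f A \<longleftrightarrow> (AE x in leb d. x \<notin> A \<longrightarrow> f x = 0)"

definition compactly_supported :: "nat \<Rightarrow> cfun \<Rightarrow> bool" where
  "compactly_supported d f \<longleftrightarrow> (\<exists>A. compact A \<and> A \<subseteq> Rd d \<and> supported_in d f A)"

definition cut :: "pt set \<Rightarrow> cfun \<Rightarrow> cfun" where
  "cut A f = (\<lambda>x. if x \<in> A then f x else 0)"


subsection \<open>Bilinear forms and kernels\<close>

definition bounded_bilinear_form ::
    "nat \<Rightarrow> real \<Rightarrow> (cfun \<Rightarrow> cfun \<Rightarrow> complex) \<Rightarrow> bool" where
  "bounded_bilinear_form d r \<Lambda> \<longleftrightarrow>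
     (let X = Lspace d (ennreal r); Y = Lspace d (conj_exponent (ennreal r)) in
       (\<forall>f\<in>X. \<forall>f'\<in>X. \<forall>g\<in>Y. \<Lambda> (\<lambda>x. f x + f' x) g = \<Lambda> f g + \<Lambda> f' g) \<and>
       (\<forall>c. \<forall>f\<in>X. \<forall>g\<in>Y. \<Lambda> (\<lambda>x. c * f x) g = c * \<Lambda> f g) \<and>
       (\<forall>f\<in>X. \<forall>g\<in>Y. \<forall>g'\<in>Y. \<Lambda> f (\<lambda>x. g x + g' x) = \<Lambda> f g + \<Lambda> f g') \<and>
       (\<forall>c. \<forall>f\<in>X. \<forall>g\<in>Y. \<Lambda> f (\<lambda>x. c * g x) = c * \<Lambda> f g) \<and>
       (\<exists>B::real. \<forall>f\<in>X. \<forall>g\<in>Y. ennreal (cmod (\<Lambda> f g)) \<le>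
          ennreal B * Lnorm d (ennreal r) f * Lnorm d (conj_exponent (ennreal r)) g))"

text \<open>
  The double integral is an integral over the product space. Compact sets \<open>A\<close>, \<open>B\<close> as below exist
  precisely if the essential supports of \<open>f\<close> and \<open>g\<close> are compact and disjoint.
\<close>

definition has_kernel ::
    "nat \<Rightarrow> real \<Rightarrow> (cfun \<Rightarrow> cfun \<Rightarrow> complex) \<Rightarrow> kern \<Rightarrow> bool" where
  "has_kernel d r \<Lambda> K \<longleftrightarrow>
     (\<forall>f\<in>Lspace d (ennreal r). \<forall>g\<in>Lspace d (conj_exponent (ennreal r)). \<forall>A B.
        compact A \<and> compact B \<and> A \<subseteq> Rd d \<and> B \<subseteq> Rd d \<and> A \<inter> B = {} \<and>
        supported_in d f A \<and> supported_in d g B \<longrightarrow>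
          integrable (leb2 d) (\<lambda>(x, y). K x y * f y * g x) \<and>
          \<Lambda> f g = (\<integral>(x, y). K x y * f y * g x \<partial>leb2 d))"

definition kernel_const :: "nat \<Rightarrow> ennreal \<Rightarrow> (int \<Rightarrow> kern) \<Rightarrow> ennreal" where
  "kernel_const d q Ks =
     (SUP s. ennreal (2 powr (of_int s * real d / enn2real (conj_exponent q))) *
        (SUP x\<in>Rd d. Lnorm d q (\<lambda>z. Ks s x (add_pt d x z)) +
                      Lnorm d q (\<lambda>z. Ks s (add_pt d x z) x)))"

definition single_scale :: "nat \<Rightarrow> ennreal \<Rightarrow> kern \<Rightarrow> (int \<Rightarrow> kern) \<Rightarrow> bool" where
  "single_scale d q K Ks \<longleftrightarrow>
     (\<forall>s. (\<lambda>(x, y). Ks s x y) \<in> borel_measurable (leb2 d)) \<and>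
     (\<forall>s. \<forall>x\<in>Rd d. (\<lambda>z. Ks s x (add_pt d x z)) \<in> borel_measurable (leb d) \<and>
                    (\<lambda>z. Ks s (add_pt d x z) x) \<in> borel_measurable (leb d)) \<and>
     (\<forall>x\<in>Rd d. \<forall>y\<in>Rd d. x \<noteq> y \<longrightarrow> ((\<lambda>s. Ks s x y) has_sum K x y) UNIV) \<and>
     (\<forall>s. \<forall>x\<in>Rd d. \<forall>y\<in>Rd d. Ks s x y \<noteq> 0 \<longrightarrow>
        2 powi (s - 2) < edist d x y \<and> edist d x y < 2 powi s) \<and>
     kernel_const d q Ks < top"

text \<open>
  A truncated form is meaningful at \<open>(h1, h2)\<close> when its integral converges absolutely; its value
  is \<open>0\<close> otherwise, by the convention of the Bochner integral.
\<close>

definition trunc_integrand ::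
    "(int \<Rightarrow> kern) \<Rightarrow> int \<Rightarrow> int \<Rightarrow> cfun \<Rightarrow> cfun \<Rightarrow> pt \<times> pt \<Rightarrow> complex" where
  "trunc_integrand Ks \<mu> \<nu> h1 h2 = (\<lambda>(x, y). (\<Sum>s\<in>{\<mu><..\<nu>}. Ks s x y) * h1 y * h2 x)"

definition trunc_converges ::
    "nat \<Rightarrow> (int \<Rightarrow> kern) \<Rightarrow> int \<Rightarrow> int \<Rightarrow> cfun \<Rightarrow> cfun \<Rightarrow> bool" where
  "trunc_converges d Ks \<mu> \<nu> h1 h2 \<longleftrightarrow> integrable (leb2 d) (trunc_integrand Ks \<mu> \<nu> h1 h2)"

definition trunc_form ::
    "nat \<Rightarrow> (int \<Rightarrow> kern) \<Rightarrow> int \<Rightarrow> int \<Rightarrow> cfun \<Rightarrow> cfun \<Rightarrow> complex" where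
  "trunc_form d Ks \<mu> \<nu> h1 h2 = (\<integral>z. trunc_integrand Ks \<mu> \<nu> h1 h2 z \<partial>leb2 d)"

definition form_norm ::
    "nat \<Rightarrow> real \<Rightarrow> (cfun \<Rightarrow> cfun \<Rightarrow> complex) \<Rightarrow> ennreal" where
  "form_norm d r \<Lambda> =
     (SUP f\<in>{f \<in> Lspace d (ennreal r). Lnorm d (ennreal r) f \<le> 1}.
      SUP g\<in>{g \<in> Lspace d (conj_exponent (ennreal r)). Lnorm d (conj_exponent (ennreal r)) g \<le> 1}.
        ennreal (cmod (\<Lambda> f g)))"

definition trunc_const :: "nat \<Rightarrow> real \<Rightarrow> (int \<Rightarrow> kern) \<Rightarrow> ennreal" where
  "trunc_const d r Ks = (SUP (\<mu>, \<nu>)\<in>{(\<mu>, \<nu>). \<mu> < \<nu>}. form_norm d r (trunc_form d Ks \<mu> \<nu>))"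


subsection \<open>Cubes\<close>

text \<open>Cubes are half-open, given by their lower corner and their sidelength.\<close>

datatype cube = Cube (corner: pt) (side: real)

definition is_cube :: "nat \<Rightarrow> cube \<Rightarrow> bool" where
  "is_cube d Q \<longleftrightarrow> corner Q \<in> Rd d \<and> side Q > 0"

definition cset :: "nat \<Rightarrow> cube \<Rightarrow> pt set" where
  "cset d Q = {x \<in> Rd d. \<forall>i<d. corner Q i \<le> x i \<and> x i < corner Q i + side Q}"

definition vol :: "nat \<Rightarrow> cube \<Rightarrow> ennreal" where
  "vol d Q = emeasure (leb d) (cset d Q)"

definition scale :: "cube \<Rightarrow> real" where
  "scale Q = log 2 (side Q)"

definition dil :: "nat \<Rightarrow> real \<Rightarrow> cube \<Rightarrow> cube" where
  "dil d a Q = Cube (\<lambda>i\<in>{..<d}. corner Q i - (a - 1) / 2 * side Q) (a * side Q)"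

definition avg :: "nat \<Rightarrow> ennreal \<Rightarrow> cfun \<Rightarrow> cube \<Rightarrow> ennreal" where
  "avg d p f Q =
     ennreal (enn2real (vol d Q) powr (- 1 / enn2real p)) * Lnorm d p (cut (cset d Q) f)"

definition maximal :: "nat \<Rightarrow> ennreal \<Rightarrow> cfun \<Rightarrow> pt \<Rightarrow> ennreal" where
  "maximal d p f x = (SUP Q\<in>{Q. is_cube d Q}. avg d p f Q * indicator (cset d Q) x)"

text \<open>
  The cubes of sidelength \<open>2^k\<close> form a translate, by \<open>a k\<close>, of the standard grid of that size, and
  the condition on \<open>a\<close> says that the grids are nested.
\<close>

definition dyadic_lattice :: "nat \<Rightarrow> cube set \<Rightarrow> bool" where
  "dyadic_lattice d \<D> \<longleftrightarrow>
     (\<exists>a :: int \<Rightarrow> nat \<Rightarrow> real.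
        (\<forall>k. \<forall>i<d. \<exists>n::int. a (k + 1) i = a k i + of_int n * 2 powi k) \<and>
        \<D> = {Cube (\<lambda>i\<in>{..<d}. a k i + of_int (m i) * 2 powi k) (2 powi k) |
              k (m :: nat \<Rightarrow> int). True})"


subsection \<open>Stopping collections and localized spaces\<close>

definition shadow :: "nat \<Rightarrow> cube set \<Rightarrow> pt set" where
  "shadow d \<Q> = (\<Union>L\<in>\<Q>. cset d L)"

definition stopping_collection :: "nat \<Rightarrow> cube set \<Rightarrow> cube \<Rightarrow> cube set \<Rightarrow> bool" where
  "stopping_collection d \<D> Q \<Q> \<longleftrightarrow>
     \<Q> \<subseteq> \<D> \<and> disjoint_family_on (cset d) \<Q> \<and>
     (\<forall>L\<in>\<Q>. cset d L \<subseteq> cset d (dil d 3 Q)) \<and>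
     (\<forall>L\<in>\<Q>. \<forall>L'\<in>\<Q>. \<bar>scale L - scale L'\<bar> \<ge> 8 \<longrightarrow>
        cset d (dil d 7 L) \<inter> cset d (dil d 7 L') = {}) \<and>
     (\<Union>L\<in>{L\<in>\<Q>. cset d (dil d 3 L) \<inter> cset d (dil d 2 Q) \<noteq> {}}. cset d (dil d 9 L))
        \<subseteq> shadow d \<Q>"

definition Ynorm :: "nat \<Rightarrow> ennreal \<Rightarrow> cube set \<Rightarrow> cfun \<Rightarrow> ennreal" where
  "Ynorm d p \<Q> h =
     (if p = top then Lnorm d top h
      else max (Lnorm d top (cut (- shadow d \<Q>) h))
               (SUP L\<in>\<Q>. INF x\<in>cset d (dil d (2 ^ 5) L). maximal d p h x))"

definition Yspace :: "nat \<Rightarrow> ennreal \<Rightarrow> cube \<Rightarrow> cube set \<Rightarrow> cfun set" where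
  "Yspace d p Q \<Q> =
     {h \<in> Lspace d p. supported_in d h (cset d (dil d 3 Q)) \<and> Ynorm d p \<Q> h < top}"

definition splits_as :: "nat \<Rightarrow> cube set \<Rightarrow> cfun \<Rightarrow> (cube \<Rightarrow> cfun) \<Rightarrow> bool" where
  "splits_as d \<Q> b bL \<longleftrightarrow>
     (\<forall>L\<in>\<Q>. supported_in d (bL L) (cset d L)) \<and>
     (AE x in leb d. ((\<lambda>L. bL L x) has_sum b x) \<Q>)"

definition Xspace :: "nat \<Rightarrow> ennreal \<Rightarrow> cube \<Rightarrow> cube set \<Rightarrow> cfun set" where
  "Xspace d p Q \<Q> = {b \<in> Yspace d p Q \<Q>. \<exists>bL. splits_as d \<Q> b bL}"

definition Xdot :: "nat \<Rightarrow> ennreal \<Rightarrow> cube \<Rightarrow> cube set \<Rightarrow> cfun set" where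
  "Xdot d p Q \<Q> = {b \<in> Xspace d p Q \<Q>. \<exists>bL. splits_as d \<Q> b bL \<and>
     (\<forall>L\<in>\<Q>. (LINT x:cset d L|leb d. bL L x) = 0)}"


subsection \<open>Localized forms\<close>

text \<open>
  The floor only serves to pass to the integers: it is exact for dyadic cubes. In \<open>coll_form\<close> at
  most finitely many summands have a nonempty range of scales.
\<close>

definition loc_form ::
    "nat \<Rightarrow> (int \<Rightarrow> kern) \<Rightarrow> cube \<Rightarrow> int \<Rightarrow> int \<Rightarrow> cfun \<Rightarrow> cfun \<Rightarrow> complex" where
  "loc_form d Ks Q \<mu> \<nu> h1 h2 = trunc_form d Ks \<mu> (min \<lfloor>scale Q\<rfloor> \<nu>) (cut (cset d Q) h1) h2"

definition coll_form ::
    "nat \<Rightarrow> (int \<Rightarrow> kern) \<Rightarrow> cube \<Rightarrow> cube set \<Rightarrow> int \<Rightarrow> int \<Rightarrow> cfun \<Rightarrow> cfun \<Rightarrow> complex" where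
  "coll_form d Ks Q \<Q> \<mu> \<nu> h1 h2 =
     loc_form d Ks Q \<mu> \<nu> h1 h2 -
     (\<Sum>\<^sub>\<infinity>L\<in>{L\<in>\<Q>. cset d L \<subseteq> cset d Q}. loc_form d Ks L \<mu> \<nu> h1 h2)"

text \<open>All integrals that occur in \<open>coll_form\<close> converge absolutely.\<close>

definition coll_converges ::
    "nat \<Rightarrow> (int \<Rightarrow> kern) \<Rightarrow> cube \<Rightarrow> cube set \<Rightarrow> int \<Rightarrow> int \<Rightarrow> cfun \<Rightarrow> cfun \<Rightarrow> bool" where
  "coll_converges d Ks Q \<Q> \<mu> \<nu> h1 h2 \<longleftrightarrow>
     (\<forall>L\<in>insert Q {L\<in>\<Q>. cset d L \<subseteq> cset d Q}.
        trunc_converges d Ks \<mu> (min \<lfloor>scale L\<rfloor> \<nu>) (cut (cset d L) h1) h2)"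

text \<open>
  The localized estimates, with constant \<open>C\<close>, required at those pairs of functions at which the
  form is given by absolutely convergent integrals. All pairs of bounded functions are of this
  kind, but for small exponents not necessarily all pairs in the two spaces.
\<close>

definition localized_estimates ::
    "nat \<Rightarrow> (int \<Rightarrow> kern) \<Rightarrow> real \<Rightarrow> real \<Rightarrow> real \<Rightarrow> bool" where
  "localized_estimates d Ks p1 p2 C \<longleftrightarrow>
     (\<forall>\<mu> \<nu> \<D> Q \<Q>. dyadic_lattice d \<D> \<and> Q \<in> \<D> \<and> stopping_collection d \<D> Q \<Q> \<longrightarrow>
        (\<forall>b\<in>Xdot d (ennreal p1) Q \<Q>. \<forall>h\<in>Yspace d (ennreal p2) Q \<Q>.
           coll_converges d Ks Q \<Q> \<mu> \<nu> b h \<longrightarrow>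
           ennreal (cmod (coll_form d Ks Q \<Q> \<mu> \<nu> b h))
             \<le> ennreal C * vol d Q * Ynorm d (ennreal p1) \<Q> b * Ynorm d (ennreal p2) \<Q> h) \<and>
        (\<forall>h\<in>Yspace d top Q \<Q>. \<forall>b\<in>Xdot d (ennreal p2) Q \<Q>.
           coll_converges d Ks Q \<Q> \<mu> \<nu> h b \<longrightarrow>
           ennreal (cmod (coll_form d Ks Q \<Q> \<mu> \<nu> h b))
             \<le> ennreal C * vol d Q * Ynorm d top \<Q> h * Ynorm d (ennreal p2) \<Q> b))"


subsection \<open>Sparse forms\<close>

definition sparse_collection :: "nat \<Rightarrow> real \<Rightarrow> cube set \<Rightarrow> bool" where
  "sparse_collection d \<eta> \<S> \<longleftrightarrow>
     countable \<S> \<and> (\<forall>Q\<in>\<S>. is_cube d Q) \<and>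
     (\<exists>E. disjoint_family_on E \<S> \<and>
          (\<forall>Q\<in>\<S>. E Q \<in> sets (leb d) \<and> E Q \<subseteq> cset d Q \<and>
                  emeasure (leb d) (E Q) \<ge> ennreal \<eta> * vol d Q))"

definition PSF :: "nat \<Rightarrow> real \<Rightarrow> real \<Rightarrow> cube set \<Rightarrow> cfun \<Rightarrow> cfun \<Rightarrow> ennreal" where
  "PSF d p1 p2 \<S> f1 f2 =
     (\<Sum>\<^sub>\<infinity>Q\<in>\<S>. vol d Q * avg d (ennreal p1) f1 Q * avg d (ennreal p2) f2 Q)"

end

theory Submission
  imports Defs
begin

text \<open>
  The idea is a Calderon-Zygmund stopping time argument that is iterated over scales. Let \<open>Q\<close> be a
  dyadic cube and localize \<open>f\<^sub>1\<close> and \<open>f\<^sub>2\<close> to \<open>3Q\<close>. The points near which one of the two functions has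
  averages much larger than its average over \<open>3Q\<close> form an open set \<open>E\<close> of small measure, by the weak
  type estimate (\<open>heavy_set_small\<close>). The maximal dyadic cubes \<open>L \<subseteq> 3Q\<close> with \<open>9L \<subseteq> E\<close> are a stopping
  collection (\<open>Whitney_stopping_collection\<close>): maximality forces neighbouring cubes to have comparable
  size, and it also says that \<open>32L\<close> leaves \<open>E\<close>, so that the maximal functions are under control at
  some point of \<open>32L\<close>. Off the stopping cubes the functions themselves are bounded by their averages.

  Hence each function splits into a good part, bounded by a multiple of its average over \<open>3Q\<close>, and a
  bad part with mean zero on every stopping cube, whose localized norm is bounded in the same way. In
  the form associated with the stopping collection, the two localized estimates control the terms
  (bad, arbitrary) and (good, bad). In the term (good, good) both entries are bounded and live on a
  dilate of one cube, where the \<open>L\<^sup>r\<close> bound for truncations gives the volume of that cube whatever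
  \<open>r\<close> is. The result is \<open>one_step\<close>: the form localized to \<open>Q\<close> is at most
  \<open>C |3Q| \<langle>f\<^sub>1\<rangle> \<langle>f\<^sub>2\<rangle>\<close> plus the forms localized to those stopping cubes that lie in \<open>Q\<close>.

  These cubes cover at most half of \<open>Q\<close>, so repeating the step builds a tree of cubes each of which
  keeps at least half of its measure for itself (\<open>stopping_tree\<close>). Scales at or below \<open>\<mu>\<close> contribute
  nothing to the truncated form, so the tree is finite. The threefold dilates of its cubes are sparse
  with a constant depending on the dimension only.

  Two points need care. All integrals must converge absolutely for the splittings to make sense; this
  is ensured by proving the bound for bounded functions first, and the general case follows by
  truncating the values of \<open>f\<^sub>1\<close> and \<open>f\<^sub>2\<close> and dominated convergence (\<open>sparse_bound\<close>). And the fact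
  that a function is almost everywhere bounded where its averages are is obtained directly, from
  outer regularity and dyadic covers (\<open>AE_bounded_off_heavy_set\<close>), without differentiating integrals.
\<close>


section \<open>Lebesgue measure and cubes\<close>

text \<open>Lebesgue measure before completion; it lives on the Borel sets.\<close>

abbreviation bleb :: "nat \<Rightarrow> pt measure" where
  "bleb d \<equiv> Pi\<^sub>M {..<d} (\<lambda>_. lborel)"

interpretation leb_prod: product_sigma_finite "\<lambda>_::nat. lborel :: real measure"
  by standard

lemma sigma_finite_bleb: "sigma_finite_measure (bleb d)"
  by (rule leb_prod.sigma_finite) simp

lemma space_bleb [simp]: "space (bleb d) = Rd d"
  by (simp add: space_PiM Rd_def)

lemma space_leb [simp]: "space (leb d) = Rd d"
  by (simp add: leb_def)

lemma Rd_leb [simp]: "Rd d \<in> sets (leb d)"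
  using sets.top[of "leb d"] by simp

lemma sets_bleb_leb: "A \<in> sets (bleb d) \<Longrightarrow> A \<in> sets (leb d)"
  by (simp add: leb_def)

lemma emeasure_leb_bleb: "A \<in> sets (bleb d) \<Longrightarrow> emeasure (leb d) A = emeasure (bleb d) A"
  by (simp add: leb_def)

lemma cset_eq_PiE: "cset d Q = (\<Pi>\<^sub>E i\<in>{..<d}. {corner Q i ..< corner Q i + side Q})"
  by (auto simp: cset_def Rd_def PiE_def Pi_def extensional_def)

lemma cset_subset_Rd: "cset d Q \<subseteq> Rd d"
  by (auto simp: cset_def)

lemma cset_bleb [measurable]: "cset d Q \<in> sets (bleb d)"
  unfolding cset_eq_PiE by (rule sets_PiM_I_finite) auto

lemma cset_leb [measurable]: "cset d Q \<in> sets (leb d)"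
  by (rule sets_bleb_leb) (rule cset_bleb)

lemma emeasure_cset: "0 \<le> side Q \<Longrightarrow> emeasure (leb d) (cset d Q) = ennreal (side Q ^ d)"
  using emeasure_leb_bleb[OF cset_bleb, of d Q] unfolding cset_eq_PiE
  by (simp add: leb_prod.emeasure_PiM ennreal_power)

lemma vol_eq: "0 \<le> side Q \<Longrightarrow> vol d Q = ennreal (side Q ^ d)"
  by (simp add: vol_def emeasure_cset)

text \<open>The interior of a cube.\<close>

definition ocset :: "nat \<Rightarrow> cube \<Rightarrow> pt set" where
  "ocset d Q = {x \<in> Rd d. \<forall>i<d. corner Q i < x i \<and> x i < corner Q i + side Q}"

lemma ocset_leb [measurable]: "ocset d Q \<in> sets (leb d)"
proof (rule sets_bleb_leb)
  have "ocset d Q = (\<Pi>\<^sub>E i\<in>{..<d}. {corner Q i <..< corner Q i + side Q})"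
    by (auto simp: ocset_def Rd_def PiE_def Pi_def extensional_def)
  then show "ocset d Q \<in> sets (bleb d)"
    by (auto intro!: sets_PiM_I_finite)
qed

lemma ocset_subset_cset: "ocset d Q \<subseteq> cset d Q"
  by (auto simp: ocset_def cset_def less_imp_le)

lemma side_dil [simp]: "side (dil d a Q) = a * side Q"
  by (simp add: dil_def)

lemma cset_dil:
  "cset d (dil d a Q) = {x \<in> Rd d. \<forall>i<d. corner Q i - (a - 1) / 2 * side Q \<le> x i \<and>
     x i < corner Q i + (a + 1) / 2 * side Q}"
  by (auto simp: cset_def dil_def field_simps)

lemma ocset_dil:
  "ocset d (dil d a Q) = {x \<in> Rd d. \<forall>i<d. corner Q i - (a - 1) / 2 * side Q < x i \<and>
     x i < corner Q i + (a + 1) / 2 * side Q}"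
  by (auto simp: ocset_def dil_def field_simps)

lemma cset_subset_dil: "1 \<le> a \<Longrightarrow> 0 < side Q \<Longrightarrow> cset d Q \<subseteq> cset d (dil d a Q)"
proof
  fix x assume a: "1 \<le> a" "0 < side Q" and x: "x \<in> cset d Q"
  have 0: "0 \<le> (a - 1) / 2 * side Q" and 1: "(a + 1) / 2 * side Q = side Q + (a - 1) / 2 * side Q"
    using a by (auto simp: field_simps)
  show "x \<in> cset d (dil d a Q)"
    unfolding cset_dil 1 using x 0 unfolding cset_def by force
qed

lemma dil_dil_inject: "0 < a \<Longrightarrow> is_cube d Q \<Longrightarrow> is_cube d Q' \<Longrightarrow> dil d a Q = dil d a Q' \<Longrightarrow> Q = Q'"
proof -
  assume a: "0 < a" and Q: "is_cube d Q" and Q': "is_cube d Q'" and e: "dil d a Q = dil d a Q'"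
  have s: "side Q = side Q'" using arg_cong[OF e, of side] a by simp
  have "corner Q i = corner Q' i" for i
  proof (cases "i < d")
    case True
    then show ?thesis using fun_cong[OF arg_cong[OF e, of corner], of i] s by (simp add: dil_def)
  next
    case False
    then show ?thesis using Q Q' by (simp add: is_cube_def Rd_def PiE_def extensional_def)
  qed
  then show "Q = Q'" using s by (cases Q, cases Q') auto
qed

section \<open>Dyadic cubes\<close>

lemma two_powi_less_iff [simp]: "(2::real) powi k < 2 powi k' \<longleftrightarrow> k < k'"
  by (simp add: powr_real_of_int' [symmetric])

lemma two_powi_le_iff [simp]: "(2::real) powi k \<le> 2 powi k' \<longleftrightarrow> k \<le> k'"
  by (simp add: powr_real_of_int' [symmetric])

lemma two_powi_eq_iff [simp]: "(2::real) powi k = 2 powi k' \<longleftrightarrow> k = k'"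
  by (simp add: eq_iff)

text \<open>
  A dyadic cube is addressed by its scale \<open>k\<close> and any one of its points \<open>x\<close>, so that ancestors are
  obtained by increasing \<open>k\<close>. The grid is the standard one, translated by \<open>c\<close> in every coordinate.
\<close>

definition gix :: "real \<Rightarrow> int \<Rightarrow> pt \<Rightarrow> nat \<Rightarrow> int" where
  "gix c k x i = \<lfloor>(x i - c) / 2 powi k\<rfloor>"

definition dcube :: "nat \<Rightarrow> real \<Rightarrow> int \<Rightarrow> pt \<Rightarrow> cube" where
  "dcube d c k x = Cube (\<lambda>i\<in>{..<d}. c + of_int (gix c k x i) * 2 powi k) (2 powi k)"

definition dgrid :: "nat \<Rightarrow> real \<Rightarrow> cube set" where
  "dgrid d c = {dcube d c k x | k x. x \<in> Rd d}"

lemma side_dcube [simp]: "side (dcube d c k x) = 2 powi k"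
  by (simp add: dcube_def)

lemma scale_dcube [simp]: "scale (dcube d c k x) = of_int k"
proof -
  have "(2::real) powi k = 2 powr of_int k"
    by (simp add: powr_real_of_int')
  then show ?thesis by (simp add: scale_def)
qed

lemma corner_dcube: "i < d \<Longrightarrow> corner (dcube d c k x) i = c + of_int (gix c k x i) * 2 powi k"
  by (simp add: dcube_def)

lemma is_cube_dcube: "is_cube d (dcube d c k x)"
  by (simp add: is_cube_def dcube_def Rd_def)

lemma mem_dcube_iff: "y \<in> cset d (dcube d c k x) \<longleftrightarrow> y \<in> Rd d \<and> (\<forall>i<d. gix c k y i = gix c k x i)"
proof -
  have "(c + of_int m * 2 powi k \<le> t \<and> t < c + of_int m * 2 powi k + 2 powi k)
      \<longleftrightarrow> \<lfloor>(t - c) / 2 powi k\<rfloor> = m" for m :: int and t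
    unfolding floor_eq_iff by (simp add: field_simps) 
  then show ?thesis
    by (auto simp: cset_def corner_dcube gix_def)
qed

lemma dcube_self: "x \<in> Rd d \<Longrightarrow> x \<in> cset d (dcube d c k x)"
  by (simp add: mem_dcube_iff)

lemma dcube_eqI: "y \<in> cset d (dcube d c k x) \<Longrightarrow> dcube d c k y = dcube d c k x"
  unfolding mem_dcube_iff by (auto simp: dcube_def fun_eq_iff)

lemma gix_coarsen: "gix c (k + int n) x i = gix c k x i div 2 ^ n"
proof -
  have "(x i - c) / 2 powi (k + int n) = ((x i - c) / 2 powi k) / of_int (2 ^ n)"
    by (simp add: power_int_add)
  moreover have "\<lfloor>a / of_int (2 ^ n)\<rfloor> = \<lfloor>a\<rfloor> div 2 ^ n" for a :: real
    by (rule floor_divide_real_eq_div) simp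
  ultimately show ?thesis
    unfolding gix_def by metis
qed

lemma dcube_coarsen:
  assumes "k \<le> k'" "y \<in> cset d (dcube d c k x)"
  shows "y \<in> cset d (dcube d c k' x)"
proof -
  obtain n where "k' = k + int n" using assms(1) zle_iff_zadd by auto
  then show ?thesis using assms(2) by (auto simp: mem_dcube_iff gix_coarsen)
qed

lemma dcube_nested:
  assumes "k \<le> k'" "y \<in> cset d (dcube d c k x)" "y \<in> cset d (dcube d c k' x')"
  shows "cset d (dcube d c k x) \<subseteq> cset d (dcube d c k' x')"
proof
  fix z assume "z \<in> cset d (dcube d c k x)"
  then have "z \<in> cset d (dcube d c k y)" using assms(2) dcube_eqI by metis
  then have "z \<in> cset d (dcube d c k' y)" using assms(1) dcube_coarsen by blast
  then show "z \<in> cset d (dcube d c k' x')" using assms(3) dcube_eqI by metis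
qed

lemma dyadic_lattice_dgrid: "dyadic_lattice d (dgrid d c)"
  unfolding dyadic_lattice_def
proof (intro exI conjI)
  let ?a = "\<lambda>(k::int) (i::nat). c"
  show "\<forall>k. \<forall>i<d. \<exists>n::int. ?a (k + 1) i = ?a k i + of_int n * 2 powi k"
    by (auto intro: exI[of _ 0])
  have 1: "L \<in> {Cube (\<lambda>i\<in>{..<d}. ?a k i + of_int (m i) * 2 powi k) (2 powi k) | k (m :: nat \<Rightarrow> int). True}"
    if "L \<in> dgrid d c" for L
    using that unfolding dgrid_def dcube_def by auto
  have 2: "Cube (\<lambda>i\<in>{..<d}. ?a k i + of_int (m i) * 2 powi k) (2 powi k) \<in> dgrid d c"
    for k and m :: "nat \<Rightarrow> int"
  proof -
    let ?x = "\<lambda>i\<in>{..<d}. c + of_int (m i) * 2 powi k"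
    have "gix c k ?x i = m i" if "i < d" for i
      using that by (simp add: gix_def)
    then have "dcube d c k ?x = Cube (\<lambda>i\<in>{..<d}. ?a k i + of_int (m i) * 2 powi k) (2 powi k)"
      by (auto simp: dcube_def fun_eq_iff)
    then show ?thesis unfolding dgrid_def
      by (smt (verit) PiE_UNIV_domain Rd_def mem_Collect_eq restrict_PiE_iff UNIV_I)
  qed
  show "dgrid d c = {Cube (\<lambda>i\<in>{..<d}. ?a k i + of_int (m i) * 2 powi k) (2 powi k) | k (m :: nat \<Rightarrow> int). True}"
    using 1 2 by blast
qed

lemma countable_dgrid: "countable (dgrid d c)"
proof -
  define F :: "int \<times> (nat \<Rightarrow> int) \<Rightarrow> cube" where
    "F = (\<lambda>(k, m). Cube (\<lambda>i\<in>{..<d}. c + of_int (m i) * 2 powi k) (2 powi k))"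
  have "dgrid d c \<subseteq> F ` (UNIV \<times> (\<Pi>\<^sub>E i\<in>{..<d}. UNIV))"
  proof
    fix L assume "L \<in> dgrid d c"
    then obtain k x where L: "L = dcube d c k x" unfolding dgrid_def by blast
    have "L = F (k, \<lambda>i\<in>{..<d}. gix c k x i)"
      unfolding L dcube_def F_def by (simp cong: restrict_cong)
    moreover have "(\<lambda>i\<in>{..<d}. gix c k x i) \<in> (\<Pi>\<^sub>E i\<in>{..<d}. UNIV)"
      by simp
    ultimately show "L \<in> F ` (UNIV \<times> (\<Pi>\<^sub>E i\<in>{..<d}. UNIV))" by blast
  qed
  moreover have "countable (\<Pi>\<^sub>E i\<in>{..<d}. (UNIV :: int set))"
    by (rule countable_PiE) simp_all
  ultimately show ?thesis
    by (meson countable_SIGMA countable_image countable_subset countableI_type)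
qed

lemma dgrid_nested:
  assumes "L \<in> dgrid d c" "L' \<in> dgrid d c" "side L \<le> side L'" "y \<in> cset d L" "y \<in> cset d L'"
  shows "cset d L \<subseteq> cset d L'"
proof -
  obtain k x k' x' where L: "L = dcube d c k x" "L' = dcube d c k' x'"
    using assms(1,2) by (auto simp: dgrid_def)
  have "k \<le> k'" using assms(3) unfolding L by simp
  then show ?thesis using dcube_nested assms(4,5) unfolding L by blast
qed

lemma dgrid_is_cube: "L \<in> dgrid d c \<Longrightarrow> is_cube d L"
  by (auto simp: dgrid_def is_cube_dcube)

lemma dgrid_nonempty: "L \<in> dgrid d c \<Longrightarrow> cset d L \<noteq> {}"
  unfolding dgrid_def using dcube_self by blast

text \<open>
  The members of a family that lie in no larger member. The bound on the sidelengths puts each point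
  of the union below a largest cube, and nestedness makes distinct largest cubes disjoint.
\<close>

lemma maximal_dyadic_cubes:
  assumes G: "\<G> \<subseteq> dgrid d c" and K: "\<And>L. L \<in> \<G> \<Longrightarrow> side L \<le> 2 powi K"
  obtains \<M> where "\<M> \<subseteq> \<G>" "disjoint_family_on (cset d) \<M>" "(\<Union>L\<in>\<M>. cset d L) = (\<Union>L\<in>\<G>. cset d L)"
    "\<And>L L'. L \<in> \<M> \<Longrightarrow> L' \<in> \<G> \<Longrightarrow> cset d L \<subseteq> cset d L' \<Longrightarrow> side L \<le> side L' \<Longrightarrow> L' = L"
proof -
  define \<M> where "\<M> = {L\<in>\<G>. \<forall>L'\<in>\<G>. cset d L \<subseteq> cset d L' \<longrightarrow> side L \<le> side L' \<longrightarrow> L' = L}"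
  have 1: "disjoint_family_on (cset d) \<M>"
    unfolding disjoint_family_on_def
  proof (intro ballI impI)
    fix L L' assume *: "L \<in> \<M>" "L' \<in> \<M>" "L \<noteq> L'"
    show "cset d L \<inter> cset d L' = {}"
    proof (rule ccontr)
      assume "cset d L \<inter> cset d L' \<noteq> {}"
      then obtain y where y: "y \<in> cset d L" "y \<in> cset d L'" by auto
      have "L \<in> dgrid d c" "L' \<in> dgrid d c" using * G by (auto simp: \<M>_def)
      then have "side L \<le> side L' \<Longrightarrow> cset d L \<subseteq> cset d L'" "side L' \<le> side L \<Longrightarrow> cset d L' \<subseteq> cset d L"
        using dgrid_nested y by blast+
      then show False using * unfolding \<M>_def by (metis (mono_tags, lifting) linorder_linear mem_Collect_eq)
    qed
  qed
  have 2: "(\<Union>L\<in>\<G>. cset d L) \<subseteq> (\<Union>L\<in>\<M>. cset d L)"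
  proof
    fix x assume "x \<in> (\<Union>L\<in>\<G>. cset d L)"
    then obtain L0 where L0: "L0 \<in> \<G>" "x \<in> cset d L0" by auto
    have xR: "x \<in> Rd d" using L0 cset_subset_Rd by blast
    define Z where "Z = {k. k \<le> K \<and> dcube d c k x \<in> \<G>}"
    have rep: "\<exists>k. k \<le> K \<and> L = dcube d c k x" if L0: "L \<in> \<G>" "x \<in> cset d L" for L
    proof -
      obtain k y where L: "L = dcube d c k y" using L0 G unfolding dgrid_def by blast
      then have "L = dcube d c k x" using L0 dcube_eqI by metis
      moreover have "k \<le> K" using K[OF L0(1)] unfolding L by simp
      ultimately show ?thesis by blast
    qed
    \<comment> \<open>only scales above that of \<open>L0\<close> are compared, which makes the set of candidates finite\<close>
    obtain k0 where k0: "k0 \<in> Z" using rep[OF L0] L0(1) unfolding Z_def by blast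
    define m where "m = Max {k\<in>Z. k0 \<le> k}"
    have fin: "finite {k\<in>Z. k0 \<le> k}"
      by (rule finite_subset[of _ "{k0..K}"]) (auto simp: Z_def)
    have m: "m \<in> Z" "k0 \<le> m" using Max_in[OF fin] k0 unfolding m_def by auto
    have mmax: "k \<le> m" if "k \<in> Z" for k
      using Max_ge[OF fin, of k] that m(2) unfolding m_def by (cases "k0 \<le> k") auto
    have "dcube d c m x \<in> \<M>"
      unfolding \<M>_def
    proof (intro CollectI conjI ballI impI)
      show "dcube d c m x \<in> \<G>" using m by (auto simp: Z_def)
      fix L' assume L': "L' \<in> \<G>" "cset d (dcube d c m x) \<subseteq> cset d L'" "side (dcube d c m x) \<le> side L'"
      have "x \<in> cset d L'" using dcube_self[OF xR] L'(2) by blast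
      then obtain k where k: "k \<le> K" "L' = dcube d c k x" using rep L'(1) by blast
      then have "k \<in> Z" using L'(1) by (auto simp: Z_def)
      then have "k \<le> m" by (rule mmax)
      moreover have "m \<le> k" using L'(3) k by simp
      ultimately show "L' = dcube d c m x" using k by simp
    qed
    then show "x \<in> (\<Union>L\<in>\<M>. cset d L)" using dcube_self[OF xR] by blast
  qed
  have 3: "\<M> \<subseteq> \<G>" by (auto simp: \<M>_def)
  show thesis
  proof (rule that[of \<M>])
    show "(\<Union>L\<in>\<M>. cset d L) = (\<Union>L\<in>\<G>. cset d L)" using 2 3 by blast
    show "L' = L" if "L \<in> \<M>" "L' \<in> \<G>" "cset d L \<subseteq> cset d L'" "side L \<le> side L'" for L L'
      using that unfolding \<M>_def by blast
  qed (rule 3, rule 1)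
qed

section \<open>Open sets and dyadic covers\<close>

text \<open>
  Openness relative to the space of points, expressed through the maximum distance, for which balls
  are cubes. Points are constant in the coordinates beyond the dimension.
\<close>

definition rd_open :: "nat \<Rightarrow> pt set \<Rightarrow> bool" where
  "rd_open d V \<longleftrightarrow> V \<subseteq> Rd d \<and>
     (\<forall>x\<in>V. \<exists>e>0. \<forall>y\<in>Rd d. (\<forall>i<d. \<bar>y i - x i\<bar> < e) \<longrightarrow> y \<in> V)"

lemma rd_openI:
  assumes "V \<subseteq> Rd d" "\<And>x. x \<in> V \<Longrightarrow> \<exists>e>0. \<forall>y\<in>Rd d. (\<forall>i<d. \<bar>y i - x i\<bar> < e) \<longrightarrow> y \<in> V"
  shows "rd_open d V"
  using assms by (simp add: rd_open_def)

lemma rd_openE: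
  assumes "rd_open d V" "x \<in> V"
  obtains e where "e > 0" "\<And>y. y \<in> Rd d \<Longrightarrow> (\<And>i. i < d \<Longrightarrow> \<bar>y i - x i\<bar> < e) \<Longrightarrow> y \<in> V"
proof -
  obtain e where "e > 0" "\<forall>y\<in>Rd d. (\<forall>i<d. \<bar>y i - x i\<bar> < e) \<longrightarrow> y \<in> V"
    using assms by (auto simp: rd_open_def)
  then show thesis by (intro that[of e]) simp_all
qed

lemma rd_open_subset: "rd_open d V \<Longrightarrow> V \<subseteq> Rd d"
  by (simp add: rd_open_def)

lemma rd_open_UN:
  assumes "\<And>i. i \<in> I \<Longrightarrow> rd_open d (V i)" shows "rd_open d (\<Union>i\<in>I. V i)"
proof (rule rd_openI)
  show "(\<Union>i\<in>I. V i) \<subseteq> Rd d" using assms rd_open_subset by (intro UN_least) simp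
  fix x assume "x \<in> (\<Union>i\<in>I. V i)"
  then obtain i where i: "i \<in> I" "x \<in> V i" by auto
  then obtain e where "e > 0" "\<And>y. y \<in> Rd d \<Longrightarrow> (\<And>i. i < d \<Longrightarrow> \<bar>y i - x i\<bar> < e) \<Longrightarrow> y \<in> V i"
    using rd_openE[OF assms] by metis
  then show "\<exists>e>0. \<forall>y\<in>Rd d. (\<forall>i<d. \<bar>y i - x i\<bar> < e) \<longrightarrow> y \<in> (\<Union>i\<in>I. V i)"
    using i(1) by (intro exI[of _ e]) auto
qed

lemma rd_open_Un:
  assumes "rd_open d V" "rd_open d W" shows "rd_open d (V \<union> W)"
proof -
  have "rd_open d (\<Union>i\<in>{V, W}. i)" using assms by (intro rd_open_UN) auto
  then show ?thesis by simp
qed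

lemma rd_open_Int:
  assumes "rd_open d V" "rd_open d W" shows "rd_open d (V \<inter> W)"
proof (rule rd_openI)
  show "V \<inter> W \<subseteq> Rd d" using assms(1) rd_open_subset by (intro le_infI1)
  fix x assume x: "x \<in> V \<inter> W"
  obtain e where e: "e > 0" "\<And>y. y \<in> Rd d \<Longrightarrow> (\<And>i. i < d \<Longrightarrow> \<bar>y i - x i\<bar> < e) \<Longrightarrow> y \<in> V"
    using rd_openE[OF assms(1)] x by (metis IntD1)
  obtain e' where e': "e' > 0" "\<And>y. y \<in> Rd d \<Longrightarrow> (\<And>i. i < d \<Longrightarrow> \<bar>y i - x i\<bar> < e') \<Longrightarrow> y \<in> W"
    using rd_openE[OF assms(2)] x by (metis IntD2)
  show "\<exists>e>0. \<forall>y\<in>Rd d. (\<forall>i<d. \<bar>y i - x i\<bar> < e) \<longrightarrow> y \<in> V \<inter> W"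
    using e e' by (intro exI[of _ "min e e'"]) auto
qed

lemma rd_open_box:
  assumes "\<And>i. i < d \<Longrightarrow> open (X i)"
  shows "rd_open d {x \<in> Rd d. \<forall>i<d. x i \<in> X i}"
proof (rule rd_openI)
  fix x assume x: "x \<in> {x \<in> Rd d. \<forall>i<d. x i \<in> X i}"
  have "\<exists>e>0. \<forall>t. \<bar>t - x i\<bar> < e \<longrightarrow> t \<in> X i" if "i < d" for i
    using assms[OF that] x that unfolding open_dist by (auto simp: dist_real_def)
  then obtain e where e: "\<And>i. i < d \<Longrightarrow> e i > 0" "\<And>i t. i < d \<Longrightarrow> \<bar>t - x i\<bar> < e i \<Longrightarrow> t \<in> X i"
    by metis
  define m where "m = Min (insert 1 (e ` {..<d}))"
  have m: "m > 0" "\<And>i. i < d \<Longrightarrow> m \<le> e i"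
    using e(1) by (auto simp: m_def)
  show "\<exists>e>0. \<forall>y\<in>Rd d. (\<forall>i<d. \<bar>y i - x i\<bar> < e) \<longrightarrow> y \<in> {x \<in> Rd d. \<forall>i<d. x i \<in> X i}"
  proof (intro exI[of _ m] conjI ballI impI)
    fix y assume y: "y \<in> Rd d" "\<forall>i<d. \<bar>y i - x i\<bar> < m"
    have "y i \<in> X i" if "i < d" for i
      using e(2)[OF that, of "y i"] m(2)[OF that] y(2) that by (meson less_le_trans)
    then show "y \<in> {x \<in> Rd d. \<forall>i<d. x i \<in> X i}" using y(1) by simp
  qed (rule m(1))
qed auto

lemma rd_open_ocset: "rd_open d (ocset d Q)"
proof -
  have "ocset d Q = {x \<in> Rd d. \<forall>i<d. x i \<in> {corner Q i <..< corner Q i + side Q}}"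
    by (auto simp: ocset_def)
  then show ?thesis using rd_open_box[of d "\<lambda>i. {corner Q i <..< corner Q i + side Q}"] by simp
qed

lemma rd_open_open:
  assumes U: "open U" shows "rd_open d (U \<inter> Rd d)"
proof (rule rd_openI)
  fix x assume x: "x \<in> U \<inter> Rd d"
  have "openin (product_topology (\<lambda>i. euclidean) UNIV) U"
    using U by (simp add: open_fun_def)
  from product_topology_open_contains_basis[OF this, of x] x
  obtain X where X: "x \<in> (\<Pi>\<^sub>E i\<in>UNIV. X i)" "\<And>i. open (X i)" "(\<Pi>\<^sub>E i\<in>UNIV. X i) \<subseteq> U"
    by auto
  let ?B = "{y \<in> Rd d. \<forall>i<d. y i \<in> X i}"
  have "?B \<subseteq> U \<inter> Rd d"
  proof
    fix y assume y: "y \<in> ?B"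
    have "y i \<in> X i" for i
    proof (cases "i < d")
      case False
      then have "y i = x i" using x y by (auto simp: Rd_def PiE_def extensional_def)
      then show ?thesis using X(1) by auto
    qed (use y in auto)
    then show "y \<in> U \<inter> Rd d" using X(3) y by (auto simp: PiE_def)
  qed
  moreover have "\<exists>e>0. \<forall>y\<in>Rd d. (\<forall>i<d. \<bar>y i - x i\<bar> < e) \<longrightarrow> y \<in> ?B"
  proof -
    have "rd_open d ?B" using X(2) by (intro rd_open_box)
    moreover have "x \<in> ?B" using X(1) x by auto
    ultimately show ?thesis unfolding rd_open_def by (elim conjE bspec)
  qed
  ultimately show "\<exists>e>0. \<forall>y\<in>Rd d. (\<forall>i<d. \<bar>y i - x i\<bar> < e) \<longrightarrow> y \<in> U \<inter> Rd d"
    by (elim exE) (rule exI, auto)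
qed auto

lemma dist_dil_dcube:
  assumes "1 \<le> a" "x \<in> Rd d" "y \<in> cset d (dil d a (dcube d c k x))" "i < d"
  shows "\<bar>y i - x i\<bar> \<le> a * 2 powi k"
proof -
  let ?s = "2 powi k :: real"
  define r where "r = corner (dcube d c k x) i"
  have y: "r - (a - 1) / 2 * ?s \<le> y i" "y i < r + (a + 1) / 2 * ?s"
    using assms(3,4) unfolding cset_dil r_def by auto
  have x: "r \<le> x i" "x i < r + ?s"
    using dcube_self[OF assms(2), of c k] assms(4) unfolding cset_def r_def by auto
  have "(a - 1) / 2 * ?s + ?s \<le> a * ?s" "(a + 1) / 2 * ?s \<le> a * ?s"
    using assms(1) by (auto simp: field_simps)
  then show ?thesis using x y by linarith
qed

lemma small_dil_dcube:
  assumes "rd_open d V" "x \<in> V" "1 \<le> a"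
  obtains k where "k \<le> K" "cset d (dil d a (dcube d c k x)) \<subseteq> V"
proof -
  obtain e where e: "e > 0" "\<And>y. y \<in> Rd d \<Longrightarrow> (\<And>i. i < d \<Longrightarrow> \<bar>y i - x i\<bar> < e) \<Longrightarrow> y \<in> V"
    using rd_openE[OF assms(1,2)] by metis
  have xR: "x \<in> Rd d" using rd_open_subset[OF assms(1)] assms(2) by auto
  obtain n where n: "(1/2::real) ^ n < e / a"
    using real_arch_pow_inv[of "e / a" "1/2"] e assms(3) by auto
  define k where "k = min K (- int n)"
  have "(2::real) powi k \<le> 2 powi (- int n)" by (simp add: k_def)
  also have "\<dots> = (1/2) ^ n" by (simp add: power_int_minus power_one_over inverse_eq_divide)
  also have "\<dots> < e / a" by (rule n)
  finally have "a * 2 powi k < e" using assms(3) by (simp add: field_simps)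
  then have "cset d (dil d a (dcube d c k x)) \<subseteq> V"
    using dist_dil_dcube[OF assms(3) xR, where c = c and k = k] cset_subset_Rd[of d "dil d a (dcube d c k x)"]
    by (intro subsetI e(2)) fastforce+
  then show ?thesis by (intro that[of k]) (simp_all add: k_def)
qed

lemma rd_open_eq_UN_dyadic:
  assumes "rd_open d V"
  shows "V = (\<Union>L\<in>{L\<in>dgrid d c. side L \<le> 2 powi K \<and> cset d L \<subseteq> V}. cset d L)"
proof
  show "V \<subseteq> (\<Union>L\<in>{L\<in>dgrid d c. side L \<le> 2 powi K \<and> cset d L \<subseteq> V}. cset d L)"
  proof
    fix x assume x: "x \<in> V"
    then have xR: "x \<in> Rd d" using assms by (auto simp: rd_open_def)
    obtain k where k: "k \<le> K" "cset d (dil d 1 (dcube d c k x)) \<subseteq> V"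
      using small_dil_dcube[OF assms x, of 1 K c] by auto
    have "cset d (dcube d c k x) \<subseteq> V"
      using k(2) cset_subset_dil[of 1 "dcube d c k x" d] by simp
    then show "x \<in> (\<Union>L\<in>{L\<in>dgrid d c. side L \<le> 2 powi K \<and> cset d L \<subseteq> V}. cset d L)"
      using dcube_self[OF xR, of c k] k(1) xR unfolding dgrid_def
      by (intro UN_I[of "dcube d c k x"]) auto
  qed
qed auto

lemma rd_open_leb: assumes "rd_open d V" shows "V \<in> sets (leb d)"
proof -
  have "countable {L\<in>dgrid d 0. side L \<le> 2 powi 0 \<and> cset d L \<subseteq> V}"
    using countable_dgrid by (rule countable_subset[rotated]) auto
  then show ?thesis
    by (subst rd_open_eq_UN_dyadic[OF assms, of 0 0]) (auto intro!: sets.countable_UN')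
qed

text \<open>
  Outer regularity of Lebesgue measure, with the open superset split into its maximal dyadic
  subcubes. Restriction to the open box \<open>R'\<close> around \<open>R\<close> makes the measure finite, as regularity
  demands, without spoiling openness. The factor 2 stands for any factor greater than 1.
\<close>

lemma dyadic_cover:
  assumes A: "A \<in> sets (leb d)" "A \<subseteq> cset d R" "0 < side R" "0 < emeasure (leb d) A"
  obtains \<J> where "\<J> \<subseteq> dgrid d c" "disjoint_family_on (cset d) \<J>" "A \<subseteq> (\<Union>L\<in>\<J>. cset d L)"
    "emeasure (leb d) (\<Union>L\<in>\<J>. cset d L) \<le> 2 * emeasure (leb d) A"
proof -
  \<comment> \<open>a Borel set containing \<open>A\<close> with the same measure\<close>
  obtain B where B: "A \<subseteq> B" "B \<in> sets (bleb d)" "emeasure (leb d) A = emeasure (bleb d) B"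
    using completion_upper[of A "bleb d"] A(1) unfolding leb_def by metis
  define R' where "R' = ocset d (dil d 3 R)"
  have R'm: "R' \<in> sets (leb d)" by (simp add: R'_def)
  have R'b [measurable]: "R' \<in> sets (bleb d)"
  proof -
    have "R' = (\<Pi>\<^sub>E i\<in>{..<d}. {corner (dil d 3 R) i <..< corner (dil d 3 R) i + side (dil d 3 R)})"
      by (auto simp: R'_def ocset_def Rd_def PiE_def Pi_def extensional_def)
    then show ?thesis by (auto intro!: sets_PiM_I_finite)
  qed
  have AR': "A \<subseteq> R'"
    using A(2,3) unfolding R'_def ocset_dil cset_def by (force simp: field_simps)
  have R'fin: "emeasure (leb d) R' < \<infinity>"
  proof -
    have "emeasure (leb d) R' \<le> emeasure (leb d) (cset d (dil d 3 R))"
      unfolding R'_def by (intro emeasure_mono ocset_subset_cset) simp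
    also have "\<dots> < \<infinity>" using A(3) by (simp add: emeasure_cset)
    finally show ?thesis .
  qed
  define N where "N = distr (density (bleb d) (indicator R')) borel (\<lambda>x. x)"
  have idm: "(\<lambda>x. x) \<in> bleb d \<rightarrow>\<^sub>M borel"
  proof (rule measurable_coordinatewise_then_product)
    fix i
    show "(\<lambda>x. x i) \<in> borel_measurable (bleb d)"
    proof (cases "i < d")
      case True then show ?thesis by simp
    next
      case False
      then have "(\<lambda>x. x i) \<in> borel_measurable (bleb d) \<longleftrightarrow> (\<lambda>x. undefined::real) \<in> borel_measurable (bleb d)"
        by (intro measurable_cong) (auto simp: Rd_def PiE_def extensional_def)
      then show ?thesis by simp
    qed
  qed
  have N: "emeasure N X = emeasure (bleb d) (X \<inter> R')" if X: "X \<in> sets borel" for X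
  proof -
    have XR: "X \<inter> Rd d \<in> sets (bleb d)"
      using measurable_sets[OF idm X] by (simp add: vimage_def Int_def)
    have "emeasure N X = emeasure (density (bleb d) (indicator R')) (X \<inter> Rd d)"
      unfolding N_def using X idm by (subst emeasure_distr) (auto simp: vimage_def Int_def)
    also have "\<dots> = (\<integral>\<^sup>+x. indicator R' x * indicator (X \<inter> Rd d) x \<partial>bleb d)"
      using XR by (subst emeasure_density) auto
    also have "\<dots> = (\<integral>\<^sup>+x. indicator (X \<inter> R') x \<partial>bleb d)"
      by (intro nn_integral_cong) (auto simp: indicator_def R'_def ocset_def)
    also have "\<dots> = emeasure (bleb d) (X \<inter> R')"
    proof (rule nn_integral_indicator)
      have "X \<inter> R' = (X \<inter> Rd d) \<inter> R'" by (auto simp: R'_def ocset_def)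
      then show "X \<inter> R' \<in> sets (bleb d)" using XR R'b by auto
    qed
    finally show ?thesis .
  qed
  define B' where "B' = (\<lambda>x. restrict x {..<d}) -` B"
  have Bb: "B' \<in> sets borel"
  proof -
    have "(\<lambda>x. restrict x {..<d}) \<in> borel \<rightarrow>\<^sub>M bleb d"
      by (rule measurable_restrict) (simp add: measurable_product_coordinates)
    from measurable_sets[OF this B(2)] show ?thesis by (simp add: B'_def)
  qed
  have res: "restrict x {..<d} = x" if "x \<in> Rd d" for x
    using that by (simp add: Rd_def PiE_def extensional_restrict)
  have "R' \<subseteq> Rd d" by (auto simp: R'_def ocset_def)
  then have B'R': "B' \<inter> R' \<subseteq> B"
    using res by (auto simp: B'_def dest!: subsetD)
  have AB': "A \<subseteq> B'"
  proof
    fix x assume "x \<in> A"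
    then have "x \<in> Rd d" "x \<in> B" using A(2) B(1) cset_subset_Rd by blast+
    then show "x \<in> B'" using res by (simp add: B'_def)
  qed
  have Nle: "emeasure N X \<le> emeasure (leb d) R'" if "X \<in> sets borel" for X
  proof -
    have "emeasure N X \<le> emeasure (bleb d) R'"
      unfolding N[OF that] by (rule emeasure_mono) (use R'b in auto)
    then show ?thesis by (simp add: emeasure_leb_bleb R'b)
  qed
  have sN: "sets N = sets borel" by (simp add: N_def)
  have "emeasure N (space N) \<noteq> \<infinity>"
    using Nle[of "space N"] R'fin sN by (metis sets.top neq_top_trans not_less_iff_gr_or_eq infinity_ennreal_def)
  then have "emeasure N B' = (INF U\<in>{U. B' \<subseteq> U \<and> open U}. emeasure N U)"
    using Bb sN by (intro outer_regular)
  moreover have "emeasure N B' < 2 * emeasure (leb d) A"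
  proof -
    have "emeasure N B' \<le> emeasure (bleb d) B"
      unfolding N[OF Bb] by (rule emeasure_mono) (use B'R' B(2) in auto)
    also have "\<dots> = emeasure (leb d) A" using B(3) by simp
    also have "\<dots> < 2 * emeasure (leb d) A"
    proof -
      have "emeasure (leb d) A \<le> emeasure (leb d) R'"
        using AR' R'm by (rule emeasure_mono)
      then obtain a where a: "emeasure (leb d) A = ennreal a" "0 \<le> a"
        using R'fin by (cases "emeasure (leb d) A") (auto simp: top_unique)
      then have "0 < a" using A(4) by simp
      then have "ennreal a < ennreal (2 * a)" by (intro ennreal_lessI) auto
      then show ?thesis using a by (simp add: ennreal_mult)
    qed
    finally show ?thesis .
  qed
  ultimately obtain U where U: "B' \<subseteq> U" "open U" "emeasure N U < 2 * emeasure (leb d) A"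
    by (auto simp: INF_less_iff)
  define V where "V = (U \<inter> Rd d) \<inter> R'"
  have V: "rd_open d V"
    unfolding V_def R'_def by (intro rd_open_Int rd_open_open rd_open_ocset U)
  have Vm: "emeasure (leb d) V \<le> 2 * emeasure (leb d) A"
  proof -
    have "V = U \<inter> R'" using \<open>R' \<subseteq> Rd d\<close> by (auto simp: V_def)
    moreover have "U \<inter> R' \<in> sets (bleb d)"
    proof -
      have "U \<inter> Rd d \<in> sets (bleb d)"
        using measurable_sets[OF idm, of U] U(2) by (simp add: vimage_def Int_def)
      then have "(U \<inter> Rd d) \<inter> R' \<in> sets (bleb d)" using R'b by (rule sets.Int)
      moreover have "(U \<inter> Rd d) \<inter> R' = U \<inter> R'" using \<open>R' \<subseteq> Rd d\<close> by auto
      ultimately show ?thesis by simp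
    qed
    then have "emeasure (bleb d) (U \<inter> R') = emeasure (leb d) (U \<inter> R')"
      by (simp add: emeasure_leb_bleb)
    ultimately show ?thesis using N[of U] U by simp
  qed
  have AV: "A \<subseteq> V" using U(1) AB' AR' \<open>R' \<subseteq> Rd d\<close> by (auto simp: V_def)
  define \<G> where "\<G> = {L\<in>dgrid d c. side L \<le> 2 powi 0 \<and> cset d L \<subseteq> V}"
  have VG: "V = (\<Union>L\<in>\<G>. cset d L)"
    unfolding \<G>_def by (rule rd_open_eq_UN_dyadic[OF V])
  obtain \<J> where J: "\<J> \<subseteq> \<G>" "disjoint_family_on (cset d) \<J>" "(\<Union>L\<in>\<J>. cset d L) = (\<Union>L\<in>\<G>. cset d L)"
  proof (rule maximal_dyadic_cubes[of \<G> d c 0])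
    show "\<G> \<subseteq> dgrid d c" "\<And>L. L \<in> \<G> \<Longrightarrow> side L \<le> 2 powi 0"
      by (auto simp: \<G>_def)
  qed
  show thesis
  proof (rule that[of \<J>])
    show "\<J> \<subseteq> dgrid d c" using J(1) by (auto simp: \<G>_def)
    show "A \<subseteq> (\<Union>L\<in>\<J>. cset d L)" using AV VG J(3) by simp
    show "emeasure (leb d) (\<Union>L\<in>\<J>. cset d L) \<le> 2 * emeasure (leb d) A" using Vm VG J(3) by simp
  qed (rule J(2))
qed

section \<open>Averages over tripled dyadic cubes\<close>

text \<open>
  Heavy cubes are tested on their threefold dilates, and the heavy set is the union of the interiors
  of these dilates. It plays the role of a superlevel set of the maximal function, but it comes from a
  countable family and is open by construction.
\<close>

definition heavy :: "nat \<Rightarrow> real \<Rightarrow> (pt \<Rightarrow> ennreal) \<Rightarrow> real \<Rightarrow> cube set" where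
  "heavy d c w t = {L\<in>dgrid d c. ennreal t * vol d (dil d 3 L) < emeasure (density (leb d) w) (cset d (dil d 3 L))}"

definition heavy_set :: "nat \<Rightarrow> real \<Rightarrow> (pt \<Rightarrow> ennreal) \<Rightarrow> real \<Rightarrow> pt set" where
  "heavy_set d c w t = (\<Union>L\<in>heavy d c w t. ocset d (dil d 3 L))"

lemma rd_open_heavy_set: "rd_open d (heavy_set d c w t)"
  unfolding heavy_set_def by (intro rd_open_UN rd_open_ocset)

text \<open>
  Vitali's selection: a largest cube of the family, tripled, swallows all the cubes that meet it, and
  the remaining cubes are treated by induction.
\<close>

lemma finite_Vitali:
  assumes "finite F" "\<And>Q. Q \<in> F \<Longrightarrow> 0 < side Q"
  shows "\<exists>G\<subseteq>F. disjoint_family_on (cset d) G \<and> (\<Union>Q\<in>F. cset d Q) \<subseteq> (\<Union>Q\<in>G. cset d (dil d 3 Q))"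
  using assms
proof (induction F rule: finite_psubset_induct)
  case (psubset F)
  show ?case
  proof (cases "F = {}")
    case True
    then show ?thesis by (intro exI[of _ "{}"]) (auto simp: disjoint_family_on_def)
  next
    case False
    obtain Q where Q: "Q \<in> F" "\<And>R. R \<in> F \<Longrightarrow> side R \<le> side Q"
      using Max_in[of "side ` F"] Max_ge[of "side ` F"] False psubset.hyps(1)
      by (metis (no_types, lifting) finite_imageI image_iff image_is_empty)
    define F' where "F' = {R\<in>F - {Q}. cset d R \<inter> cset d Q = {}}"
    have "F' \<subset> F" using Q by (auto simp: F'_def)
    then obtain G' where G': "G' \<subseteq> F'" "disjoint_family_on (cset d) G'"
        "(\<Union>Q\<in>F'. cset d Q) \<subseteq> (\<Union>Q\<in>G'. cset d (dil d 3 Q))"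
    proof -
      have "\<exists>G\<subseteq>F'. disjoint_family_on (cset d) G \<and> (\<Union>Q\<in>F'. cset d Q) \<subseteq> (\<Union>Q\<in>G. cset d (dil d 3 Q))"
        by (rule psubset.IH[OF \<open>F' \<subset> F\<close>]) (use psubset.prems F'_def in simp)
      then show ?thesis using that by (elim exE conjE) 
    qed
    have sw: "cset d R \<subseteq> cset d (dil d 3 Q)" if RF: "R \<in> F" "R \<notin> F'" for R
    proof (cases "R = Q")
      case True
      then show ?thesis using cset_subset_dil[of 3 Q] psubset.prems Q by simp
    next
      case False
      then obtain z where z: "z \<in> cset d R" "z \<in> cset d Q" using RF by (auto simp: F'_def)
      show ?thesis
      proof
        fix x assume x: "x \<in> cset d R"
        have "side R \<le> side Q" using Q RF by blast
        then show "x \<in> cset d (dil d 3 Q)"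
          using x z unfolding cset_dil by (auto simp: cset_def) (smt (verit))+
      qed
    qed
    have "disjoint_family_on (cset d) (insert Q G')"
      using G'(1,2) unfolding disjoint_family_on_def F'_def by blast
    moreover have "(\<Union>R\<in>F. cset d R) \<subseteq> (\<Union>R\<in>insert Q G'. cset d (dil d 3 R))"
    proof
      fix x assume "x \<in> (\<Union>R\<in>F. cset d R)"
      then obtain R where R: "R \<in> F" "x \<in> cset d R" by blast
      show "x \<in> (\<Union>R\<in>insert Q G'. cset d (dil d 3 R))"
      proof (cases "R \<in> F'")
        case True then show ?thesis using R G'(3) by auto
      next
        case False then show ?thesis using R sw by auto
      qed
    qed
    moreover have "insert Q G' \<subseteq> F" using G'(1) Q by (auto simp: F'_def)
    ultimately show ?thesis by blast
  qed
qed

lemma emeasure_UN_countable_le: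
  assumes "countable I" "\<And>i. i \<in> I \<Longrightarrow> X i \<in> sets M"
    "\<And>F. finite F \<Longrightarrow> F \<subseteq> I \<Longrightarrow> emeasure M (\<Union>i\<in>F. X i) \<le> B"
  shows "emeasure M (\<Union>i\<in>I. X i) \<le> B"
proof (cases "I = {}")
  case True
  then show ?thesis by simp
next
  case False
  define e where "e = from_nat_into I"
  have e: "e n \<in> I" for n using from_nat_into[OF False] by (simp add: e_def)
  have I: "I = range e" using range_from_nat_into[OF False assms(1)] by (simp add: e_def)
  have "(\<Union>i\<in>I. X i) = (\<Union>n. \<Union>i\<in>e ` {..n}. X i)" unfolding I by auto
  also have "emeasure M \<dots> = (SUP n. emeasure M (\<Union>i\<in>e ` {..n}. X i))"
    by (intro SUP_emeasure_incseq[symmetric]) (use assms(2) e in \<open>force simp: incseq_def intro!: sets.finite_UN\<close>)+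
  also have "\<dots> \<le> B"
    by (intro SUP_least assms(3)) (use e in auto)
  finally show ?thesis .
qed

text \<open>
  Finitely many heavy dilates contain disjoint ones whose triples cover the union; each of the
  selected ones carries its share of the mass of \<open>w\<close>.
\<close>

lemma weak_type:
  assumes w: "w \<in> borel_measurable (leb d)"
  shows "ennreal t * emeasure (leb d) (heavy_set d c w t) \<le> 3 ^ d * (\<integral>\<^sup>+x. w x \<partial>leb d)"
proof (cases "t > 0")
  case False
  then show ?thesis by (simp add: ennreal_neg)
next
  case t: True
  let ?N = "density (leb d) w"
  let ?B = "3 ^ d * (\<integral>\<^sup>+x. w x \<partial>leb d)" and ?M = "density (leb d) (\<lambda>_. ennreal t)"
  have M: "emeasure ?M A = ennreal t * emeasure (leb d) A" if "A \<in> sets (leb d)" for A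
    using that by (rule emeasure_density_const)
  have sub: "heavy d c w t \<subseteq> dgrid d c" by (auto simp: heavy_def)
  have "emeasure ?M (\<Union>L\<in>heavy d c w t. cset d (dil d 3 L)) \<le> ?B"
  proof (rule emeasure_UN_countable_le)
    show "countable (heavy d c w t)" using countable_dgrid sub by (rule countable_subset[rotated])
    fix F assume F: "finite F" "F \<subseteq> heavy d c w t"
    let ?F = "dil d 3 ` F"
    have pos: "0 < side Q" if "Q \<in> ?F" for Q
      using that F sub dgrid_is_cube by (fastforce simp: is_cube_def)
    obtain G where G: "G \<subseteq> ?F" "disjoint_family_on (cset d) G"
        "(\<Union>Q\<in>?F. cset d Q) \<subseteq> (\<Union>Q\<in>G. cset d (dil d 3 Q))"
      using finite_Vitali[of ?F d] F pos by auto
    have finG: "finite G" using G(1) F(1) finite_surj by blast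
    have vol3: "emeasure (leb d) (cset d (dil d 3 Q)) = 3 ^ d * vol d Q" if "Q \<in> G" for Q
    proof -
      have "0 < side Q" using that G(1) pos by blast
      then show ?thesis
        by (simp add: emeasure_cset vol_eq power_mult_distrib ennreal_mult flip: ennreal_power)
    qed
    have "ennreal t * emeasure (leb d) (\<Union>L\<in>F. cset d (dil d 3 L))
        \<le> ennreal t * (\<Sum>Q\<in>G. emeasure (leb d) (cset d (dil d 3 Q)))"
    proof (rule mult_left_mono)
      have "emeasure (leb d) (\<Union>L\<in>F. cset d (dil d 3 L)) \<le> emeasure (leb d) (\<Union>Q\<in>G. cset d (dil d 3 Q))"
        using G(3) by (intro emeasure_mono) (auto intro!: sets.finite_UN finG)
      also have "\<dots> \<le> (\<Sum>Q\<in>G. emeasure (leb d) (cset d (dil d 3 Q)))"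
        by (intro emeasure_subadditive_finite finG) auto
      finally show "emeasure (leb d) (\<Union>L\<in>F. cset d (dil d 3 L)) \<le> (\<Sum>Q\<in>G. emeasure (leb d) (cset d (dil d 3 Q)))" .
    qed simp
    also have "\<dots> = 3 ^ d * (\<Sum>Q\<in>G. ennreal t * vol d Q)"
      by (simp add: vol3 sum_distrib_left mult_ac cong: sum.cong)
    also have "\<dots> \<le> 3 ^ d * (\<Sum>Q\<in>G. emeasure ?N (cset d Q))"
    proof (intro mult_left_mono sum_mono)
      fix Q assume "Q \<in> G"
      then obtain L where "L \<in> heavy d c w t" "Q = dil d 3 L" using G(1) F(2) by blast
      then show "ennreal t * vol d Q \<le> emeasure ?N (cset d Q)"
        by (simp add: heavy_def less_imp_le)
    qed simp
    also have "(\<Sum>Q\<in>G. emeasure ?N (cset d Q)) = emeasure ?N (\<Union>Q\<in>G. cset d Q)"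
      by (intro sum_emeasure finG G(2)) auto
    also have "\<dots> \<le> emeasure ?N (space ?N)" by (rule emeasure_space)
    also have "\<dots> = (\<integral>\<^sup>+x. w x \<partial>leb d)"
      using w by (subst emeasure_density) (auto intro!: nn_integral_cong)
    finally have "ennreal t * emeasure (leb d) (\<Union>L\<in>F. cset d (dil d 3 L)) \<le> 3 ^ d * (\<integral>\<^sup>+x. w x \<partial>leb d)"
      by (simp add: mult_left_mono)
    then show "emeasure ?M (\<Union>L\<in>F. cset d (dil d 3 L)) \<le> ?B"
      using F(1) by (subst M) (auto intro!: sets.finite_UN)
  qed auto
  moreover have "emeasure ?M (heavy_set d c w t) \<le> emeasure ?M (\<Union>L\<in>heavy d c w t. cset d (dil d 3 L))"
  proof (rule emeasure_mono)
    show "heavy_set d c w t \<subseteq> (\<Union>L\<in>heavy d c w t. cset d (dil d 3 L))"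
      unfolding heavy_set_def using ocset_subset_cset by blast
    show "(\<Union>L\<in>heavy d c w t. cset d (dil d 3 L)) \<in> sets ?M"
      using countable_subset[OF sub countable_dgrid] by (intro sets.countable_UN') auto
  qed
  ultimately have "emeasure ?M (heavy_set d c w t) \<le> ?B" by (rule order_trans[rotated])
  then show ?thesis
    using M[OF rd_open_leb[OF rd_open_heavy_set]] by simp
qed

text \<open>
  A substitute for Lebesgue's differentiation theorem. If \<open>w\<close> exceeded the bound on a set \<open>A\<close> of
  positive measure outside the heavy set, then \<open>A\<close> could be covered efficiently by dyadic cubes
  meeting \<open>A\<close>; none of these is heavy, so \<open>w\<close> has too little mass on them, hence on \<open>A\<close>. Of the
  factor 4, one 2 is lost in the cover and the other yields the contradiction.
\<close>

lemma AE_bounded_off_heavy_set: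
  assumes w: "w \<in> borel_measurable (leb d)" and fin: "(\<integral>\<^sup>+x. w x \<partial>leb d) < \<infinity>" and t: "t > 0"
    and R: "0 < side R" "\<And>x. x \<in> Rd d \<Longrightarrow> x \<notin> cset d R \<Longrightarrow> w x = 0"
  shows "AE x in leb d. x \<notin> heavy_set d c w t \<longrightarrow> w x \<le> ennreal (4 * 3 ^ d * t)"
proof -
  let ?N = "density (leb d) w" and ?T = "ennreal (4 * 3 ^ d * t)"
  define A where "A = {x\<in>space (leb d). ?T < w x} - heavy_set d c w t"
  have Am: "A \<in> sets (leb d)"
    unfolding A_def using w rd_open_leb[OF rd_open_heavy_set] by measurable
  have AR: "A \<subseteq> cset d R" using R(2) by (auto simp: A_def) (metis not_less_zero)
  have NA: "?T * emeasure (leb d) A \<le> emeasure ?N A"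
  proof -
    have "?T * emeasure (leb d) A = (\<integral>\<^sup>+x. ?T * indicator A x \<partial>leb d)"
      using Am by (simp add: nn_integral_cmult_indicator)
    also have "\<dots> \<le> (\<integral>\<^sup>+x. w x * indicator A x \<partial>leb d)"
      by (intro nn_integral_mono) (auto simp: A_def indicator_def)
    finally show ?thesis using w Am by (simp add: emeasure_density)
  qed
  have "emeasure (leb d) A = 0"
  proof (rule ccontr)
    assume "emeasure (leb d) A \<noteq> 0"
    then have pos: "0 < emeasure (leb d) A" by (simp add: zero_less_iff_neq_zero)
    obtain \<J> where J: "\<J> \<subseteq> dgrid d c" "disjoint_family_on (cset d) \<J>" "A \<subseteq> (\<Union>L\<in>\<J>. cset d L)"
      "emeasure (leb d) (\<Union>L\<in>\<J>. cset d L) \<le> 2 * emeasure (leb d) A"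
      using dyadic_cover[OF Am AR R(1) pos] by metis
    define \<J>' where "\<J>' = {L\<in>\<J>. cset d L \<inter> A \<noteq> {}}"
    have J': "\<J>' \<subseteq> dgrid d c" "disjoint_family_on (cset d) \<J>'" "A \<subseteq> (\<Union>L\<in>\<J>'. cset d L)"
    proof -
      show "\<J>' \<subseteq> dgrid d c" "disjoint_family_on (cset d) \<J>'"
        using J(1,2) by (auto simp: \<J>'_def disjoint_family_on_def)
      show "A \<subseteq> (\<Union>L\<in>\<J>'. cset d L)"
        using J(3) unfolding \<J>'_def by blast
    qed
    have cJ': "countable \<J>'" "countable \<J>"
      using countable_subset[OF J'(1) countable_dgrid] countable_subset[OF J(1) countable_dgrid] .
    have light: "emeasure ?N (cset d L) \<le> ennreal (3 ^ d * t) * emeasure (leb d) (cset d L)" if LJ: "L \<in> \<J>'" for L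
    proof -
      obtain x where x: "x \<in> cset d L" "x \<in> A" using LJ by (auto simp: \<J>'_def)
      have s: "0 < side L" using LJ J'(1) dgrid_is_cube by (auto simp: is_cube_def)
      have "x \<in> ocset d (dil d 3 L)"
        using x(1) s unfolding ocset_dil cset_def by (force simp: field_simps)
      then have "L \<notin> heavy d c w t"
        using x(2) by (auto simp: A_def heavy_set_def)
      then have "emeasure ?N (cset d (dil d 3 L)) \<le> ennreal t * vol d (dil d 3 L)"
        using LJ J'(1) by (auto simp: heavy_def not_less)
      moreover have "emeasure ?N (cset d L) \<le> emeasure ?N (cset d (dil d 3 L))"
        using s by (intro emeasure_mono cset_subset_dil) auto
      moreover have "ennreal t * vol d (dil d 3 L) = ennreal (3 ^ d * t) * emeasure (leb d) (cset d L)"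
        using s t by (simp add: vol_eq emeasure_cset power_mult_distrib ennreal_mult' [symmetric] mult_ac)
      ultimately show ?thesis by simp
    qed
    have "?T * emeasure (leb d) A \<le> emeasure ?N (\<Union>L\<in>\<J>'. cset d L)"
      using NA J'(3) cJ' by (elim order_trans) (auto intro!: emeasure_mono sets.countable_UN')
    also have "\<dots> = (\<integral>\<^sup>+L. emeasure ?N (cset d L) \<partial>count_space \<J>')"
      using cJ' J'(2) by (intro emeasure_UN_countable) auto
    also have "\<dots> \<le> (\<integral>\<^sup>+L. ennreal (3 ^ d * t) * emeasure (leb d) (cset d L) \<partial>count_space \<J>')"
      using light by (intro nn_integral_mono) auto
    also have "\<dots> = ennreal (3 ^ d * t) * (\<integral>\<^sup>+L. emeasure (leb d) (cset d L) \<partial>count_space \<J>')"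
      by (intro nn_integral_cmult) auto
    also have "(\<integral>\<^sup>+L. emeasure (leb d) (cset d L) \<partial>count_space \<J>') = emeasure (leb d) (\<Union>L\<in>\<J>'. cset d L)"
      using cJ' J'(2) by (intro emeasure_UN_countable[symmetric]) auto
    also have "\<dots> \<le> emeasure (leb d) (\<Union>L\<in>\<J>. cset d L)"
      using cJ' by (intro emeasure_mono) (auto simp: \<J>'_def intro!: sets.countable_UN')
    also have "\<dots> \<le> 2 * emeasure (leb d) A" by (rule J(4))
    finally have le: "?T * emeasure (leb d) A \<le> ennreal (3 ^ d * t) * (2 * emeasure (leb d) A)"
      by (simp add: mult_left_mono)
    have "emeasure (leb d) A \<le> emeasure (leb d) (cset d R)" using AR by (intro emeasure_mono) auto
    then obtain a where a: "emeasure (leb d) A = ennreal a" "0 \<le> a"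
      using R(1) by (cases "emeasure (leb d) A") (auto simp: emeasure_cset top_unique)
    have "0 < a" using a pos by simp
    have "ennreal (4 * 3 ^ d * t * a) \<le> ennreal (3 ^ d * t * (2 * a))"
      using le t \<open>0 < a\<close> unfolding a(1) by (simp add: ennreal_mult)
    then have "4 * 3 ^ d * t * a \<le> 3 ^ d * t * (2 * a)"
      using t \<open>0 < a\<close> by (subst (asm) ennreal_le_iff) auto
    then show False using t \<open>0 < a\<close> by simp
  qed
  then have "AE x in leb d. x \<notin> A" using Am by (intro AE_not_in) auto
  then show ?thesis
    using AE_space by eventually_elim (auto simp: A_def not_less)
qed

section \<open>Stopping collections\<close>

lemma dil3_dcube_iff:
  "y \<in> cset d (dil d 3 (dcube d c k x)) \<longleftrightarrow> y \<in> Rd d \<and> (\<forall>i<d. \<bar>gix c k y i - gix c k x i\<bar> \<le> 1)"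
proof -
  have "(c + of_int m * 2 powi k - 2 powi k \<le> t \<and> t < c + of_int m * 2 powi k + 2 * 2 powi k)
      \<longleftrightarrow> \<bar>\<lfloor>(t - c) / 2 powi k\<rfloor> - m\<bar> \<le> 1" for m :: int and t
  proof -
    let ?u = "(t - c) / 2 powi k"
    have "(c + of_int m * 2 powi k - 2 powi k \<le> t \<and> t < c + of_int m * 2 powi k + 2 * 2 powi k)
      \<longleftrightarrow> of_int (m - 1) \<le> ?u \<and> ?u < of_int (m + 2)"
      by (simp add: field_simps)
    also have "\<dots> \<longleftrightarrow> m - 1 \<le> \<lfloor>?u\<rfloor> \<and> \<lfloor>?u\<rfloor> < m + 2"
      by (simp only: le_floor_iff floor_less_iff)
    finally show ?thesis by linarith
  qed
  then show ?thesis
    by (auto simp: cset_dil corner_dcube gix_def)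
qed

lemma dcube_subset_dil3:
  assumes "y \<in> cset d (dil d 3 (dcube d c k x))"
  shows "cset d (dcube d c k y) \<subseteq> cset d (dil d 3 (dcube d c k x))"
  using assms unfolding dil3_dcube_iff mem_dcube_iff by (auto simp: dil3_dcube_iff mem_dcube_iff)

text \<open>
  A parent has twice the sidelength of the child and contains it, so its ninefold dilate fits
  into the 32-fold dilate of the child.
\<close>

lemma parent_dil9_subset:
  assumes x: "x \<in> Rd d"
  shows "cset d (dil d 9 (dcube d c (k + 1) x)) \<subseteq> cset d (dil d (2 ^ 5) (dcube d c k x))"
proof
  fix y assume y: "y \<in> cset d (dil d 9 (dcube d c (k + 1) x))"
  let ?s = "2 powi k :: real"
  have s: "?s > 0" by simp
  have s1: "2 powi (k + 1) = 2 * ?s" by (simp add: power_int_add)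
  have "corner (dcube d c k x) i - (2 ^ 5 - 1) / 2 * ?s \<le> y i \<and> y i < corner (dcube d c k x) i + (2 ^ 5 + 1) / 2 * ?s"
    if i: "i < d" for i
  proof -
    define r where "r = corner (dcube d c k x) i"
    define r' where "r' = corner (dcube d c (k + 1) x) i"
    have 1: "r \<le> x i" "x i < r + ?s"
      using dcube_self[OF x, of c k] i unfolding cset_def r_def by auto
    have 2: "r' \<le> x i" "x i < r' + 2 * ?s"
      using dcube_self[OF x, of c "k + 1"] i s1 unfolding cset_def r'_def by auto
    have 3: "r' - 8 * ?s \<le> y i" "y i < r' + 10 * ?s"
      using y i s1 unfolding cset_dil r'_def by auto
    show ?thesis unfolding r_def[symmetric] using 1 2 3 s by (simp; linarith)
  qed
  then show "y \<in> cset d (dil d (2 ^ 5) (dcube d c k x))"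
    using y cset_subset_Rd unfolding cset_dil[of d "2 ^ 5"] by auto
qed

text \<open>
  A cube that is at least eight generations smaller than \<open>L'\<close> and close to it has a parent that is
  still tiny compared with \<open>L'\<close>; hence the parent's ninefold dilate stays inside that of \<open>L'\<close>.
\<close>

lemma parent_dil9_subset_neighbour:
  assumes x: "x \<in> Rd d" and k: "k + 8 \<le> k'"
    and z: "z \<in> cset d (dil d 7 (dcube d c k x))" "z \<in> cset d (dil d 7 (dcube d c k' x'))"
  shows "cset d (dil d 9 (dcube d c (k + 1) x)) \<subseteq> cset d (dil d 9 (dcube d c k' x'))"
proof
  fix y assume y: "y \<in> cset d (dil d 9 (dcube d c (k + 1) x))"
  let ?s = "2 powi k :: real" and ?t = "2 powi k' :: real"
  have s: "?s > 0" by simp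
  have s1: "2 powi (k + 1) = 2 * ?s" by (simp add: power_int_add)
  have "(2::real) powi (k + 8) = 256 * ?s" by (simp add: power_int_add)
  then have st: "256 * ?s \<le> ?t" using k by (metis two_powi_le_iff)
  have "corner (dcube d c k' x') i - 4 * ?t \<le> y i \<and> y i < corner (dcube d c k' x') i + 5 * ?t"
    if i: "i < d" for i
  proof -
    define r where "r = corner (dcube d c k x) i"
    define r' where "r' = corner (dcube d c (k + 1) x) i"
    define u where "u = corner (dcube d c k' x') i"
    have 1: "r \<le> x i" "x i < r + ?s"
      using dcube_self[OF x, of c k] i unfolding cset_def r_def by auto
    have 2: "r' \<le> x i" "x i < r' + 2 * ?s"
      using dcube_self[OF x, of c "k + 1"] i s1 unfolding cset_def r'_def by auto
    have 3: "r' - 8 * ?s \<le> y i" "y i < r' + 10 * ?s"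
      using y i s1 unfolding cset_dil r'_def by auto
    have 4: "r - 3 * ?s \<le> z i" "z i < r + 4 * ?s"
      using z(1) i unfolding cset_dil r_def by auto
    have 5: "u - 3 * ?t \<le> z i" "z i < u + 4 * ?t"
      using z(2) i unfolding cset_dil u_def by auto
    show ?thesis unfolding u_def[symmetric] using 1 2 3 4 5 s st by linarith
  qed
  then show "y \<in> cset d (dil d 9 (dcube d c k' x'))"
    using y cset_subset_Rd unfolding cset_dil[of d 9 "dcube d c k' x'"] by auto
qed

text \<open>
  The Whitney decomposition of an open set \<open>E\<close> into the maximal dyadic cubes whose ninefold dilates
  are contained in \<open>E\<close>. Cubes that leave \<open>3Q\<close> are discarded, which the second stopping condition
  permits: if \<open>3L\<close> meets \<open>2Q\<close>, then \<open>9L\<close> is contained in \<open>3Q\<close>, because \<open>E\<close> is too small to contain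
  ninefold dilates of large cubes.
\<close>

lemma Whitney_stopping_collection:
  assumes d: "d \<ge> 1" and Q: "Q \<in> dgrid d c" and E: "rd_open d E"
    and small: "emeasure (leb d) E \<le> ennreal ((side Q / 2) ^ d)"
  obtains \<Q> where "stopping_collection d (dgrid d c) Q \<Q>"
    "shadow d \<Q> = E \<inter> cset d (dil d 3 Q)"
    "\<And>L. L \<in> \<Q> \<Longrightarrow> \<not> cset d (dil d (2 ^ 5) L) \<subseteq> E"
    "\<And>L. L \<in> \<Q> \<Longrightarrow> 9 * side L \<le> side Q / 2"
proof -
  obtain kQ xQ where Q_eq: "Q = dcube d c kQ xQ" using Q unfolding dgrid_def by blast
  define \<G> where "\<G> = {L\<in>dgrid d c. cset d (dil d 9 L) \<subseteq> E}"
  have G: "\<G> \<subseteq> dgrid d c" by (auto simp: \<G>_def)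
  have sG: "9 * side L \<le> side Q / 2" if L: "L \<in> \<G>" for L
  proof -
    have pos: "0 < side L" using L dgrid_is_cube by (auto simp: \<G>_def is_cube_def)
    have "ennreal ((9 * side L) ^ d) = emeasure (leb d) (cset d (dil d 9 L))"
      using pos by (subst emeasure_cset) auto
    also have "\<dots> \<le> emeasure (leb d) E"
      using L rd_open_leb[OF E] by (intro emeasure_mono) (auto simp: \<G>_def)
    also note small
    finally have "(9 * side L) ^ d \<le> (side Q / 2) ^ d"
      by (subst (asm) ennreal_le_iff) (auto simp: Q_eq)
    then show ?thesis using d pos by (subst (asm) power_mono_iff) (auto simp: Q_eq)
  qed
  have sG': "side L \<le> 2 powi kQ" if "L \<in> \<G>" for L
  proof -
    have "0 < side L" using that dgrid_is_cube by (auto simp: \<G>_def is_cube_def)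
    then show ?thesis using sG[OF that] by (simp add: Q_eq)
  qed
  obtain \<M> where M: "\<M> \<subseteq> \<G>" "disjoint_family_on (cset d) \<M>" "(\<Union>L\<in>\<M>. cset d L) = (\<Union>L\<in>\<G>. cset d L)"
    and Mmax: "\<And>L L'. L \<in> \<M> \<Longrightarrow> L' \<in> \<G> \<Longrightarrow> cset d L \<subseteq> cset d L' \<Longrightarrow> side L \<le> side L' \<Longrightarrow> L' = L"
    using maximal_dyadic_cubes[OF G sG'] by metis
  have EG: "(\<Union>L\<in>\<G>. cset d L) = E"
  proof
    show "(\<Union>L\<in>\<G>. cset d L) \<subseteq> E"
    proof (rule UN_least)
      fix L assume L: "L \<in> \<G>"
      then have "0 < side L" using dgrid_is_cube by (auto simp: \<G>_def is_cube_def)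
      then have "cset d L \<subseteq> cset d (dil d 9 L)" by (intro cset_subset_dil) auto
      then show "cset d L \<subseteq> E" using L by (auto simp: \<G>_def)
    qed
    show "E \<subseteq> (\<Union>L\<in>\<G>. cset d L)"
    proof
      fix x assume x: "x \<in> E"
      then have xR: "x \<in> Rd d" using rd_open_subset[OF E] by auto
      obtain k where "k \<le> 0" "cset d (dil d 9 (dcube d c k x)) \<subseteq> E"
        using small_dil_dcube[OF E x, of 9 0 c] by auto
      then show "x \<in> (\<Union>L\<in>\<G>. cset d L)"
        using dcube_self[OF xR, of c k] xR by (intro UN_I[of "dcube d c k x"]) (auto simp: \<G>_def dgrid_def)
    qed
  qed
  have parent: "\<not> cset d (dil d 9 (dcube d c (k + 1) x)) \<subseteq> E" if L: "dcube d c k x \<in> \<M>" "x \<in> Rd d" for k x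
  proof
    assume "cset d (dil d 9 (dcube d c (k + 1) x)) \<subseteq> E"
    then have "dcube d c (k + 1) x \<in> \<G>" using L(2) unfolding \<G>_def dgrid_def by blast
    moreover have "cset d (dcube d c k x) \<subseteq> cset d (dcube d c (k + 1) x)"
      by (rule dcube_nested[where y = x]) (use L(2) dcube_self in auto)
    ultimately have "dcube d c (k + 1) x = dcube d c k x"
      by (intro Mmax[OF L(1)]) auto
    then have "side (dcube d c (k + 1) x) = side (dcube d c k x)" by simp
    then show False by simp
  qed
  have repM: "\<exists>k x. x \<in> Rd d \<and> L = dcube d c k x" if "L \<in> \<M>" for L
    using that M(1) G unfolding dgrid_def by blast
  have far: "cset d (dil d 7 L) \<inter> cset d (dil d 7 L') = {}"
    if L: "L \<in> \<M>" "L' \<in> \<M>" "8 \<le> scale L' - scale L" for L L'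
  proof (rule ccontr)
    assume "cset d (dil d 7 L) \<inter> cset d (dil d 7 L') \<noteq> {}"
    then obtain z where z: "z \<in> cset d (dil d 7 L)" "z \<in> cset d (dil d 7 L')" by auto
    obtain k x k' x' where rep: "x \<in> Rd d" "L = dcube d c k x" "L' = dcube d c k' x'"
      using repM L(1,2) by metis
    have "k + 8 \<le> k'" using L(3) unfolding rep by simp
    then have "cset d (dil d 9 (dcube d c (k + 1) x)) \<subseteq> cset d (dil d 9 L')"
      using parent_dil9_subset_neighbour rep z by metis
    also have "\<dots> \<subseteq> E" using L(2) M(1) by (auto simp: \<G>_def)
    finally show False using parent L(1) rep by blast
  qed
  define \<Q> where "\<Q> = {L\<in>\<M>. cset d L \<subseteq> cset d (dil d 3 Q)}"
  have QM: "\<Q> \<subseteq> \<M>" by (auto simp: \<Q>_def)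
  have sh: "shadow d \<Q> = E \<inter> cset d (dil d 3 Q)"
  proof
    show "shadow d \<Q> \<subseteq> E \<inter> cset d (dil d 3 Q)"
      using M EG by (auto simp: shadow_def \<Q>_def)
    show "E \<inter> cset d (dil d 3 Q) \<subseteq> shadow d \<Q>"
    proof
      fix y assume y: "y \<in> E \<inter> cset d (dil d 3 Q)"
      then have "y \<in> (\<Union>L\<in>\<M>. cset d L)" using EG M(3) by simp
      then obtain L where L: "L \<in> \<M>" "y \<in> cset d L" by auto
      have yR: "y \<in> Rd d" using y cset_subset_Rd by auto
      have "side L \<le> side (dcube d c kQ y)" using sG' L(1) M(1) by auto
      then have "cset d L \<subseteq> cset d (dcube d c kQ y)"
        using L M(1) G yR dcube_self[OF yR]
        by (intro dgrid_nested[where c = c and y = y]) (auto simp: dgrid_def)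
      also have "\<dots> \<subseteq> cset d (dil d 3 Q)"
        using y unfolding Q_eq by (intro dcube_subset_dil3) auto
      finally show "y \<in> shadow d \<Q>" using L by (auto simp: shadow_def \<Q>_def)
    qed
  qed
  have "stopping_collection d (dgrid d c) Q \<Q>"
    unfolding stopping_collection_def
  proof (intro conjI ballI impI)
    show "\<Q> \<subseteq> dgrid d c" using QM M(1) G by auto
    show "disjoint_family_on (cset d) \<Q>"
      using disjoint_family_on_mono[OF QM M(2)] .
    show "cset d L \<subseteq> cset d (dil d 3 Q)" if "L \<in> \<Q>" for L using that by (simp add: \<Q>_def)
    show "cset d (dil d 7 L) \<inter> cset d (dil d 7 L') = {}"
      if "L \<in> \<Q>" "L' \<in> \<Q>" "\<bar>scale L - scale L'\<bar> \<ge> 8" for L L'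
    proof -
      have "L \<in> \<M>" "L' \<in> \<M>" using that QM by auto
      moreover have "8 \<le> scale L' - scale L \<or> 8 \<le> scale L - scale L'" using that(3) by linarith
      ultimately show ?thesis using far[of L L'] far[of L' L] by blast
    qed
    show "(\<Union>L\<in>{L\<in>\<Q>. cset d (dil d 3 L) \<inter> cset d (dil d 2 Q) \<noteq> {}}. cset d (dil d 9 L)) \<subseteq> shadow d \<Q>"
    proof (rule UN_least)
      fix L assume L: "L \<in> {L\<in>\<Q>. cset d (dil d 3 L) \<inter> cset d (dil d 2 Q) \<noteq> {}}"
      then have LG: "L \<in> \<G>" using QM M(1) by auto
      have pos: "0 < side L" using LG dgrid_is_cube by (auto simp: \<G>_def is_cube_def)
      have LQ: "9 * side L \<le> side Q / 2" by (rule sG[OF LG])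
      obtain z where z: "z \<in> cset d (dil d 3 L)" "z \<in> cset d (dil d 2 Q)" using L by auto
      have "cset d (dil d 9 L) \<subseteq> cset d (dil d 3 Q)"
      proof
        fix w assume w: "w \<in> cset d (dil d 9 L)"
        have "corner Q i - side Q \<le> w i \<and> w i < corner Q i + 2 * side Q" if i: "i < d" for i
        proof -
          have "corner L i - 4 * side L \<le> w i" "w i < corner L i + 5 * side L"
            using w i unfolding cset_dil by auto
          moreover have "corner L i - side L \<le> z i" "z i < corner L i + 2 * side L"
            using z(1) i unfolding cset_dil by auto
          moreover have "corner Q i - side Q / 2 \<le> z i" "z i < corner Q i + 3 / 2 * side Q"
            using z(2) i unfolding cset_dil by auto
          ultimately show ?thesis using LQ pos by linarith
        qed
        then show "w \<in> cset d (dil d 3 Q)"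
          using w cset_subset_Rd unfolding cset_dil[of d 3 Q] by auto
      qed
      then show "cset d (dil d 9 L) \<subseteq> shadow d \<Q>"
        using LG unfolding sh by (auto simp: \<G>_def)
    qed
  qed
  moreover have "\<not> cset d (dil d (2 ^ 5) L) \<subseteq> E" if L: "L \<in> \<Q>" for L
  proof -
    obtain k x where rep: "x \<in> Rd d" "L = dcube d c k x" using repM L QM by blast
    then show ?thesis
      using parent[of k x] parent_dil9_subset[of x d c k] L QM by auto
  qed
  moreover have "9 * side L \<le> side Q / 2" if "L \<in> \<Q>" for L using that sG QM M(1) by blast
  ultimately show thesis using sh by (intro that[of \<Q>]) 
qed

section \<open>Averages and maximal functions\<close>

abbreviation pw :: "real \<Rightarrow> cfun \<Rightarrow> pt \<Rightarrow> ennreal" where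
  "pw p h \<equiv> (\<lambda>x. ennreal (cmod (h x) powr p))"

abbreviation pmass :: "nat \<Rightarrow> real \<Rightarrow> cfun \<Rightarrow> pt measure" where
  "pmass d p h \<equiv> density (leb d) (pw p h)"

lemma enn_powr_le_iff:
  assumes "0 < p" "0 \<le> t"
  shows "enn_powr I (1 / p) \<le> ennreal t \<longleftrightarrow> I \<le> ennreal (t powr p)"
proof (cases I)
  case (real u)
  have "u powr (1 / p) \<le> t \<longleftrightarrow> u \<le> t powr p"
  proof
    assume "u powr (1 / p) \<le> t"
    then have "(u powr (1 / p)) powr p \<le> t powr p" using assms by (intro powr_mono2) auto
    then show "u \<le> t powr p" using assms real by (simp add: powr_powr)
  next
    assume "u \<le> t powr p"
    then have "u powr (1 / p) \<le> (t powr p) powr (1 / p)" using assms real by (intro powr_mono2) auto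
    then show "u powr (1 / p) \<le> t" using assms by (simp add: powr_powr)
  qed
  then show ?thesis using real assms by (simp add: enn_powr_def)
next
  case top
  then show ?thesis by (simp add: enn_powr_def top_unique)
qed

lemma Lnorm_le_iff:
  assumes "0 < p" "0 \<le> t"
  shows "Lnorm d (ennreal p) f \<le> ennreal t \<longleftrightarrow> (\<integral>\<^sup>+x. pw p f x \<partial>leb d) \<le> ennreal (t powr p)"
  using enn_powr_le_iff[OF assms, of "\<integral>\<^sup>+x. pw p f x \<partial>leb d"] assms by (simp add: Lnorm_def)

lemma cut_measurable [measurable]:
  "f \<in> borel_measurable M \<Longrightarrow> A \<inter> space M \<in> sets M \<Longrightarrow> cut A f \<in> borel_measurable M"
  unfolding cut_def
  by (rule measurable_If_set) auto

lemma cut_borel_leb: "f \<in> borel_measurable (leb d) \<Longrightarrow> A \<in> sets (leb d) \<Longrightarrow> cut A f \<in> borel_measurable (leb d)"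
  by (rule cut_measurable) (auto intro: sets.Int)

lemma pw_measurable [measurable]: "f \<in> borel_measurable M \<Longrightarrow> pw p f \<in> borel_measurable M"
  by measurable

lemma emeasure_pmass:
  assumes "f \<in> borel_measurable (leb d)" "A \<in> sets (leb d)" "0 < p"
  shows "emeasure (pmass d p f) A = (\<integral>\<^sup>+x. pw p (cut A f) x \<partial>leb d)"
  using assms by (subst emeasure_density) (auto simp: cut_def indicator_def intro!: nn_integral_cong)

lemma avg_le_iff:
  assumes p: "0 < p" and t: "0 \<le> t" and f: "f \<in> borel_measurable (leb d)" and Q: "0 < side Q"
  shows "avg d (ennreal p) f Q \<le> ennreal t \<longleftrightarrow> emeasure (pmass d p f) (cset d Q) \<le> ennreal (t powr p * side Q ^ d)"
proof -
  define v where "v = side Q ^ d"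
  have v: "0 < v" using Q by (simp add: v_def)
  have V: "enn2real (vol d Q) = v" using Q by (simp add: vol_eq v_def)
  define I where "I = Lnorm d (ennreal p) (cut (cset d Q) f)"
  have "avg d (ennreal p) f Q = ennreal (v powr (- 1 / p)) * I"
    using p by (simp add: avg_def V I_def)
  also have "\<dots> \<le> ennreal t \<longleftrightarrow> I \<le> ennreal (t * v powr (1 / p))"
  proof (cases I)
    case (real u)
    have "v powr (- 1 / p) * u \<le> t \<longleftrightarrow> u \<le> t * v powr (1 / p)"
      using v by (simp add: powr_minus_divide field_simps)
    then show ?thesis using real t v by (simp add: ennreal_mult[symmetric])
  next
    case top
    then show ?thesis using v by (simp add: ennreal_mult_top top_unique)
  qed
  also have "\<dots> \<longleftrightarrow> (\<integral>\<^sup>+x. pw p (cut (cset d Q) f) x \<partial>leb d) \<le> ennreal ((t * v powr (1 / p)) powr p)"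
    unfolding I_def using p t by (intro Lnorm_le_iff) auto
  also have "(t * v powr (1 / p)) powr p = t powr p * v"
    using p t v by (simp add: powr_mult powr_powr)
  finally show ?thesis using f p by (simp add: emeasure_pmass v_def)
qed

lemma heavy_iff:
  assumes "0 < p" "0 \<le> t" "f \<in> borel_measurable (leb d)" "L \<in> dgrid d c"
  shows "L \<in> heavy d c (pw p f) (t powr p) \<longleftrightarrow> ennreal t < avg d (ennreal p) f (dil d 3 L)"
proof -
  have "0 < side L" using assms(4) dgrid_is_cube by (auto simp: is_cube_def)
  then show ?thesis
    using avg_le_iff[OF assms(1-3), of "dil d 3 L"] assms(4)
    by (simp add: heavy_def vol_eq ennreal_mult not_le [symmetric])
qed

text \<open>
  Every cube lies in the interior of some \<open>3L\<close> with \<open>L\<close> dyadic of at most twice its sidelength.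
  Therefore the averages over the cubes \<open>3L\<close> control the full maximal function.
\<close>

lemma maximal_le_off_heavy_set:
  assumes p: "1 \<le> p" and t: "0 \<le> t" and f: "f \<in> borel_measurable (leb d)"
    and x: "x \<notin> heavy_set d c (pw p f) (t powr p)"
  shows "maximal d (ennreal p) f x \<le> ennreal (6 ^ d * t)"
  unfolding maximal_def
proof (rule SUP_least)
  fix R assume "R \<in> {Q. is_cube d Q}"
  then have R: "corner R \<in> Rd d" "0 < side R" by (auto simp: is_cube_def)
  show "avg d (ennreal p) f R * indicator (cset d R) x \<le> ennreal (6 ^ d * t)"
  proof (cases "x \<in> cset d R")
    case True
    define k where "k = \<lceil>log 2 (side R)\<rceil>"
    have k1: "side R \<le> 2 powi k"
    proof -
      have "side R = 2 powr (log 2 (side R))" using R by simp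
      also have "\<dots> \<le> 2 powr k" unfolding k_def by (intro powr_mono) auto
      finally show ?thesis by (simp add: powr_real_of_int')
    qed
    have k2: "2 powi k \<le> 2 * side R"
    proof -
      have "(2::real) powi k = 2 powr k" by (simp add: powr_real_of_int')
      also have "\<dots> \<le> 2 powr (1 + log 2 (side R))" unfolding k_def by (intro powr_mono; linarith)
      also have "\<dots> = 2 * side R" using R by (simp add: powr_add)
      finally show ?thesis .
    qed
    define L where "L = dcube d c k (corner R)"
    have L: "L \<in> dgrid d c" using R by (auto simp: L_def dgrid_def)
    have RL: "cset d R \<subseteq> ocset d (dil d 3 L)"
    proof
      fix y assume y: "y \<in> cset d R"
      have "corner L i - side L < y i \<and> y i < corner L i + 2 * side L" if i: "i < d" for i
      proof -
        have "corner L i \<le> corner R i" "corner R i < corner L i + side L"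
          using dcube_self[OF R(1), of c k] i unfolding L_def cset_def by auto
        moreover have "corner R i \<le> y i" "y i < corner R i + side R"
          using y i by (auto simp: cset_def)
        moreover have "side R \<le> side L" "0 < side L" using k1 by (auto simp: L_def)
        ultimately show ?thesis by linarith
      qed
      then show "y \<in> ocset d (dil d 3 L)"
        using y cset_subset_Rd by (auto simp: ocset_dil)
    qed
    then have "x \<in> ocset d (dil d 3 L)" using True by auto
    then have "L \<notin> heavy d c (pw p f) (t powr p)" using x by (auto simp: heavy_set_def)
    then have avL: "avg d (ennreal p) f (dil d 3 L) \<le> ennreal t"
      using p t f L by (subst (asm) heavy_iff) auto
    have "emeasure (pmass d p f) (cset d R) \<le> emeasure (pmass d p f) (cset d (dil d 3 L))"
      using RL ocset_subset_cset by (intro emeasure_mono) auto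
    also have "\<dots> \<le> ennreal (t powr p * side (dil d 3 L) ^ d)"
      using avL p t f by (subst (asm) avg_le_iff) (auto simp: L_def)
    also have "\<dots> \<le> ennreal ((6 ^ d * t) powr p * side R ^ d)"
    proof (rule ennreal_leI)
      have "side (dil d 3 L) ^ d \<le> (6 * side R) ^ d"
        using k2 by (intro power_mono) (auto simp: L_def)
      also have "\<dots> = 6 ^ d * side R ^ d" by (simp add: power_mult_distrib)
      also have "\<dots> \<le> (6 ^ d) powr p * side R ^ d"
      proof (rule mult_right_mono)
        have "(6 ^ d :: real) powr 1 \<le> (6 ^ d) powr p" using p by (intro powr_mono) auto
        then show "(6 ^ d :: real) \<le> (6 ^ d) powr p" by simp
      qed (use R in auto)
      finally have "t powr p * side (dil d 3 L) ^ d \<le> t powr p * ((6 ^ d) powr p * side R ^ d)"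
        by (rule mult_left_mono) auto
      then show "t powr p * side (dil d 3 L) ^ d \<le> (6 ^ d * t) powr p * side R ^ d"
        using t by (simp add: powr_mult mult_ac)
    qed
    finally have "avg d (ennreal p) f R \<le> ennreal (6 ^ d * t)"
      using p t f R by (subst avg_le_iff) auto
    then show ?thesis using True by simp
  qed simp
qed

section \<open>Translations and product measure\<close>

lemma distr_translate_bleb:
  assumes x: "x \<in> Rd d"
  shows "distr (bleb d) (bleb d) (add_pt d x) = bleb d"
proof (rule leb_prod.PiM_eqI)
  fix A :: "nat \<Rightarrow> real set" assume A: "\<And>i. i \<in> {..<d} \<Longrightarrow> A i \<in> sets lborel"
  have T: "add_pt d x \<in> bleb d \<rightarrow>\<^sub>M bleb d"
    unfolding add_pt_def by measurable
  have V: "add_pt d x -` (\<Pi>\<^sub>E i\<in>{..<d}. A i) \<inter> space (bleb d) = (\<Pi>\<^sub>E i\<in>{..<d}. (+) (x i) -` A i)"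
    by (auto simp: Rd_def add_pt_def PiE_def Pi_def extensional_def)
  have m: "(+) (x i) -` A i \<in> sets lborel" if "i \<in> {..<d}" for i
    using measurable_sets[of "(+) (x i)" lborel lborel "A i"] A[OF that] by simp
  have e: "emeasure lborel ((+) (x i) -` A i) = emeasure lborel (A i)" if "i \<in> {..<d}" for i
  proof -
    have "emeasure lborel (A i) = emeasure (distr lborel borel ((+) (x i))) (A i)"
      by (simp add: lborel_distr_plus)
    then show ?thesis using A[OF that] by (simp add: emeasure_distr)
  qed
  have "emeasure (distr (bleb d) (bleb d) (add_pt d x)) (\<Pi>\<^sub>E i\<in>{..<d}. A i)
      = emeasure (bleb d) (\<Pi>\<^sub>E i\<in>{..<d}. (+) (x i) -` A i)"
    using A by (subst emeasure_distr[OF T]) (simp_all add: V[simplified] sets_PiM_I_finite)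
  also have "\<dots> = (\<Prod>i\<in>{..<d}. emeasure lborel ((+) (x i) -` A i))"
    using m by (intro leb_prod.emeasure_PiM) auto
  also have "\<dots> = (\<Prod>i\<in>{..<d}. emeasure lborel (A i))"
    using e by (intro prod.cong) auto
  finally show "emeasure (distr (bleb d) (bleb d) (add_pt d x)) (\<Pi>\<^sub>E i\<in>{..<d}. A i)
      = (\<Prod>i\<in>{..<d}. emeasure lborel (A i))" .
qed auto

text \<open>
  Measurability is available for the translated function alone, so the function itself is compared
  with the translate of a Borel version.
\<close>

lemma nn_integral_translate:
  assumes x: "x \<in> Rd d" and G: "(\<lambda>z. F (add_pt d x z)) \<in> borel_measurable (leb d)"
  shows "(\<integral>\<^sup>+y. F y \<partial>bleb d) = (\<integral>\<^sup>+z. (F (add_pt d x z) :: ennreal) \<partial>leb d)"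
proof -
  define m where "m = add_pt d (\<lambda>i\<in>{..<d}. - x i)"
  have mR: "(\<lambda>i\<in>{..<d}. - x i) \<in> Rd d" by (simp add: Rd_def)
  have mm: "m \<in> bleb d \<rightarrow>\<^sub>M bleb d" unfolding m_def add_pt_def by measurable
  have md: "distr (bleb d) (bleb d) m = bleb d" unfolding m_def by (rule distr_translate_bleb[OF mR])
  have inv: "add_pt d x (m y) = y" if "y \<in> Rd d" for y
    using that by (auto simp: m_def add_pt_def Rd_def fun_eq_iff PiE_def extensional_def)
  obtain G' where G': "G' \<in> borel_measurable (bleb d)" "AE z in bleb d. F (add_pt d x z) = G' z"
    using completion_ex_borel_measurable[OF G[unfolded leb_def]] by auto
  have "AE y in bleb d. F (add_pt d x (m y)) = G' (m y)"
    using AE_distrD[OF mm, of "\<lambda>z. F (add_pt d x z) = G' z"] G'(2) unfolding md by simp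
  then have "AE y in bleb d. F y = G' (m y)"
    using AE_space by eventually_elim (simp add: inv)
  then have "(\<integral>\<^sup>+y. F y \<partial>bleb d) = (\<integral>\<^sup>+y. G' (m y) \<partial>bleb d)" by (rule nn_integral_cong_AE)
  also have "\<dots> = (\<integral>\<^sup>+z. G' z \<partial>distr (bleb d) (bleb d) m)"
    using mm G'(1) by (subst nn_integral_distr) auto
  also have "\<dots> = (\<integral>\<^sup>+z. F (add_pt d x z) \<partial>bleb d)"
    unfolding md using G'(2) by (intro nn_integral_cong_AE) (auto elim: AE_mp)
  finally show ?thesis by (simp add: leb_def nn_integral_completion)
qed

lemma space_leb2 [simp]: "space (leb2 d) = Rd d \<times> Rd d"
  by (simp add: leb2_def space_pair_measure)

interpretation leb_pair: pair_sigma_finite "bleb d" "bleb d" for d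
  by (intro pair_sigma_finite.intro sigma_finite_bleb)

lemma null_pair:
  assumes "N \<in> null_sets (bleb d)"
  shows "N \<times> Rd d \<in> null_sets (bleb d \<Otimes>\<^sub>M bleb d)" "Rd d \<times> N \<in> null_sets (bleb d \<Otimes>\<^sub>M bleb d)"
proof -
  have R: "Rd d \<in> sets (bleb d)" using sets.top[of "bleb d"] by simp
  show "N \<times> Rd d \<in> null_sets (bleb d \<Otimes>\<^sub>M bleb d)" "Rd d \<times> N \<in> null_sets (bleb d \<Otimes>\<^sub>M bleb d)"
    using assms R by (auto simp: null_sets_def sigma_finite_measure.emeasure_pair_measure_Times[OF sigma_finite_bleb])
qed

lemma AE_leb2:
  assumes "AE x in leb d. R x"
  shows "AE z in leb2 d. R (fst z)" "AE z in leb2 d. R (snd z)"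
proof -
  have "AE x in bleb d. R x" using assms unfolding leb_def AE_completion_iff .
  then obtain N where N: "N \<in> null_sets (bleb d)" "{x \<in> Rd d. \<not> R x} \<subseteq> N"
    by (auto elim!: AE_E simp: null_sets_def)
  have "AE z in bleb d \<Otimes>\<^sub>M bleb d. R (fst z)" "AE z in bleb d \<Otimes>\<^sub>M bleb d. R (snd z)"
    by (rule AE_I'[OF null_pair(1)[OF N(1)]], use N(2) in \<open>auto simp: space_pair_measure\<close>)
       (rule AE_I'[OF null_pair(2)[OF N(1)]], use N(2) in \<open>auto simp: space_pair_measure\<close>)
  then show "AE z in leb2 d. R (fst z)" "AE z in leb2 d. R (snd z)"
    unfolding leb2_def by (auto intro: AE_completion)
qed

lemma fst_leb2 [measurable]: "fst \<in> leb2 d \<rightarrow>\<^sub>M leb d"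
  and snd_leb2 [measurable]: "snd \<in> leb2 d \<rightarrow>\<^sub>M leb d"
proof -
  have m: "fst \<in> leb2 d \<rightarrow>\<^sub>M bleb d" "snd \<in> leb2 d \<rightarrow>\<^sub>M bleb d"
    unfolding leb2_def by (auto intro: measurable_completion)
  have R: "Rd d \<in> sets (bleb d)" using sets.top[of "bleb d"] by simp
  have n: "N \<in> null_sets (distr (leb2 d) (bleb d) fst)" "N \<in> null_sets (distr (leb2 d) (bleb d) snd)"
    if N: "N \<in> null_sets (bleb d)" for N
  proof -
    have NR: "N \<subseteq> Rd d" "N \<in> sets (bleb d)" using N sets.sets_into_space[of N "bleb d"] by auto
    have "fst -` N \<inter> space (leb2 d) = N \<times> Rd d" "snd -` N \<inter> space (leb2 d) = Rd d \<times> N"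
      using NR by auto
    then show "N \<in> null_sets (distr (leb2 d) (bleb d) fst)" "N \<in> null_sets (distr (leb2 d) (bleb d) snd)"
      using null_pair[OF N] NR m
      by (auto simp: null_sets_def emeasure_distr leb2_def)
  qed
  show "fst \<in> leb2 d \<rightarrow>\<^sub>M leb d" "snd \<in> leb2 d \<rightarrow>\<^sub>M leb d"
    using completion.measurable_completion2[OF m(1)[unfolded leb2_def]] n(1)
      completion.measurable_completion2[OF m(2)[unfolded leb2_def]] n(2)
    unfolding leb_def leb2_def by blast+
qed

section \<open>Single scale kernels\<close>

lemma edist_component: "i < d \<Longrightarrow> \<bar>x i - y i\<bar> \<le> edist d x y"
proof -
  assume i: "i < d"
  have "\<bar>x i - y i\<bar> = L2_set (\<lambda>i. x i - y i) {i}" by simp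
  also have "\<dots> \<le> edist d x y"
    unfolding edist_def L2_set_def using i by (intro real_sqrt_le_mono sum_mono2) auto
  finally show ?thesis .
qed

lemma single_scale_measurable:
  "single_scale d q K Ks \<Longrightarrow> (\<lambda>z. Ks s (fst z) (snd z)) \<in> borel_measurable (leb2 d)"
  by (simp add: single_scale_def case_prod_beta')

lemma single_scale_support:
  assumes "single_scale d q K Ks" "x \<in> Rd d" "y \<in> Rd d" "Ks s x y \<noteq> 0" "i < d"
  shows "\<bar>x i - y i\<bar> < 2 powi s"
proof -
  have "edist d x y < 2 powi s" using assms(1-4) unfolding single_scale_def by blast
  then show ?thesis using edist_component[OF assms(5), of x y] by simp
qed

lemma single_scale_Lnorm:
  assumes "single_scale d q K Ks"
  obtains C where "0 \<le> C" "\<And>x. x \<in> Rd d \<Longrightarrow> Lnorm d q (\<lambda>z. Ks s x (add_pt d x z)) \<le> ennreal C"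
proof -
  let ?S = "SUP x\<in>Rd d. Lnorm d q (\<lambda>z. Ks s x (add_pt d x z)) + Lnorm d q (\<lambda>z. Ks s (add_pt d x z) x)"
  let ?c = "2 powr (of_int s * real d / enn2real (conj_exponent q))"
  have "ennreal ?c * ?S \<le> kernel_const d q Ks"
    unfolding kernel_const_def by (rule SUP_upper) simp
  also have "\<dots> < top" using assms by (simp add: single_scale_def)
  finally have "?S < top" by (auto simp: ennreal_mult_less_top)
  then obtain C where C: "0 \<le> C" "?S = ennreal C" by (cases ?S) auto
  have "Lnorm d q (\<lambda>z. Ks s x (add_pt d x z)) \<le> ennreal C" if "x \<in> Rd d" for x
  proof -
    have "Lnorm d q (\<lambda>z. Ks s x (add_pt d x z)) \<le> Lnorm d q (\<lambda>z. Ks s x (add_pt d x z)) + Lnorm d q (\<lambda>z. Ks s (add_pt d x z) x)"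
      by simp
    also have "\<dots> \<le> ?S" using that by (rule SUP_upper)
    finally show ?thesis using C by simp
  qed
  then show thesis using that C by blast
qed

text \<open>
  A single scale of the kernel is integrable in \<open>y\<close>, uniformly in \<open>x\<close>, because it lies in \<open>L\<^sup>q\<close>
  uniformly and has bounded support. The bound enters only through its finiteness, which makes all
  forms of bounded functions absolutely convergent.
\<close>

lemma single_scale_L1:
  assumes K: "single_scale d q K Ks" and q: "1 < q"
  obtains C where "\<And>x. x \<in> Rd d \<Longrightarrow> (\<integral>\<^sup>+y. ennreal (cmod (Ks s x y)) \<partial>bleb d) \<le> ennreal C"
proof -
  obtain C where C: "0 \<le> C" "\<And>x. x \<in> Rd d \<Longrightarrow> Lnorm d q (\<lambda>z. Ks s x (add_pt d x z)) \<le> ennreal C"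
    using single_scale_Lnorm[OF K] by metis
  define B where "B = Cube (\<lambda>i\<in>{..<d}. - (2 powi s)) (2 * 2 powi s)"
  have Bm: "emeasure (leb d) (cset d B) = ennreal ((2 * 2 powi s) ^ d)"
    by (subst emeasure_cset) (auto simp: B_def)
  define C' where "C' = (2 * 2 powi s) ^ d * (1 + C) + C powr enn2real q"
  show thesis
  proof (rule that[of C'])
    fix x assume x: "x \<in> Rd d"
    let ?G = "\<lambda>z. Ks s x (add_pt d x z)"
    have Gm: "?G \<in> borel_measurable (leb d)" using K x by (simp add: single_scale_def)
    have GB: "z \<in> cset d B" if z: "z \<in> Rd d" "?G z \<noteq> 0" for z
    proof -
      have "add_pt d x z \<in> Rd d" by (simp add: add_pt_def Rd_def)
      then have "\<bar>x i - add_pt d x z i\<bar> < 2 powi s" if "i < d" for i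
        using single_scale_support[OF K x _ z(2) that] by simp
      then have "\<bar>z i\<bar> < 2 powi s" if "i < d" for i using that by (fastforce simp: add_pt_def)
      then show ?thesis using z(1) unfolding cset_def B_def by (force simp: abs_less_iff)
    qed
    have "(\<integral>\<^sup>+z. ennreal (cmod (?G z)) \<partial>leb d) \<le> ennreal C'"
    proof (cases "q = top")
      case True
      have "AE z in leb d. ennreal (cmod (?G z)) \<le> ennreal C"
        using esssup_AE[of "\<lambda>z. ennreal (cmod (?G z))" "leb d"] C(2)[OF x] True
        by (auto simp: Lnorm_def elim: order_trans eventually_mono)
      then have "AE z in leb d. ennreal (cmod (?G z)) \<le> ennreal C * indicator (cset d B) z"
        using AE_space by eventually_elim (use GB in \<open>fastforce simp: indicator_def\<close>)
      then have "(\<integral>\<^sup>+z. ennreal (cmod (?G z)) \<partial>leb d) \<le> (\<integral>\<^sup>+z. ennreal C * indicator (cset d B) z \<partial>leb d)"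
        by (rule nn_integral_mono_AE)
      also have "\<dots> = ennreal C * ennreal ((2 * 2 powi s) ^ d)"
        by (subst nn_integral_cmult_indicator) (auto simp: Bm)
      also have "\<dots> = ennreal ((2 * 2 powi s) ^ d * C)"
        using C(1) by (subst ennreal_mult'[symmetric]) (auto simp: mult.commute)
      also have "\<dots> \<le> ennreal C'"
        using C(1) unfolding C'_def by (intro ennreal_leI) (simp add: algebra_simps)
      finally show ?thesis .
    next
      case False
      then obtain r where r: "q = ennreal r" "0 \<le> r" by (cases q) auto
      have r1: "1 < r" using q r by (simp flip: ennreal_1 add: ennreal_less_iff)
      have int: "(\<integral>\<^sup>+z. pw r ?G z \<partial>leb d) \<le> ennreal (C powr r)"
        using C(2)[OF x] r r1 C(1) by (subst (asm) r(1), subst (asm) Lnorm_le_iff) auto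
      have pt: "cmod (?G z) \<le> 1 + cmod (?G z) powr r" for z
      proof (cases "cmod (?G z) \<le> 1")
        case False
        then have "cmod (?G z) powr 1 \<le> cmod (?G z) powr r" using r1 by (intro powr_mono) auto
        then show ?thesis using False by simp
      qed (simp add: add_increasing2)
      have "(\<integral>\<^sup>+z. ennreal (cmod (?G z)) \<partial>leb d) \<le> (\<integral>\<^sup>+z. indicator (cset d B) z + pw r ?G z \<partial>leb d)"
      proof (intro nn_integral_mono)
        fix z assume z: "z \<in> space (leb d)"
        show "ennreal (cmod (?G z)) \<le> indicator (cset d B) z + pw r ?G z"
        proof (cases "?G z = 0")
          case False
          then have "z \<in> cset d B" using GB z by simp
          moreover have "ennreal (cmod (?G z)) \<le> ennreal (1 + cmod (?G z) powr r)"
            using pt[of z] by (rule ennreal_leI)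
          ultimately show ?thesis by (simp add: ennreal_plus)
        qed simp
      qed
      also have "\<dots> = emeasure (leb d) (cset d B) + (\<integral>\<^sup>+z. pw r ?G z \<partial>leb d)"
        using Gm by (subst nn_integral_add) auto
      also have "\<dots> \<le> ennreal ((2 * 2 powi s) ^ d) + ennreal (C powr r)"
        using int by (simp add: Bm add_left_mono)
      also have "\<dots> \<le> ennreal C'"
      proof -
        have "(2 * 2 powi s) ^ d * 1 \<le> (2 * 2 powi s) ^ d * (1 + C)"
          using C(1) by (intro mult_left_mono) auto
        then show ?thesis
          unfolding C'_def r(1) using r(2) by (subst ennreal_plus[symmetric]) (auto intro!: ennreal_leI)
      qed
      finally show ?thesis .
    qed
    then show "(\<integral>\<^sup>+y. ennreal (cmod (Ks s x y)) \<partial>bleb d) \<le> ennreal C'"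
      using x Gm by (subst nn_integral_translate[of x]) auto
  qed
qed

definition ksum :: "(int \<Rightarrow> kern) \<Rightarrow> int \<Rightarrow> int \<Rightarrow> kern" where
  "ksum Ks \<mu> \<nu> x y = (\<Sum>s\<in>{\<mu><..\<nu>}. Ks s x y)"

lemma trunc_integrand_eq: "trunc_integrand Ks \<mu> \<nu> h1 h2 z = ksum Ks \<mu> \<nu> (fst z) (snd z) * h1 (snd z) * h2 (fst z)"
  by (simp add: trunc_integrand_def ksum_def case_prod_beta)

lemma trunc_integrand_measurable:
  assumes K: "single_scale d q K Ks" and h: "h1 \<in> borel_measurable (leb d)" "h2 \<in> borel_measurable (leb d)"
  shows "trunc_integrand Ks \<mu> \<nu> h1 h2 \<in> borel_measurable (leb2 d)"
proof -
  note [measurable] = single_scale_measurable[OF K] h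
  show ?thesis unfolding trunc_integrand_eq[abs_def] ksum_def by measurable
qed

lemma trunc_converges_bounded:
  assumes K: "single_scale d q K Ks" and q: "1 < q"
    and h: "h1 \<in> borel_measurable (leb d)" "h2 \<in> borel_measurable (leb d)"
    and bd: "\<And>x. cmod (h1 x) \<le> B" "\<And>x. cmod (h2 x) \<le> B"
    and R: "0 < side R" "\<And>x. x \<in> Rd d \<Longrightarrow> x \<notin> cset d R \<Longrightarrow> h2 x = 0"
  shows "trunc_converges d Ks \<mu> \<nu> h1 h2"
proof -
  have B: "0 \<le> B" using bd(1) norm_ge_zero order_trans by blast
  define \<Phi> where "\<Phi> s z = ennreal (cmod (Ks s (fst z) (snd z))) * indicator (cset d R) (fst z)" for s z
  have \<Phi>m: "\<Phi> s \<in> borel_measurable (leb2 d)" for s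
  proof -
    note [measurable] = single_scale_measurable[OF K]
    have [measurable]: "(\<lambda>z. indicator (cset d R) (fst z) :: ennreal) \<in> borel_measurable (leb2 d)"
      by (rule measurable_compose[OF fst_leb2]) simp
    show ?thesis unfolding \<Phi>_def by measurable
  qed
  have \<Phi>fin: "(\<integral>\<^sup>+z. \<Phi> s z \<partial>leb2 d) < \<infinity>" for s
  proof -
    obtain C where C: "\<And>x. x \<in> Rd d \<Longrightarrow> (\<integral>\<^sup>+y. ennreal (cmod (Ks s x y)) \<partial>bleb d) \<le> ennreal C"
      using single_scale_L1[OF K q] by metis
    obtain \<Phi>' where P: "\<Phi>' \<in> borel_measurable (bleb d \<Otimes>\<^sub>M bleb d)" "AE z in bleb d \<Otimes>\<^sub>M bleb d. \<Phi> s z = \<Phi>' z"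
      using completion_ex_borel_measurable[OF \<Phi>m[unfolded leb2_def]] by blast
    have "(\<integral>\<^sup>+z. \<Phi> s z \<partial>leb2 d) = (\<integral>\<^sup>+z. \<Phi>' z \<partial>(bleb d \<Otimes>\<^sub>M bleb d))"
      unfolding leb2_def nn_integral_completion by (rule nn_integral_cong_AE[OF P(2)])
    also have "\<dots> = (\<integral>\<^sup>+x. \<integral>\<^sup>+y. \<Phi>' (x, y) \<partial>bleb d \<partial>bleb d)"
      by (rule sigma_finite_measure.nn_integral_fst[OF sigma_finite_bleb P(1), symmetric])
    also have "\<dots> \<le> (\<integral>\<^sup>+x. ennreal C * indicator (cset d R) x \<partial>bleb d)"
    proof (rule nn_integral_mono_AE)
      have "AE x in bleb d. AE y in bleb d. \<Phi> s (x, y) = \<Phi>' (x, y)"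
        using leb_pair.AE_pair[OF P(2)] .
      then show "AE x in bleb d. (\<integral>\<^sup>+y. \<Phi>' (x, y) \<partial>bleb d) \<le> ennreal C * indicator (cset d R) x"
        using AE_space
      proof eventually_elim
        fix x assume ae: "AE y in bleb d. \<Phi> s (x, y) = \<Phi>' (x, y)" and x: "x \<in> space (bleb d)"
        have "(\<integral>\<^sup>+y. \<Phi>' (x, y) \<partial>bleb d) = (\<integral>\<^sup>+y. \<Phi> s (x, y) \<partial>bleb d)"
          using ae by (intro nn_integral_cong_AE) auto
        also have "\<dots> \<le> ennreal C * indicator (cset d R) x"
          using C[of x] x by (cases "x \<in> cset d R") (auto simp: \<Phi>_def)
        finally show "(\<integral>\<^sup>+y. \<Phi>' (x, y) \<partial>bleb d) \<le> ennreal C * indicator (cset d R) x" .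
      qed
    qed
    also have "\<dots> = ennreal C * emeasure (leb d) (cset d R)"
      by (subst nn_integral_cmult_indicator) (auto simp: emeasure_leb_bleb[OF cset_bleb])
    also have "\<dots> < \<infinity>" using R(1) by (simp add: emeasure_cset ennreal_mult_less_top)
    finally show ?thesis .
  qed
  have "(\<integral>\<^sup>+z. ennreal (norm (trunc_integrand Ks \<mu> \<nu> h1 h2 z)) \<partial>leb2 d)
      \<le> (\<integral>\<^sup>+z. ennreal (B * B) * (\<Sum>s\<in>{\<mu><..\<nu>}. \<Phi> s z) \<partial>leb2 d)"
  proof (intro nn_integral_mono)
    fix z assume z: "z \<in> space (leb2 d)"
    show "ennreal (norm (trunc_integrand Ks \<mu> \<nu> h1 h2 z)) \<le> ennreal (B * B) * (\<Sum>s\<in>{\<mu><..\<nu>}. \<Phi> s z)"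
    proof (cases "fst z \<in> cset d R")
      case False
      then have "h2 (fst z) = 0" using R(2) z by auto
      then show ?thesis by (simp add: trunc_integrand_eq)
    next
      case True
      have "norm (trunc_integrand Ks \<mu> \<nu> h1 h2 z)
          = cmod (ksum Ks \<mu> \<nu> (fst z) (snd z)) * (cmod (h1 (snd z)) * cmod (h2 (fst z)))"
        by (simp add: trunc_integrand_eq norm_mult mult_ac)
      also have "\<dots> \<le> (\<Sum>s\<in>{\<mu><..\<nu>}. cmod (Ks s (fst z) (snd z))) * (B * B)"
        unfolding ksum_def using B bd by (intro mult_mono norm_sum) (auto intro: sum_nonneg)
      finally have "ennreal (norm (trunc_integrand Ks \<mu> \<nu> h1 h2 z))
          \<le> ennreal ((B * B) * (\<Sum>s\<in>{\<mu><..\<nu>}. cmod (Ks s (fst z) (snd z))))"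
        by (intro ennreal_leI) (simp add: mult.commute)
      also have "\<dots> = ennreal (B * B) * (\<Sum>s\<in>{\<mu><..\<nu>}. \<Phi> s z)"
        using True B by (simp add: ennreal_mult sum_nonneg \<Phi>_def)
      finally show ?thesis .
    qed
  qed
  also have "\<dots> = ennreal (B * B) * (\<Sum>s\<in>{\<mu><..\<nu>}. \<integral>\<^sup>+z. \<Phi> s z \<partial>leb2 d)"
    using \<Phi>m by (simp add: nn_integral_cmult nn_integral_sum)
  also have "\<dots> < \<infinity>" using \<Phi>fin by (simp add: ennreal_mult_less_top less_top)
  finally show ?thesis
    unfolding trunc_converges_def
    using trunc_integrand_measurable[OF K h] by (intro integrableI_bounded)
qed

section \<open>Truncated forms\<close>

lemma trunc_form_trivial: "\<nu> \<le> \<mu> \<Longrightarrow> trunc_form d Ks \<mu> \<nu> h1 h2 = 0"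
  by (simp add: trunc_form_def trunc_integrand_eq ksum_def cong: integral_cong)

lemma trunc_form_add1:
  assumes "trunc_converges d Ks \<mu> \<nu> f h" "trunc_converges d Ks \<mu> \<nu> g h"
  shows "trunc_form d Ks \<mu> \<nu> (\<lambda>x. f x + g x) h = trunc_form d Ks \<mu> \<nu> f h + trunc_form d Ks \<mu> \<nu> g h"
  unfolding trunc_form_def Bochner_Integration.integral_add[OF assms[unfolded trunc_converges_def], symmetric]
  by (rule Bochner_Integration.integral_cong) (simp_all add: trunc_integrand_eq algebra_simps)

lemma trunc_form_add2:
  assumes "trunc_converges d Ks \<mu> \<nu> h f" "trunc_converges d Ks \<mu> \<nu> h g"
  shows "trunc_form d Ks \<mu> \<nu> h (\<lambda>x. f x + g x) = trunc_form d Ks \<mu> \<nu> h f + trunc_form d Ks \<mu> \<nu> h g"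
  unfolding trunc_form_def Bochner_Integration.integral_add[OF assms[unfolded trunc_converges_def], symmetric]
  by (rule Bochner_Integration.integral_cong) (simp_all add: trunc_integrand_eq algebra_simps)

lemma trunc_form_scale:
  "trunc_form d Ks \<mu> \<nu> (\<lambda>x. a * f x) (\<lambda>x. b * g x) = (a * b) * trunc_form d Ks \<mu> \<nu> f g"
proof -
  have "trunc_form d Ks \<mu> \<nu> (\<lambda>x. a * f x) (\<lambda>x. b * g x) = (\<integral>z. (a * b) * trunc_integrand Ks \<mu> \<nu> f g z \<partial>leb2 d)"
    by (simp add: trunc_form_def trunc_integrand_eq mult_ac)
  also have "\<dots> = (a * b) * trunc_form d Ks \<mu> \<nu> f g"
    unfolding trunc_form_def by (rule integral_mult_right_zero)
  finally show ?thesis .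
qed

lemma trunc_form_cong_AE:
  assumes K: "single_scale d q K Ks"
    and m: "f \<in> borel_measurable (leb d)" "f' \<in> borel_measurable (leb d)" "g \<in> borel_measurable (leb d)" "g' \<in> borel_measurable (leb d)"
    and e: "AE x in leb d. f x = f' x" "AE x in leb d. g x = g' x"
  shows "trunc_form d Ks \<mu> \<nu> f g = trunc_form d Ks \<mu> \<nu> f' g'"
  unfolding trunc_form_def
proof (rule integral_cong_AE)
  show "AE z in leb2 d. trunc_integrand Ks \<mu> \<nu> f g z = trunc_integrand Ks \<mu> \<nu> f' g' z"
    using AE_leb2(2)[OF e(1)] AE_leb2(1)[OF e(2)] by eventually_elim (simp add: trunc_integrand_eq)
qed (intro trunc_integrand_measurable[OF K] m)+

lemma conj_exponent_real: "1 < r \<Longrightarrow> conj_exponent (ennreal r) = ennreal (r / (r - 1))"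
proof -
  assume r: "1 < r"
  have "1 / ennreal r = ennreal (1 / r)" using r by (simp flip: ennreal_1 add: divide_ennreal)
  then have "1 - 1 / ennreal r = ennreal (1 - 1 / r)" using r by (simp flip: ennreal_1 add: ennreal_minus)
  then have "conj_exponent (ennreal r) = ennreal (1 / (1 - 1 / r))"
    unfolding conj_exponent_def using r by (simp flip: ennreal_1 add: divide_ennreal)
  then show ?thesis using r by (simp add: field_simps)
qed

lemma Lnorm_normalised:
  assumes p: "1 < p" and g: "g \<in> borel_measurable (leb d)" and bd: "AE x in leb d. cmod (g x) \<le> G"
    and G: "0 < G" and R: "0 < side R" "AE x in leb d. x \<notin> cset d R \<longrightarrow> g x = 0"
  defines "a \<equiv> G * (side R ^ d) powr (1 / p)"
  shows "Lnorm d (ennreal p) (\<lambda>x. complex_of_real (1 / a) * g x) \<le> 1"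
proof -
  define v where "v = side R ^ d"
  have v: "0 < v" using R by (simp add: v_def)
  have a: "0 < a" using G v R(1) unfolding a_def v_def by (intro mult_pos_pos) auto
  have "(\<integral>\<^sup>+x. pw p (\<lambda>x. complex_of_real (1 / a) * g x) x \<partial>leb d) \<le> (\<integral>\<^sup>+x. ennreal (1 / v) * indicator (cset d R) x \<partial>leb d)"
  proof (rule nn_integral_mono_AE)
    show "AE x in leb d. pw p (\<lambda>x. complex_of_real (1 / a) * g x) x \<le> ennreal (1 / v) * indicator (cset d R) x"
      using bd R(2)
    proof eventually_elim
      fix x assume x: "cmod (g x) \<le> G" "x \<notin> cset d R \<longrightarrow> g x = 0"
      have "(cmod (g x) / a) powr p \<le> 1 / v"
      proof -
        have "cmod (g x) / a \<le> G / a" using x a by (intro divide_right_mono) auto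
        also have "G / a = (1 / v) powr (1 / p)" using G v by (simp add: a_def v_def powr_divide)
        finally have "(cmod (g x) / a) powr p \<le> ((1 / v) powr (1 / p)) powr p"
          using p a by (intro powr_mono2) auto
        then show ?thesis using p v by (simp add: powr_powr)
      qed
      then show "pw p (\<lambda>x. complex_of_real (1 / a) * g x) x \<le> ennreal (1 / v) * indicator (cset d R) x"
        using x(2) a by (cases "x \<in> cset d R") (auto simp: norm_mult norm_divide intro!: ennreal_leI)
    qed
  qed
  also have "\<dots> = ennreal (1 / v) * ennreal v"
    using R by (subst nn_integral_cmult_indicator) (auto simp: emeasure_cset v_def)
  also have "\<dots> = ennreal (1 powr p)" using v by (simp flip: ennreal_mult)
  finally show ?thesis using Lnorm_le_iff[of p 1 d] p by simp
qed

text \<open>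
  The \<open>L\<^sup>r\<close> bound for truncations, tested on bounded functions living on one cube: the two
  normalising factors multiply to the volume of the cube, whatever the exponent.
\<close>

lemma trunc_form_bound:
  assumes r: "1 < r" and g: "g1 \<in> borel_measurable (leb d)" "g2 \<in> borel_measurable (leb d)"
    and bd: "AE x in leb d. cmod (g1 x) \<le> G1" "AE x in leb d. cmod (g2 x) \<le> G2" and G: "0 < G1" "0 < G2"
    and R: "0 < side R" "AE x in leb d. x \<notin> cset d R \<longrightarrow> g1 x = 0" "AE x in leb d. x \<notin> cset d R \<longrightarrow> g2 x = 0"
  shows "ennreal (cmod (trunc_form d Ks \<mu> \<nu> g1 g2)) \<le> trunc_const d r Ks * ennreal (G1 * G2) * vol d R"
proof (cases "\<mu> < \<nu>")
  case False
  then show ?thesis by (simp add: trunc_form_trivial)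
next
  case True
  define r' where "r' = r / (r - 1)"
  have r': "1 < r'" "1 / r + 1 / r' = 1" using r by (auto simp: r'_def field_simps)
  define v where "v = side R ^ d"
  have v: "0 < v" using R by (simp add: v_def)
  define a1 where "a1 = G1 * v powr (1 / r)"
  define a2 where "a2 = G2 * v powr (1 / r')"
  have a: "0 < a1" "0 < a2" using G v by (auto simp: a1_def a2_def)
  have a12: "a1 * a2 = G1 * G2 * v"
  proof -
    have "v powr (1 / r) * v powr (1 / r') = v" using v r'(2) by (simp flip: powr_add)
    then show ?thesis by (simp add: a1_def a2_def mult_ac)
  qed
  let ?f1 = "\<lambda>x. complex_of_real (1 / a1) * g1 x" and ?f2 = "\<lambda>x. complex_of_real (1 / a2) * g2 x"
  have n1: "Lnorm d (ennreal r) ?f1 \<le> 1"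
    unfolding a1_def v_def by (rule Lnorm_normalised[OF r g(1) bd(1) G(1) R(1,2)])
  have n2: "Lnorm d (conj_exponent (ennreal r)) ?f2 \<le> 1"
    unfolding a2_def v_def conj_exponent_real[OF r] r'_def[symmetric]
    by (rule Lnorm_normalised[OF r'(1) g(2) bd(2) G(2) R(1,3)])
  have m: "?f1 \<in> borel_measurable (leb d)" "?f2 \<in> borel_measurable (leb d)" using g by auto
  have lt: "t < top" if "t \<le> 1" for t :: ennreal
    using that ennreal_one_less_top by (rule le_less_trans)
  have "ennreal (cmod (trunc_form d Ks \<mu> \<nu> ?f1 ?f2)) \<le> form_norm d r (trunc_form d Ks \<mu> \<nu>)"
    unfolding form_norm_def
    by (rule SUP_upper2[of ?f1], use m n1 lt in \<open>simp add: Lspace_def\<close>)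
       (rule SUP_upper, use m n2 lt in \<open>simp add: Lspace_def\<close>)
  also have "\<dots> \<le> trunc_const d r Ks"
    unfolding trunc_const_def using True by (intro SUP_upper2[of "(\<mu>, \<nu>)"]) auto
  finally have le: "ennreal (cmod (trunc_form d Ks \<mu> \<nu> ?f1 ?f2)) \<le> trunc_const d r Ks" .
  have "cmod (trunc_form d Ks \<mu> \<nu> ?f1 ?f2) = cmod (trunc_form d Ks \<mu> \<nu> g1 g2) / (a1 * a2)"
    unfolding trunc_form_scale using a by (simp add: norm_mult norm_divide)
  then have "cmod (trunc_form d Ks \<mu> \<nu> g1 g2) = cmod (trunc_form d Ks \<mu> \<nu> ?f1 ?f2) * (a1 * a2)"
    using a by simp
  then have "ennreal (cmod (trunc_form d Ks \<mu> \<nu> g1 g2)) = ennreal (cmod (trunc_form d Ks \<mu> \<nu> ?f1 ?f2)) * ennreal (a1 * a2)"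
    using a by (simp add: ennreal_mult)
  also have "\<dots> \<le> trunc_const d r Ks * ennreal (a1 * a2)" using le by (rule mult_right_mono) simp
  also have "ennreal (a1 * a2) = ennreal (G1 * G2) * vol d R"
    unfolding a12 using G R by (simp add: vol_eq v_def ennreal_mult)
  finally show ?thesis by (simp add: mult.assoc)
qed

section \<open>Calderon-Zygmund decomposition\<close>

lemma esssup_Lnorm_le:
  assumes "f \<in> borel_measurable (leb d)" "AE x in leb d. cmod (f x) \<le> C"
  shows "Lnorm d top f \<le> ennreal C"
  unfolding Lnorm_def using assms by (auto intro!: esssup_I elim!: eventually_mono ennreal_leI)

lemma bounded_mass_finite:
  assumes "1 \<le> p" "f \<in> borel_measurable (leb d)" "\<And>x. cmod (f x) \<le> B" "A \<in> sets (leb d)"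
  shows "emeasure (pmass d p f) A \<le> ennreal (B powr p) * emeasure (leb d) A"
proof -
  have "emeasure (pmass d p f) A = (\<integral>\<^sup>+x. pw p f x * indicator A x \<partial>leb d)"
    using assms by (subst emeasure_density) auto
  also have "\<dots> \<le> (\<integral>\<^sup>+x. ennreal (B powr p) * indicator A x \<partial>leb d)"
    using assms(1,3) by (intro nn_integral_mono mult_right_mono ennreal_leI powr_mono2) auto
  also have "\<dots> = ennreal (B powr p) * emeasure (leb d) A"
    using assms by (subst nn_integral_cmult_indicator) auto
  finally show ?thesis .
qed

lemma bounded_in_Lspace:
  assumes p: "1 \<le> p" and f: "f \<in> borel_measurable (leb d)" and bd: "\<And>x. cmod (f x) \<le> B"
    and R: "0 \<le> side R" "\<And>x. x \<in> Rd d \<Longrightarrow> x \<notin> cset d R \<Longrightarrow> f x = 0"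
  shows "f \<in> Lspace d (ennreal p)"
proof -
  have B: "0 \<le> B" using bd norm_ge_zero order_trans by blast
  define M where "M = B powr p * side R ^ d"
  have M: "0 \<le> M" using R by (simp add: M_def)
  have "(\<integral>\<^sup>+x. pw p f x \<partial>leb d) = (\<integral>\<^sup>+x. pw p (cut (cset d R) f) x \<partial>leb d)"
    using R(2) by (intro nn_integral_cong) (auto simp: cut_def)
  also have "\<dots> = emeasure (pmass d p f) (cset d R)"
    using p f by (intro emeasure_pmass[symmetric]) auto
  also have "\<dots> \<le> ennreal (B powr p) * emeasure (leb d) (cset d R)"
    using p f bd by (intro bounded_mass_finite) auto
  also have "\<dots> = ennreal M" using R by (simp add: emeasure_cset M_def ennreal_mult)
  also have "M = (M powr (1 / p)) powr p" using p M by (simp add: powr_powr)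
  finally have "Lnorm d (ennreal p) f \<le> ennreal (M powr (1 / p))"
    using p by (subst Lnorm_le_iff) auto
  then have "Lnorm d (ennreal p) f < top" using le_less_trans ennreal_less_top by blast
  then show ?thesis using f by (simp add: Lspace_def)
qed

text \<open>Constants come out of \<open>L\<^sup>p\<close> bounds without a \<open>p\<close>-th root, at the price of being at least 1.\<close>

lemma le_powr_self:
  assumes "1 \<le> (C::real)" "1 \<le> p" "0 \<le> t" "0 \<le> s" "s powr p \<le> C * t powr p"
  shows "s \<le> C * t"
proof -
  have "C powr 1 \<le> C powr p" using assms by (intro powr_mono) auto
  then have "C * t powr p \<le> C powr p * t powr p" using assms by (intro mult_right_mono) auto
  then have "s powr p \<le> (C * t) powr p" using assms by (simp add: powr_mult)
  then have "(s powr p) powr (1 / p) \<le> ((C * t) powr p) powr (1 / p)"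
    by (rule powr_mono2[rotated 2]) (use assms in auto)
  moreover have "(s powr p) powr (1 / p) = s" "((C * t) powr p) powr (1 / p) = C * t"
    using assms by (simp_all add: powr_powr)
  ultimately show ?thesis by simp
qed

lemma shadowE:
  assumes "x \<in> shadow d \<Q>"
  obtains L where "L \<in> \<Q>" "x \<in> cset d L"
  using assms unfolding shadow_def by blast

text \<open>
  What the Whitney decomposition of \<open>E\<close> provides for the splitting of functions supported in \<open>3Q\<close>.
  For a single function, \<open>E\<close> only has to contain its heavy set.
\<close>

locale stopping_data =
  fixes d :: nat and c :: real and Q :: cube and \<Q> :: "cube set" and E :: "pt set"
  assumes d1: "1 \<le> d"
    and Qgrid: "Q \<in> dgrid d c"
    and sub: "\<Q> \<subseteq> dgrid d c"
    and disj: "disjoint_family_on (cset d) \<Q>"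
    and sh: "shadow d \<Q> = E \<inter> cset d (dil d 3 Q)"
    and touch: "\<And>L. L \<in> \<Q> \<Longrightarrow> \<not> cset d (dil d (2 ^ 5) L) \<subseteq> E"
begin

lemma countable_Q: "countable \<Q>"
  using countable_subset[OF sub countable_dgrid] .

lemma side_pos: "L \<in> \<Q> \<Longrightarrow> 0 < side L"
  using sub dgrid_is_cube by (auto simp: is_cube_def)

lemma shadow_leb [measurable]: "shadow d \<Q> \<in> sets (leb d)"
  unfolding shadow_def using countable_Q by (intro sets.countable_UN') auto

text \<open>The stopping cube containing \<open>x\<close>, for points \<open>x\<close> of the shadow.\<close>

definition stop :: "pt \<Rightarrow> cube" where
  "stop x = (THE L. L \<in> \<Q> \<and> x \<in> cset d L)"

lemma stop_eq: "L \<in> \<Q> \<Longrightarrow> x \<in> cset d L \<Longrightarrow> stop x = L"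
  unfolding stop_def using disj
  by (intro the_equality) (auto simp: disjoint_family_on_def)

definition mean :: "cfun \<Rightarrow> cube \<Rightarrow> complex" where
  "mean h L = (LINT x:cset d L|leb d. h x) / complex_of_real (side L ^ d)"

definition good :: "cfun \<Rightarrow> cfun" where
  "good h x = (if x \<in> shadow d \<Q> then mean h (stop x) else h x)"

definition bad :: "cfun \<Rightarrow> cfun" where
  "bad h x = (if x \<in> shadow d \<Q> then h x - mean h (stop x) else 0)"

lemma good_plus_bad: "good h x + bad h x = h x"
  by (simp add: good_def bad_def)

lemma mean_stop_measurable: "(\<lambda>x. if x \<in> shadow d \<Q> then mean h (stop x) else 0) \<in> borel_measurable (leb d)"
  (is "?F \<in> _")
proof (rule measurable_piecewise_restrict[of "insert (Rd d - shadow d \<Q>) (cset d ` \<Q>)"])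
  show "countable (insert (Rd d - shadow d \<Q>) (cset d ` \<Q>))" using countable_Q by simp
  show "space (leb d) \<subseteq> \<Union> (insert (Rd d - shadow d \<Q>) (cset d ` \<Q>))"
    by (auto simp: shadow_def)
  fix \<Omega> assume O: "\<Omega> \<in> insert (Rd d - shadow d \<Q>) (cset d ` \<Q>)"
  then show "\<Omega> \<inter> space (leb d) \<in> sets (leb d)" using shadow_leb by (auto intro!: sets.Int sets.Diff)
  obtain a where a: "\<And>x. x \<in> \<Omega> \<Longrightarrow> ?F x = a"
  proof (cases "\<Omega> = Rd d - shadow d \<Q>")
    case True
    then show ?thesis by (intro that[of 0]) auto
  next
    case False
    then obtain L where L: "L \<in> \<Q>" "\<Omega> = cset d L" using O by auto
    have "?F x = mean h L" if "x \<in> \<Omega>" for x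
      using that L stop_eq by (auto simp: shadow_def)
    then show ?thesis by (rule that)
  qed
  then show "?F \<in> borel_measurable (restrict_space (leb d) \<Omega>)"
    by (subst measurable_cong[where g = "\<lambda>_. a"]) (auto simp: space_restrict_space)
qed

lemma good_measurable: "h \<in> borel_measurable (leb d) \<Longrightarrow> good h \<in> borel_measurable (leb d)"
proof -
  assume h: "h \<in> borel_measurable (leb d)"
  have "good h = (\<lambda>x. (if x \<in> shadow d \<Q> then mean h (stop x) else 0) + cut (- shadow d \<Q>) h x)"
    by (auto simp: good_def cut_def)
  also have "\<dots> \<in> borel_measurable (leb d)"
  proof (rule borel_measurable_add[OF mean_stop_measurable cut_measurable[OF h]])
    have "- shadow d \<Q> \<inter> space (leb d) = space (leb d) - shadow d \<Q>" by auto
    then show "- shadow d \<Q> \<inter> space (leb d) \<in> sets (leb d)" using shadow_leb by (metis sets.compl_sets)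
  qed
  finally show ?thesis .
qed

lemma bad_measurable: "h \<in> borel_measurable (leb d) \<Longrightarrow> bad h \<in> borel_measurable (leb d)"
proof -
  assume h: "h \<in> borel_measurable (leb d)"
  have "bad h = (\<lambda>x. h x - good h x)" by (auto simp: good_def bad_def)
  then show ?thesis using h good_measurable[OF h] by simp
qed

context
  fixes h :: cfun and B p t :: real
  assumes p: "1 \<le> p" and t: "0 < t" and hm: "h \<in> borel_measurable (leb d)"
    and bd: "\<And>x. cmod (h x) \<le> B"
    and supp_all: "\<forall>x. x \<notin> cset d (dil d 3 Q) \<longrightarrow> h x = 0"
    and heavy: "heavy_set d c (pw p h) (t powr p) \<subseteq> E"
begin

lemma supp: "x \<in> Rd d \<Longrightarrow> x \<notin> cset d (dil d 3 Q) \<Longrightarrow> h x = 0"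
  using supp_all by simp

lemma B_nonneg: "0 \<le> B"
  using bd norm_ge_zero order_trans by blast

lemma side_Q: "0 < side Q"
  using Qgrid dgrid_is_cube by (auto simp: is_cube_def)

text \<open>
  Outside \<open>3Q\<close> the function vanishes, and the rest of the complement of the shadow avoids \<open>E\<close>, hence
  the heavy set.
\<close>

lemma off_shadow: "AE x in leb d. x \<notin> shadow d \<Q> \<longrightarrow> cmod (h x) \<le> 12 ^ d * t"
proof -
  have fin: "(\<integral>\<^sup>+x. pw p h x \<partial>leb d) < \<infinity>"
  proof -
    have "(\<integral>\<^sup>+x. pw p h x \<partial>leb d) = (\<integral>\<^sup>+x. pw p (cut (cset d (dil d 3 Q)) h) x \<partial>leb d)"
      using supp by (intro nn_integral_cong) (auto simp: cut_def)
    also have "\<dots> = emeasure (pmass d p h) (cset d (dil d 3 Q))"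
      using p hm by (intro emeasure_pmass[symmetric]) auto
    also have "\<dots> \<le> ennreal (B powr p) * emeasure (leb d) (cset d (dil d 3 Q))"
      using p hm bd by (intro bounded_mass_finite) auto
    also have "\<dots> < \<infinity>" using side_Q by (simp add: emeasure_cset ennreal_mult_less_top)
    finally show ?thesis .
  qed
  have "AE x in leb d. x \<notin> heavy_set d c (pw p h) (t powr p) \<longrightarrow> pw p h x \<le> ennreal (4 * 3 ^ d * t powr p)"
  proof (rule AE_bounded_off_heavy_set[where R = "dil d 3 Q"])
    show "pw p h x = 0" if "x \<in> Rd d" "x \<notin> cset d (dil d 3 Q)" for x
      using supp[OF that] p by simp
    show "pw p h \<in> borel_measurable (leb d)" using hm by (rule pw_measurable)
    show "0 < t powr p" using t by simp
    show "0 < side (dil d 3 Q)" using side_Q by simp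
  qed (rule fin)
  then show ?thesis
    using AE_space
  proof eventually_elim
    fix x assume x: "x \<notin> heavy_set d c (pw p h) (t powr p) \<longrightarrow> pw p h x \<le> ennreal (4 * 3 ^ d * t powr p)"
      "x \<in> space (leb d)"
    show "x \<notin> shadow d \<Q> \<longrightarrow> cmod (h x) \<le> 12 ^ d * t"
    proof
      assume ns: "x \<notin> shadow d \<Q>"
      show "cmod (h x) \<le> 12 ^ d * t"
      proof (cases "x \<in> cset d (dil d 3 Q)")
        case True
        then have "x \<notin> heavy_set d c (pw p h) (t powr p)" using ns sh heavy by blast
        then have "cmod (h x) powr p \<le> 4 * 3 ^ d * t powr p" using x by simp
        moreover have "(1::real) \<le> 4 * 3 ^ d"
          using one_le_power[of "3::real" d] by linarith
        ultimately have "cmod (h x) \<le> 4 * 3 ^ d * t"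
          using le_powr_self[of "4 * 3 ^ d" p t "cmod (h x)"] p t by simp
        also have "(4::real) * 3 ^ d \<le> 12 ^ d"
        proof -
          have "(4::real) ^ 1 \<le> 4 ^ d" using d1 by (intro power_increasing) auto
          then have "(4::real) * 3 ^ d \<le> 4 ^ d * 3 ^ d" by simp
          then show ?thesis using power_mult_distrib[of "4::real" 3 d] by simp
        qed
        finally show ?thesis using t by simp
      next
        case False
        then show ?thesis using supp x t by simp
      qed
    qed
  qed
qed

text \<open>
  The dilate \<open>32L\<close> sticks out of \<open>E\<close>, hence contains a point outside the heavy set.
\<close>

lemma light_point:
  assumes "L \<in> \<Q>"
  obtains x where "x \<in> cset d (dil d (2 ^ 5) L)" "maximal d (ennreal p) h x \<le> ennreal (6 ^ d * t)"
proof -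
  obtain x where x: "x \<in> cset d (dil d (2 ^ 5) L)" "x \<notin> E" using touch[OF assms] by auto
  then have "x \<notin> heavy_set d c (pw p h) (t powr p)" using heavy by auto
  then have "maximal d (ennreal p) h x \<le> ennreal (6 ^ d * t)"
    using p t hm by (intro maximal_le_off_heavy_set) auto
  then show ?thesis using that x by blast
qed

lemma mass_le_of_maximal:
  assumes "maximal d (ennreal p) h x \<le> ennreal s" "0 \<le> s" "is_cube d R" "x \<in> cset d R"
  shows "emeasure (pmass d p h) (cset d R) \<le> ennreal (s powr p * side R ^ d)"
proof -
  have "avg d (ennreal p) h R = avg d (ennreal p) h R * indicator (cset d R) x" using assms by simp
  also have "\<dots> \<le> maximal d (ennreal p) h x"
    unfolding maximal_def using assms(3) by (intro SUP_upper) simp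
  also have "\<dots> \<le> ennreal s" by (rule assms(1))
  finally show ?thesis
    using assms p hm by (subst (asm) avg_le_iff) (auto simp: is_cube_def)
qed

text \<open>
  The average over a stopping cube is controlled by the average over its 32-fold dilate, which
  contains a point where the maximal function is small. The passage from \<open>L\<^sup>p\<close> to \<open>L\<^sup>1\<close> uses
  \<open>u \<le> 1 + u\<^sup>p\<close> after scaling.
\<close>

lemma mean_bound:
  assumes L: "L \<in> \<Q>"
  shows "cmod (mean h L) \<le> 384 ^ d * t"
proof -
  \<comment> \<open>6 from the maximal function on \<open>32L\<close> and 32 from the ratio of the sidelengths\<close>
  define T where "T = 192 ^ d * t"
  define v where "v = side L ^ d"
  have T: "0 < T" using t by (simp add: T_def)
  have v: "0 < v" using side_pos[OF L] by (simp add: v_def)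
  obtain x where x: "x \<in> cset d (dil d (2 ^ 5) L)" "maximal d (ennreal p) h x \<le> ennreal (6 ^ d * t)"
    using light_point[OF L] by metis
  have cube: "is_cube d (dil d (2 ^ 5) L)"
    using side_pos[OF L] by (simp add: is_cube_def dil_def Rd_def)
  have "emeasure (pmass d p h) (cset d L) \<le> emeasure (pmass d p h) (cset d (dil d (2 ^ 5) L))"
    using side_pos[OF L] by (intro emeasure_mono cset_subset_dil) auto
  also have "\<dots> \<le> ennreal ((6 ^ d * t) powr p * side (dil d (2 ^ 5) L) ^ d)"
    using t by (intro mass_le_of_maximal[OF x(2) _ cube x(1)]) auto
  also have "\<dots> \<le> ennreal (T powr p * v)"
  proof (rule ennreal_leI)
    have "(32 ^ d :: real) powr 1 \<le> (32 ^ d) powr p" using p by (intro powr_mono) auto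
    then have "(6 ^ d * t) powr p * (32 ^ d * v) \<le> (6 ^ d * t) powr p * ((32 ^ d) powr p * v)"
      using v by (intro mult_left_mono mult_right_mono) auto
    also have "\<dots> = (6 ^ d * t * 32 ^ d) powr p * v" using t by (simp add: powr_mult)
    also have "6 ^ d * t * 32 ^ d = T"
      using power_mult_distrib[of "6::real" 32 d] by (simp add: T_def)
    finally show "(6 ^ d * t) powr p * side (dil d (2 ^ 5) L) ^ d \<le> T powr p * v"
      by (simp add: v_def power_mult_distrib)
  qed
  finally have mass: "emeasure (pmass d p h) (cset d L) \<le> ennreal (T powr p * v)" .
  have pt: "u \<le> T + T / T powr p * u powr p" if "0 \<le> u" for u
  proof (cases "u \<le> T")
    case False
    then have "(u / T) powr 1 \<le> (u / T) powr p" using T p by (intro powr_mono) auto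
    then have "u \<le> T * (u / T) powr p" using T that False by (simp add: field_simps)
    then show ?thesis using T that by (simp add: powr_divide)
  qed (use T in \<open>simp add: add_increasing2\<close>)
  have "ennreal (cmod (LINT x:cset d L|leb d. h x)) \<le> (\<integral>\<^sup>+x. ennreal (norm (indicator (cset d L) x *\<^sub>R h x)) \<partial>leb d)"
    unfolding set_lebesgue_integral_def
  proof (cases "integrable (leb d) (\<lambda>x. indicat_real (cset d L) x *\<^sub>R h x)")
    case True
    then show "ennreal (cmod (LINT x|leb d. indicat_real (cset d L) x *\<^sub>R h x))
        \<le> (\<integral>\<^sup>+x. ennreal (norm (indicat_real (cset d L) x *\<^sub>R h x)) \<partial>leb d)"
      by (rule integral_norm_bound_ennreal)
  qed (simp add: not_integrable_integral_eq)
  also have "\<dots> \<le> (\<integral>\<^sup>+x. ennreal T * indicator (cset d L) x + ennreal (T / T powr p) * (pw p h x * indicator (cset d L) x) \<partial>leb d)"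
  proof (rule nn_integral_mono)
    fix x
    have "ennreal (cmod (h x)) \<le> ennreal (T + T / T powr p * cmod (h x) powr p)"
      using pt[of "cmod (h x)"] by (intro ennreal_leI) simp
    also have "\<dots> = ennreal T + ennreal (T / T powr p * cmod (h x) powr p)"
      using T by (intro ennreal_plus) auto
    also have "ennreal (T / T powr p * cmod (h x) powr p) = ennreal (T / T powr p) * pw p h x"
      using T by (intro ennreal_mult) auto
    finally show "ennreal (norm (indicator (cset d L) x *\<^sub>R h x)) \<le> ennreal T * indicator (cset d L) x + ennreal (T / T powr p) * (pw p h x * indicator (cset d L) x)"
      by (simp add: indicator_def)
  qed
  also have "\<dots> = ennreal T * emeasure (leb d) (cset d L) + ennreal (T / T powr p) * emeasure (pmass d p h) (cset d L)"
    using hm by (simp add: nn_integral_add nn_integral_cmult emeasure_density nn_integral_cmult_indicator)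
  also have "\<dots> \<le> ennreal (T * v) + ennreal (T / T powr p) * ennreal (T powr p * v)"
  proof (rule add_mono)
    show "ennreal T * emeasure (leb d) (cset d L) \<le> ennreal (T * v)"
      using T side_pos[OF L] by (simp add: emeasure_cset v_def ennreal_mult)
  qed (rule mult_left_mono[OF mass], simp)
  also have "\<dots> = ennreal (2 * T * v)"
  proof -
    have "ennreal (T / T powr p) * ennreal (T powr p * v) = ennreal (T * v)"
      using T v by (simp flip: ennreal_mult)
    then show ?thesis using T v by (simp flip: ennreal_plus)
  qed
  finally have "cmod (LINT x:cset d L|leb d. h x) \<le> 2 * T * v" using T v by (simp)
  then have "cmod (mean h L) \<le> 2 * T"
    using v side_pos[OF L] by (simp add: mean_def norm_divide norm_power v_def field_simps)
  also have "\<dots> \<le> 384 ^ d * t"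
  proof -
    have "(2::real) ^ 1 \<le> 2 ^ d" using d1 by (intro power_increasing) auto
    then have "(2::real) * 192 ^ d \<le> 2 ^ d * 192 ^ d" by simp
    also have "\<dots> = 384 ^ d" using power_mult_distrib[of "2::real" 192 d] by simp
    finally show ?thesis using t by (simp add: T_def)
  qed
  finally show ?thesis .
qed

lemma AE_good_bound: "AE x in leb d. cmod (good h x) \<le> 384 ^ d * t"
  using off_shadow
proof eventually_elim
  fix x assume x: "x \<notin> shadow d \<Q> \<longrightarrow> cmod (h x) \<le> 12 ^ d * t"
  show "cmod (good h x) \<le> 384 ^ d * t"
  proof (cases "x \<in> shadow d \<Q>")
    case True
    then obtain L where L: "L \<in> \<Q>" "x \<in> cset d L" by (rule shadowE)
    then show ?thesis using True mean_bound[OF L(1)] by (simp add: good_def stop_eq)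
  next
    case False
    have "(12::real) ^ d \<le> 384 ^ d" by (intro power_mono) auto
    then have "12 ^ d * t \<le> 384 ^ d * t" using t by simp
    then show ?thesis using False x by (simp add: good_def)
  qed
qed

lemma good_bounded: "cmod (good h x) \<le> B + 384 ^ d * t"
proof (cases "x \<in> shadow d \<Q>")
  case True
  then obtain L where L: "L \<in> \<Q>" "x \<in> cset d L" by (rule shadowE)
  have "good h x = mean h L" using True L by (simp add: good_def stop_eq)
  then show ?thesis using mean_bound[OF L(1)] B_nonneg by simp
next
  case False
  have "good h x = h x" using False by (simp add: good_def)
  moreover have "0 \<le> 384 ^ d * t" using t by simp
  ultimately show ?thesis using bd[of x] by simp
qed

lemma bad_bounded: "cmod (bad h x) \<le> B + 384 ^ d * t"
proof (cases "x \<in> shadow d \<Q>")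
  case True
  then obtain L where L: "L \<in> \<Q>" "x \<in> cset d L" by (rule shadowE)
  have "bad h x = h x - mean h L" using True L by (simp add: bad_def stop_eq)
  then have "cmod (bad h x) \<le> cmod (h x) + cmod (mean h L)"
    by (simp add: norm_triangle_ineq4)
  then show ?thesis using mean_bound[OF L(1)] bd[of x] by linarith
next
  case False
  have "bad h x = 0" using False by (simp add: bad_def)
  moreover have "0 \<le> 384 ^ d * t" using t by simp
  ultimately show ?thesis using B_nonneg by simp
qed

lemma good_supp: "x \<in> Rd d \<Longrightarrow> x \<notin> cset d (dil d 3 Q) \<Longrightarrow> good h x = 0"
  using supp[of x] sh by (auto simp: good_def)

lemma bad_supp: "x \<in> Rd d \<Longrightarrow> x \<notin> cset d (dil d 3 Q) \<Longrightarrow> bad h x = 0"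
  using sh by (auto simp: bad_def)

lemma Ynorm_h: "Ynorm d (ennreal p) \<Q> h \<le> ennreal (12 ^ d * t)"
proof -
  have 1: "Lnorm d top (cut (- shadow d \<Q>) h) \<le> ennreal (12 ^ d * t)"
  proof (rule esssup_Lnorm_le)
    have "- shadow d \<Q> \<inter> space (leb d) = space (leb d) - shadow d \<Q>" by auto
    then show "cut (- shadow d \<Q>) h \<in> borel_measurable (leb d)"
      using shadow_leb by (intro cut_measurable hm) (metis sets.compl_sets)
    show "AE x in leb d. cmod (cut (- shadow d \<Q>) h x) \<le> 12 ^ d * t"
      using off_shadow by eventually_elim (use t in \<open>auto simp: cut_def\<close>)
  qed
  have 2: "(SUP L\<in>\<Q>. INF x\<in>cset d (dil d (2 ^ 5) L). maximal d (ennreal p) h x) \<le> ennreal (12 ^ d * t)"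
  proof (rule SUP_least)
    fix L assume "L \<in> \<Q>"
    then obtain x where x: "x \<in> cset d (dil d (2 ^ 5) L)" "maximal d (ennreal p) h x \<le> ennreal (6 ^ d * t)"
      using light_point by metis
    have "(6::real) ^ d \<le> 12 ^ d" by (intro power_mono) auto
    then have "ennreal (6 ^ d * t) \<le> ennreal (12 ^ d * t)" using t by (intro ennreal_leI) simp
    then show "(INF x\<in>cset d (dil d (2 ^ 5) L). maximal d (ennreal p) h x) \<le> ennreal (12 ^ d * t)"
      using x by (intro INF_lower2[OF x(1)]) simp
  qed
  show ?thesis unfolding Ynorm_def using 1 2 by simp
qed

text \<open>
  The bad part is dominated by \<open>h\<close> plus a bounded function, so its maximal function is small at the
  same points.
\<close>

lemma Ynorm_bad: "Ynorm d (ennreal p) \<Q> (bad h) \<le> ennreal (2048 ^ d * t)"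
proof -
  \<comment> \<open>the bound for the good part\<close>
  define G where "G = 384 ^ d * t"
  have G: "0 < G" using t by (simp add: G_def)
  have G4: "4 * G \<le> 2048 ^ d * t"
  proof -
    have "(4::real) ^ 1 \<le> 4 ^ d" using d1 by (intro power_increasing) auto
    then have "(4::real) * 384 ^ d \<le> 4 ^ d * 384 ^ d" by simp
    also have "\<dots> = 1536 ^ d" using power_mult_distrib[of "4::real" 384 d] by simp
    also have "\<dots> \<le> 2048 ^ d" by (intro power_mono) auto
    finally show ?thesis using t by (simp add: G_def)
  qed
  have 1: "Lnorm d top (cut (- shadow d \<Q>) (bad h)) \<le> ennreal (2048 ^ d * t)"
  proof (rule esssup_Lnorm_le)
    have "cut (- shadow d \<Q>) (bad h) = (\<lambda>_. 0)" by (auto simp: cut_def bad_def)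
    then show "cut (- shadow d \<Q>) (bad h) \<in> borel_measurable (leb d)"
      "AE x in leb d. cmod (cut (- shadow d \<Q>) (bad h) x) \<le> 2048 ^ d * t" using t by auto
  qed
  have 2: "maximal d (ennreal p) (bad h) x \<le> ennreal (4 * G)"
    if x: "maximal d (ennreal p) h x \<le> ennreal (6 ^ d * t)" for x
    unfolding maximal_def
  proof (rule SUP_least)
    fix R assume "R \<in> {Q. is_cube d Q}"
    then have R: "is_cube d R" "0 < side R" by (auto simp: is_cube_def)
    define v where "v = side R ^ d"
    have v: "0 < v" using R by (simp add: v_def)
    show "avg d (ennreal p) (bad h) R * indicator (cset d R) x \<le> ennreal (4 * G)"
    proof (cases "x \<in> cset d R")
      case True
      have "(6::real) ^ d \<le> 384 ^ d" by (intro power_mono) auto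
      then have "(6 ^ d * t) powr p \<le> G powr p"
        using t p unfolding G_def by (intro powr_mono2) auto
      then have mh: "emeasure (pmass d p h) (cset d R) \<le> ennreal (G powr p * v)"
        using v t by (intro order_trans[OF mass_le_of_maximal[OF x _ R(1) True]])
          (auto simp: v_def intro!: ennreal_leI mult_right_mono)
      have pt: "cmod (bad h y) powr p \<le> 2 powr p * (cmod (h y) powr p + G powr p)"
        if "cmod (good h y) \<le> G" for y
      proof -
        have "cmod (bad h y) = cmod (h y - good h y)" using good_plus_bad[of h y] by (metis add_diff_cancel_left')
        also have "\<dots> \<le> cmod (h y) + cmod (good h y)" by (rule norm_triangle_ineq4)
        also have "\<dots> \<le> 2 * max (cmod (h y)) G" using that by linarith
        finally have "cmod (bad h y) powr p \<le> (2 * max (cmod (h y)) G) powr p" using p by (intro powr_mono2) auto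
        also have "\<dots> = 2 powr p * max (cmod (h y)) G powr p" using G by (intro powr_mult)
        also have "\<dots> \<le> 2 powr p * (cmod (h y) powr p + G powr p)"
          by (intro mult_left_mono) (auto simp: max_def)
        finally show ?thesis .
      qed
      have "emeasure (pmass d p (bad h)) (cset d R) = (\<integral>\<^sup>+y. pw p (bad h) y * indicator (cset d R) y \<partial>leb d)"
        using bad_measurable[OF hm] by (subst emeasure_density) auto
      also have "\<dots> \<le> (\<integral>\<^sup>+y. ennreal (2 powr p) * (pw p h y * indicator (cset d R) y + ennreal (G powr p) * indicator (cset d R) y) \<partial>leb d)"
      proof (rule nn_integral_mono_AE)
        show "AE y in leb d. pw p (bad h) y * indicator (cset d R) y \<le>
            ennreal (2 powr p) * (pw p h y * indicator (cset d R) y + ennreal (G powr p) * indicator (cset d R) y)"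
          using AE_good_bound
        proof eventually_elim
          fix y assume "cmod (good h y) \<le> 384 ^ d * t"
          then have "pw p (bad h) y \<le> ennreal (2 powr p * (cmod (h y) powr p + G powr p))"
            using pt[of y] by (intro ennreal_leI) (simp add: G_def)
          also have "\<dots> = ennreal (2 powr p) * (pw p h y + ennreal (G powr p))"
            by (simp add: ennreal_mult ennreal_plus)
          finally show "pw p (bad h) y * indicator (cset d R) y \<le>
            ennreal (2 powr p) * (pw p h y * indicator (cset d R) y + ennreal (G powr p) * indicator (cset d R) y)"
            by (simp add: indicator_def)
        qed
      qed
      also have "\<dots> = ennreal (2 powr p) * (emeasure (pmass d p h) (cset d R) + ennreal (G powr p) * emeasure (leb d) (cset d R))"
        using hm by (simp add: nn_integral_add nn_integral_cmult emeasure_density nn_integral_cmult_indicator)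
      also have "\<dots> \<le> ennreal (2 powr p) * (ennreal (G powr p * v) + ennreal (G powr p * v))"
        using mh R(2) by (intro mult_left_mono add_mono) (auto simp: emeasure_cset v_def ennreal_mult)
      also have "\<dots> = ennreal (2 powr p * (2 * (G powr p * v)))"
        using v by (simp flip: ennreal_plus ennreal_mult)
      also have "\<dots> \<le> ennreal ((4 * G) powr p * side R ^ d)"
      proof (rule ennreal_leI)
        have "(2::real) powr 1 \<le> 2 powr p" using p by (intro powr_mono) auto
        then have "2 powr p * (2 * (G powr p * v)) \<le> 2 powr p * (2 powr p * (G powr p * v))"
          using v by (intro mult_left_mono mult_right_mono) auto
        also have "\<dots> = (4 * G) powr p * v"
        proof -
          have "(2 * (2 * G)) powr p = 2 powr p * (2 * G) powr p" by (rule powr_mult)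
          also have "(2 * G) powr p = 2 powr p * G powr p" by (rule powr_mult)
          finally show ?thesis by simp
        qed
        finally show "2 powr p * (2 * (G powr p * v)) \<le> (4 * G) powr p * side R ^ d" by (simp add: v_def)
      qed
      finally have "avg d (ennreal p) (bad h) R \<le> ennreal (4 * G)"
        using p G R(2) bad_measurable[OF hm] by (subst avg_le_iff) auto
      then show ?thesis using True by simp
    qed simp
  qed
  have 3: "(SUP L\<in>\<Q>. INF x\<in>cset d (dil d (2 ^ 5) L). maximal d (ennreal p) (bad h) x) \<le> ennreal (2048 ^ d * t)"
  proof (rule SUP_least)
    fix L assume "L \<in> \<Q>"
    then obtain x where x: "x \<in> cset d (dil d (2 ^ 5) L)" "maximal d (ennreal p) h x \<le> ennreal (6 ^ d * t)"
      using light_point by metis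
    then show "(INF x\<in>cset d (dil d (2 ^ 5) L). maximal d (ennreal p) (bad h) x) \<le> ennreal (2048 ^ d * t)"
      using 2[OF x(2)] G4 by (intro INF_lower2[OF x(1)]) (auto elim!: order_trans intro: ennreal_leI)
  qed
  show ?thesis unfolding Ynorm_def using 1 3 by simp
qed

lemma Yspace_h: "h \<in> Yspace d (ennreal p) Q \<Q>"
proof -
  have "h \<in> Lspace d (ennreal p)"
    by (rule bounded_in_Lspace[OF p hm bd, of "dil d 3 Q"]) (use side_Q supp in auto)
  moreover have "supported_in d h (cset d (dil d 3 Q))"
    unfolding supported_in_def by (rule AE_I2) (use supp in auto)
  moreover have "Ynorm d (ennreal p) \<Q> h < top"
    using Ynorm_h ennreal_less_top by (rule le_less_trans)
  ultimately show ?thesis by (simp add: Yspace_def)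
qed

lemma Ynorm_good: "Ynorm d top \<Q> (good h) \<le> ennreal (384 ^ d * t)"
  unfolding Ynorm_def using esssup_Lnorm_le[OF good_measurable[OF hm] AE_good_bound] by simp

lemma Yspace_good: "good h \<in> Yspace d top Q \<Q>"
proof -
  have n: "Ynorm d top \<Q> (good h) < top" using Ynorm_good ennreal_less_top by (rule le_less_trans)
  then have "good h \<in> Lspace d top"
    using good_measurable[OF hm] by (simp add: Lspace_def Ynorm_def)
  moreover have "supported_in d (good h) (cset d (dil d 3 Q))"
    unfolding supported_in_def by (rule AE_I2) (use good_supp in auto)
  ultimately show ?thesis using n by (simp add: Yspace_def)
qed

lemma bad_mean_zero:
  assumes L: "L \<in> \<Q>"
  shows "(LINT x:cset d L|leb d. cut (cset d L) (bad h) x) = 0"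
proof -
  define v where "v = side L ^ d"
  have v: "0 < v" using side_pos[OF L] by (simp add: v_def)
  have fin: "emeasure (leb d) (cset d L) < \<infinity>" using side_pos[OF L] by (simp add: emeasure_cset)
  have meas: "measure (leb d) (cset d L) = v"
    using side_pos[OF L] by (simp add: measure_def emeasure_cset v_def)
  have int: "set_integrable (leb d) (cset d L) h"
    unfolding set_integrable_def
  proof (rule integrableI_bounded_set_indicator[of _ _ _ B])
    show "AE x in leb d. x \<in> cset d L \<longrightarrow> norm (h x) \<le> B" using bd by auto
  qed (use fin hm in auto)
  have intc: "set_integrable (leb d) (cset d L) (\<lambda>x. mean h L)"
    unfolding set_integrable_def using fin by auto
  have "(LINT x:cset d L|leb d. cut (cset d L) (bad h) x) = (LINT x:cset d L|leb d. h x - mean h L)"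
    using L by (intro set_lebesgue_integral_cong) (auto simp: cut_def bad_def shadow_def stop_eq)
  also have "\<dots> = (LINT x:cset d L|leb d. h x) - (LINT x:cset d L|leb d. mean h L)"
    using int intc by (rule set_integral_diff)
  also have "(LINT x:cset d L|leb d. mean h L) = complex_of_real v * mean h L"
    unfolding set_lebesgue_integral_def
    using fin cset_subset_Rd[of d L] by (simp add: meas scaleR_conv_of_real Int_absorb2)
  also have "complex_of_real v * mean h L = (LINT x:cset d L|leb d. h x)"
    using v side_pos[OF L] by (simp add: mean_def v_def)
  finally show ?thesis by simp
qed

lemma Xdot_bad: "bad h \<in> Xdot d (ennreal p) Q \<Q>"
proof -
  have n: "Ynorm d (ennreal p) \<Q> (bad h) < top" using Ynorm_bad ennreal_less_top by (rule le_less_trans)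
  have "bad h \<in> Lspace d (ennreal p)"
    by (rule bounded_in_Lspace[OF p bad_measurable[OF hm] bad_bounded, of "dil d 3 Q"]) (use side_Q bad_supp in auto)
  moreover have "supported_in d (bad h) (cset d (dil d 3 Q))"
    unfolding supported_in_def by (rule AE_I2) (use bad_supp in auto)
  ultimately have Y: "bad h \<in> Yspace d (ennreal p) Q \<Q>" using n by (simp add: Yspace_def)
  have "splits_as d \<Q> (bad h) (\<lambda>L. cut (cset d L) (bad h))"
    unfolding splits_as_def
  proof (rule conjI)
    show "\<forall>L\<in>\<Q>. supported_in d (cut (cset d L) (bad h)) (cset d L)"
      by (simp add: supported_in_def cut_def)
    show "AE x in leb d. ((\<lambda>L. cut (cset d L) (bad h) x) has_sum bad h x) \<Q>"
    proof (rule AE_I2)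
    fix x
    show "((\<lambda>L. cut (cset d L) (bad h) x) has_sum bad h x) \<Q>"
    proof (cases "x \<in> shadow d \<Q>")
      case True
      then obtain L where L: "L \<in> \<Q>" "x \<in> cset d L" by (rule shadowE)
      have other: "cut (cset d L') (bad h) x = 0" if "L' \<in> \<Q> - {L}" for L'
      proof -
        have "cset d L \<inter> cset d L' = {}" using disj L(1) that unfolding disjoint_family_on_def by blast
        then show ?thesis using L(2) by (auto simp: cut_def)
      qed
      have "((\<lambda>L. cut (cset d L) (bad h) x) has_sum (\<Sum>L\<in>{L}. cut (cset d L) (bad h) x)) {L}"
        by (rule has_sum_finite) simp
      then have "((\<lambda>L. cut (cset d L) (bad h) x) has_sum bad h x) {L}"
        using L(2) by (simp add: cut_def)
      moreover have "((\<lambda>L. cut (cset d L) (bad h) x) has_sum bad h x) {L} \<longleftrightarrow>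
          ((\<lambda>L. cut (cset d L) (bad h) x) has_sum bad h x) \<Q>"
        using L(1) other by (intro has_sum_cong_neutral) simp_all
      ultimately show ?thesis by (rule iffD1[rotated])
    next
      case False
      then have "cut (cset d L) (bad h) x = 0" if "L \<in> \<Q>" for L
        by (simp add: cut_def bad_def)
      moreover have "bad h x = 0" using False by (simp add: bad_def)
      ultimately show ?thesis using has_sum_0[of \<Q> "\<lambda>L. cut (cset d L) (bad h) x"] by simp
    qed
    qed
  qed
  then have "\<exists>bL. splits_as d \<Q> (bad h) bL \<and> (\<forall>L\<in>\<Q>. (LINT x:cset d L|leb d. bL L x) = 0)"
    using bad_mean_zero by (intro exI[where x = "\<lambda>L. cut (cset d L) (bad h)"]) simp
  then show ?thesis
    unfolding Xdot_def Xspace_def using Y by auto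
qed

end

end

section \<open>The estimate for one cube\<close>

lemma floor_scale_le: "0 < side Q \<Longrightarrow> 2 powi \<lfloor>scale Q\<rfloor> \<le> side Q"
proof -
  assume Q: "0 < side Q"
  have "(2::real) powi \<lfloor>scale Q\<rfloor> = 2 powr of_int \<lfloor>scale Q\<rfloor>" by (simp add: powr_real_of_int')
  also have "\<dots> \<le> 2 powr scale Q" by (intro powr_mono) auto
  also have "\<dots> = side Q" using Q by (simp add: scale_def)
  finally show ?thesis .
qed

text \<open>
  The kernels of scale at most \<open>s\<^sub>Q\<close> move points by less than the sidelength of \<open>Q\<close>, so the second
  entry is only seen on \<open>3Q\<close>.
\<close>

lemma loc_form_cut:
  assumes K: "single_scale d q K Ks" and Q: "0 < side Q"
  shows "loc_form d Ks Q \<mu> \<nu> h1 h2 =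
    trunc_form d Ks \<mu> (min \<lfloor>scale Q\<rfloor> \<nu>) (cut (cset d Q) h1) (cut (cset d (dil d 3 Q)) h2)"
  unfolding loc_form_def trunc_form_def
proof (rule Bochner_Integration.integral_cong[OF refl])
  fix z assume z: "z \<in> space (leb2 d)"
  define x where "x = fst z"
  define y where "y = snd z"
  have R: "x \<in> Rd d" "y \<in> Rd d" using z by (auto simp: x_def y_def)
  have "ksum Ks \<mu> (min \<lfloor>scale Q\<rfloor> \<nu>) x y = 0" if xy: "y \<in> cset d Q" "x \<notin> cset d (dil d 3 Q)"
    unfolding ksum_def
  proof (rule sum.neutral, rule ballI, rule ccontr)
    fix s assume s: "s \<in> {\<mu><..min \<lfloor>scale Q\<rfloor> \<nu>}" and nz: "Ks s x y \<noteq> 0"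
    have "(2::real) powi s \<le> 2 powi \<lfloor>scale Q\<rfloor>" using s by simp
    also have "\<dots> \<le> side Q" by (rule floor_scale_le[OF Q])
    finally have le: "(2::real) powi s \<le> side Q" .
    have "corner Q i - side Q \<le> x i \<and> x i < corner Q i + 2 * side Q" if i: "i < d" for i
    proof -
      have "\<bar>x i - y i\<bar> < side Q" using single_scale_support[OF K R nz i] le by linarith
      moreover have "corner Q i \<le> y i" "y i < corner Q i + side Q" using xy(1) i by (auto simp: cset_def)
      ultimately show ?thesis by linarith
    qed
    then have "x \<in> cset d (dil d 3 Q)" using R(1) unfolding cset_dil by auto
    then show False using xy(2) by simp
  qed
  then show "trunc_integrand Ks \<mu> (min \<lfloor>scale Q\<rfloor> \<nu>) (cut (cset d Q) h1) h2 z =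
      trunc_integrand Ks \<mu> (min \<lfloor>scale Q\<rfloor> \<nu>) (cut (cset d Q) h1) (cut (cset d (dil d 3 Q)) h2) z"
    by (auto simp: trunc_integrand_eq cut_def x_def[symmetric] y_def[symmetric])
qed

lemma loc_form_local:
  assumes K: "single_scale d q K Ks" and Q: "0 < side Q"
    and "\<And>x. x \<in> cset d Q \<Longrightarrow> f1 x = h1 x" "\<And>x. x \<in> cset d (dil d 3 Q) \<Longrightarrow> f2 x = h2 x"
  shows "loc_form d Ks Q \<mu> \<nu> f1 f2 = loc_form d Ks Q \<mu> \<nu> h1 h2"
proof -
  have "cut (cset d Q) f1 = cut (cset d Q) h1" "cut (cset d (dil d 3 Q)) f2 = cut (cset d (dil d 3 Q)) h2"
    using assms(3,4) by (auto simp: cut_def)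
  then show ?thesis unfolding loc_form_cut[OF K Q] by simp
qed

lemma sum_vol_le:
  assumes "finite F" "F \<subseteq> dgrid d c" "disjoint_family_on (cset d) F" "\<And>L. L \<in> F \<Longrightarrow> cset d L \<subseteq> cset d Q"
  shows "(\<Sum>L\<in>F. vol d L) \<le> vol d Q"
proof -
  have "(\<Sum>L\<in>F. vol d L) = emeasure (leb d) (\<Union>L\<in>F. cset d L)"
    unfolding vol_def using assms by (intro sum_emeasure) auto
  also have "\<dots> \<le> vol d Q"
    unfolding vol_def using assms(4) by (intro emeasure_mono) auto
  finally show ?thesis .
qed

text \<open>The volumes are bounded below and add up to at most the volume of \<open>Q\<close>.\<close>

lemma finite_large_cubes:
  assumes Q: "0 < side Q" and sub: "\<Q> \<subseteq> dgrid d c" and disj: "disjoint_family_on (cset d) \<Q>"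
  shows "finite {L\<in>\<Q>. cset d L \<subseteq> cset d Q \<and> \<mu> < \<lfloor>scale L\<rfloor>}" (is "finite ?F")
proof -
  define v where "v = (2 powi \<mu> :: real) ^ d"
  have v: "0 < v" by (simp add: v_def)
  have "card G \<le> nat \<lceil>side Q ^ d / v\<rceil>" if G: "G \<subseteq> ?F" "finite G" for G
  proof -
    have "ennreal (real (card G) * v) = (\<Sum>L\<in>G. ennreal v)"
      using v by (simp add: ennreal_mult ennreal_of_nat_eq_real_of_nat)
    also have "\<dots> \<le> (\<Sum>L\<in>G. vol d L)"
    proof (rule sum_mono)
      fix L assume L: "L \<in> G"
      then have "L \<in> dgrid d c" using G sub by auto
      then have pos: "0 < side L" using dgrid_is_cube by (auto simp: is_cube_def)
      have "(2::real) powi \<mu> \<le> 2 powi \<lfloor>scale L\<rfloor>" using L G by auto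
      then have "2 powi \<mu> \<le> side L" using floor_scale_le[OF pos] by linarith
      then have "v \<le> side L ^ d" unfolding v_def by (intro power_mono) auto
      then show "ennreal v \<le> vol d L" using pos by (simp add: vol_eq)
    qed
    also have "\<dots> \<le> vol d Q"
    proof (rule sum_vol_le)
      show "disjoint_family_on (cset d) G" using disj G by (auto simp: disjoint_family_on_def)
      show "G \<subseteq> dgrid d c" using G sub by auto
    qed (use G in auto)
    also have "\<dots> = ennreal (side Q ^ d)" using Q by (simp add: vol_eq)
    finally have "real (card G) * v \<le> side Q ^ d" using Q by (subst (asm) ennreal_le_iff) auto
    then have "real (card G) \<le> side Q ^ d / v" using v by (simp add: field_simps)
    then have "real (card G) \<le> real_of_int \<lceil>side Q ^ d / v\<rceil>" by linarith
    then show ?thesis by linarith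
  qed
  then show ?thesis using finite_if_finite_subsets_card_bdd by blast
qed

text \<open>Stopping cubes of scale at most \<open>\<mu>\<close> have an empty range of scales.\<close>

lemma coll_form_finite:
  fixes d Ks Q \<Q> \<mu>
  defines "F \<equiv> {L\<in>\<Q>. cset d L \<subseteq> cset d Q \<and> \<mu> < \<lfloor>scale L\<rfloor>}"
  assumes "finite F"
  shows "coll_form d Ks Q \<Q> \<mu> \<nu> h1 h2 = loc_form d Ks Q \<mu> \<nu> h1 h2 - (\<Sum>L\<in>F. loc_form d Ks L \<mu> \<nu> h1 h2)"
proof -
  have "(\<Sum>\<^sub>\<infinity>L\<in>{L\<in>\<Q>. cset d L \<subseteq> cset d Q}. loc_form d Ks L \<mu> \<nu> h1 h2) = (\<Sum>\<^sub>\<infinity>L\<in>F. loc_form d Ks L \<mu> \<nu> h1 h2)"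
  proof (rule infsum_cong_neutral)
    fix L assume "L \<in> {L\<in>\<Q>. cset d L \<subseteq> cset d Q} - F"
    then have "min \<lfloor>scale L\<rfloor> \<nu> \<le> \<mu>" by (auto simp: F_def)
    then show "loc_form d Ks L \<mu> \<nu> h1 h2 = 0" unfolding loc_form_def by (rule trunc_form_trivial)
  qed (auto simp: F_def)
  then show ?thesis using assms by (simp add: coll_form_def)
qed

text \<open>
  Splitting both entries into good and bad parts leaves two terms to which the cancellative
  localized estimates apply, and one term with two bounded entries.
\<close>

lemma loc_form_split:
  assumes K: "single_scale d q K Ks" and q: "1 < q"
    and m: "g1 \<in> borel_measurable (leb d)" "b1 \<in> borel_measurable (leb d)"
      "g2 \<in> borel_measurable (leb d)" "b2 \<in> borel_measurable (leb d)"
    and bd: "\<And>x. cmod (g1 x) \<le> B" "\<And>x. cmod (b1 x) \<le> B" "\<And>x. cmod (g2 x) \<le> B" "\<And>x. cmod (b2 x) \<le> B"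
    and h: "\<And>x. g1 x + b1 x = h1 x" "\<And>x. g2 x + b2 x = h2 x"
    and R: "0 < side R" "\<And>x. x \<in> Rd d \<Longrightarrow> x \<notin> cset d R \<Longrightarrow> g2 x = 0"
      "\<And>x. x \<in> Rd d \<Longrightarrow> x \<notin> cset d R \<Longrightarrow> b2 x = 0"
  shows "loc_form d Ks L \<mu> \<nu> h1 h2 =
    loc_form d Ks L \<mu> \<nu> b1 h2 + loc_form d Ks L \<mu> \<nu> g1 b2 + loc_form d Ks L \<mu> \<nu> g1 g2"
proof -
  let ?n = "min \<lfloor>scale L\<rfloor> \<nu>" and ?c = "cut (cset d L)"
  have B: "0 \<le> B" using bd(1) norm_ge_zero order_trans by blast
  have conv: "trunc_converges d Ks \<mu> ?n (?c u) v"
    if "u \<in> borel_measurable (leb d)" "v \<in> borel_measurable (leb d)" "\<And>x. cmod (u x) \<le> B" "\<And>x. cmod (v x) \<le> 2 * B"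
      "\<And>x. x \<in> Rd d \<Longrightarrow> x \<notin> cset d R \<Longrightarrow> v x = 0" for u v
  proof (rule trunc_converges_bounded[OF K q _ that(2) _ that(4) R(1) that(5)])
    show "?c u \<in> borel_measurable (leb d)" using that(1) cset_leb by (rule cut_borel_leb)
    show "cmod (?c u x) \<le> 2 * B" for x
      using that(3)[of x] B by (auto simp: cut_def)
  qed
  have h2: "h2 = (\<lambda>x. g2 x + b2 x)" using h(2) by auto
  have ch1: "?c h1 = (\<lambda>x. ?c b1 x + ?c g1 x)" using h(1) by (auto simp: cut_def add.commute)
  have h2m: "h2 \<in> borel_measurable (leb d)" unfolding h2 using m by simp
  have h2b: "cmod (h2 x) \<le> 2 * B" for x
    using norm_triangle_ineq[of "g2 x" "b2 x"] bd(3,4)[of x] h(2)[of x] by simp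
  have h20: "x \<in> Rd d \<Longrightarrow> x \<notin> cset d R \<Longrightarrow> h2 x = 0" for x unfolding h2 using R by simp
  have 2: "cmod (g2 x) \<le> 2 * B" "cmod (b2 x) \<le> 2 * B" for x using bd(3,4)[of x] B by linarith+
  have "loc_form d Ks L \<mu> \<nu> h1 h2 = loc_form d Ks L \<mu> \<nu> b1 h2 + loc_form d Ks L \<mu> \<nu> g1 h2"
    unfolding loc_form_def ch1
    by (rule trunc_form_add1) (rule conv[OF m(2) h2m bd(2) h2b h20], assumption, assumption, rule conv[OF m(1) h2m bd(1) h2b h20], assumption, assumption)
  moreover have "loc_form d Ks L \<mu> \<nu> g1 h2 = loc_form d Ks L \<mu> \<nu> g1 g2 + loc_form d Ks L \<mu> \<nu> g1 b2"
    unfolding loc_form_def h2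
    by (rule trunc_form_add2) (rule conv[OF m(1) m(3) bd(1) 2(1) R(2)], assumption, assumption, rule conv[OF m(1) m(4) bd(1) 2(2) R(3)], assumption, assumption)
  ultimately show ?thesis by simp
qed

lemma coll_converges_bounded:
  assumes K: "single_scale d q K Ks" and q: "1 < q"
    and m: "u \<in> borel_measurable (leb d)" "v \<in> borel_measurable (leb d)"
    and bd: "\<And>x. cmod (u x) \<le> B" "\<And>x. cmod (v x) \<le> B"
    and R: "0 < side R" "\<And>x. x \<in> Rd d \<Longrightarrow> x \<notin> cset d R \<Longrightarrow> v x = 0"
  shows "coll_converges d Ks Q \<Q> \<mu> \<nu> u v"
  unfolding coll_converges_def
proof
  fix L
  have B: "0 \<le> B" using bd(1) norm_ge_zero order_trans by blast
  show "trunc_converges d Ks \<mu> (min \<lfloor>scale L\<rfloor> \<nu>) (cut (cset d L) u) v"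
  proof (rule trunc_converges_bounded[OF K q _ m(2) _ bd(2) R])
    show "cut (cset d L) u \<in> borel_measurable (leb d)" using m(1) cset_leb by (rule cut_borel_leb)
    show "cmod (cut (cset d L) u x) \<le> B" for x using bd(1)[of x] B by (auto simp: cut_def)
  qed
qed

lemma loc_form_bound:
  assumes K: "single_scale d q K Ks" and r: "1 < r" and L: "0 < side L"
    and g: "g1 \<in> borel_measurable (leb d)" "g2 \<in> borel_measurable (leb d)"
    and bd: "AE x in leb d. cmod (g1 x) \<le> G1" "AE x in leb d. cmod (g2 x) \<le> G2" and G: "0 < G1" "0 < G2"
  shows "ennreal (cmod (loc_form d Ks L \<mu> \<nu> g1 g2)) \<le> trunc_const d r Ks * ennreal (G1 * G2) * vol d (dil d 3 L)"
  unfolding loc_form_cut[OF K L]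
proof (rule trunc_form_bound[OF r _ _ _ _ G])
  show "cut (cset d L) g1 \<in> borel_measurable (leb d)" "cut (cset d (dil d 3 L)) g2 \<in> borel_measurable (leb d)"
    using g by (auto intro: cut_borel_leb)
  show "AE x in leb d. cmod (cut (cset d L) g1 x) \<le> G1"
    using bd(1) by eventually_elim (use G in \<open>auto simp: cut_def\<close>)
  show "AE x in leb d. cmod (cut (cset d (dil d 3 L)) g2 x) \<le> G2"
    using bd(2) by eventually_elim (use G in \<open>auto simp: cut_def\<close>)
  show "0 < side (dil d 3 L)" using L by simp
  have "cset d L \<subseteq> cset d (dil d 3 L)" using L by (intro cset_subset_dil) auto
  then show "AE x in leb d. x \<notin> cset d (dil d 3 L) \<longrightarrow> cut (cset d L) g1 x = 0"
    by (intro AE_I2) (auto simp: cut_def)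
  show "AE x in leb d. x \<notin> cset d (dil d 3 L) \<longrightarrow> cut (cset d (dil d 3 L)) g2 x = 0"
    by (intro AE_I2) (auto simp: cut_def)
qed

lemma avg_bounded_finite:
  assumes "1 \<le> p" "f \<in> borel_measurable (leb d)" "\<And>x. cmod (f x) \<le> B" "0 < side Q"
  shows "avg d (ennreal p) f Q < top"
proof -
  have B: "0 \<le> B" using assms(3) norm_ge_zero order_trans by blast
  have "emeasure (pmass d p f) (cset d Q) \<le> ennreal (B powr p) * emeasure (leb d) (cset d Q)"
    using assms by (intro bounded_mass_finite) auto
  also have "\<dots> = ennreal (B powr p * side Q ^ d)" using assms by (simp add: emeasure_cset ennreal_mult)
  finally have "avg d (ennreal p) f Q \<le> ennreal B" using assms B by (subst avg_le_iff) auto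
  then show ?thesis using ennreal_less_top le_less_trans by blast
qed

lemma avg_zero_imp:
  assumes p: "1 \<le> p" and f: "f \<in> borel_measurable (leb d)" and Q: "0 < side Q" and z: "avg d (ennreal p) f Q = 0"
  shows "AE x in leb d. cut (cset d Q) f x = 0"
proof -
  have "avg d (ennreal p) f Q \<le> ennreal 0" using z by simp
  then have "emeasure (pmass d p f) (cset d Q) = 0"
    using p f Q by (subst (asm) avg_le_iff) auto
  then have "(\<integral>\<^sup>+x. pw p (cut (cset d Q) f) x \<partial>leb d) = 0"
    using p f by (simp add: emeasure_pmass)
  moreover have "cut (cset d Q) f \<in> borel_measurable (leb d)" using f cset_leb by (rule cut_borel_leb)
  ultimately have "AE x in leb d. pw p (cut (cset d Q) f) x = 0"
    by (subst (asm) nn_integral_0_iff_AE) auto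
  then show ?thesis by eventually_elim (auto simp: ennreal_eq_0_iff)
qed

text \<open>
  The weak type constant and the passage from \<open>Q\<close> to \<open>3Q\<close> cost \<open>9\<^sup>d\<close>, which the threshold \<open>64\<^sup>d\<close>
  times the average more than compensates, uniformly in \<open>p\<close>.
\<close>

lemma heavy_set_small:
  assumes p: "1 \<le> p" and a: "0 < a" and f: "f \<in> borel_measurable (leb d)" and Q: "0 < side Q"
    and av: "avg d (ennreal p) f (dil d 3 Q) \<le> ennreal a"
  shows "emeasure (leb d) (heavy_set d c (pw p (cut (cset d (dil d 3 Q)) f)) ((64 ^ d * a) powr p))
    \<le> ennreal ((1 / 4) ^ d * side Q ^ d)"
proof -
  define s where "s = side Q ^ d"
  have s: "0 < s" using Q by (simp add: s_def)
  let ?h = "cut (cset d (dil d 3 Q)) f" and ?t = "(64 ^ d * a) powr p"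
  let ?H = "heavy_set d c (pw p ?h) ?t"
  have hm: "?h \<in> borel_measurable (leb d)" using f cset_leb by (rule cut_borel_leb)
  have "ennreal ?t * emeasure (leb d) ?H \<le> 3 ^ d * (\<integral>\<^sup>+x. pw p ?h x \<partial>leb d)"
    using hm by (intro weak_type) (rule pw_measurable)
  also have "(\<integral>\<^sup>+x. pw p ?h x \<partial>leb d) = emeasure (pmass d p f) (cset d (dil d 3 Q))"
    using p f by (simp add: emeasure_pmass)
  also have "\<dots> \<le> ennreal (a powr p * side (dil d 3 Q) ^ d)"
    using av p a f Q by (subst (asm) avg_le_iff) auto
  also have "3 ^ d * ennreal (a powr p * side (dil d 3 Q) ^ d) = ennreal (9 ^ d * (a powr p * s))"
  proof -
    have "(3::real) ^ d * 3 ^ d = 9 ^ d" using power_mult_distrib[of "3::real" 3 d] by simp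
    then have "9 ^ d * (a powr p * s) = 3 ^ d * (a powr p * side (dil d 3 Q) ^ d)"
      by (simp add: s_def power_mult_distrib)
    moreover have "(3::ennreal) ^ d = ennreal (3 ^ d)" using ennreal_power[of 3 d] by simp
    moreover have "ennreal (3 ^ d) * ennreal (a powr p * side (dil d 3 Q) ^ d) = ennreal (3 ^ d * (a powr p * side (dil d 3 Q) ^ d))"
      using Q by (intro ennreal_mult[symmetric]) auto
    ultimately show ?thesis using \<open>9 ^ d * (a powr p * s) = 3 ^ d * (a powr p * side (dil d 3 Q) ^ d)\<close> by metis
  qed
  finally have le: "ennreal ?t * emeasure (leb d) ?H \<le> ennreal (9 ^ d * (a powr p * s))"
    by (simp add: mult_left_mono)
  have t: "0 < ?t" using a by simp
  have "emeasure (leb d) ?H \<noteq> top" using le t by (auto simp: ennreal_mult_top top_unique)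
  then obtain e where e: "emeasure (leb d) ?H = ennreal e" "0 \<le> e" by (cases "emeasure (leb d) ?H") auto
  have "?t * e \<le> 9 ^ d * (a powr p * s)"
    using le t e s unfolding e(1) by (subst (asm) ennreal_mult[symmetric]) (auto simp: ennreal_le_iff)
  moreover have "64 ^ d * a powr p * e \<le> ?t * e"
  proof -
    have "(64 ^ d :: real) powr 1 \<le> (64 ^ d) powr p" using p by (intro powr_mono) auto
    then have "64 ^ d * a powr p \<le> ?t" using a by (simp add: powr_mult)
    then show ?thesis using e(2) by (rule mult_right_mono)
  qed
  ultimately have "a powr p * (64 ^ d * e) \<le> a powr p * (9 ^ d * s)" by (simp add: mult_ac)
  then have "64 ^ d * e \<le> 9 ^ d * s" using a by (subst (asm) mult_le_cancel_left_pos) auto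
  also have "\<dots> \<le> 16 ^ d * s" using s by (intro mult_right_mono power_mono) auto
  finally have "64 ^ d * e \<le> 64 ^ d * ((1 / 4) ^ d * s)"
    using power_mult_distrib[of "64::real" "1/4" d] by (simp flip: mult.assoc)
  then have "e \<le> (1 / 4) ^ d * s" by (subst (asm) mult_le_cancel_left_pos) auto
  then show ?thesis unfolding e(1) s_def by (rule ennreal_leI)
qed

lemma quarter_power_le:
  fixes s :: real
  assumes s: "0 < s" and d: "1 \<le> d"
  shows "2 * ((1 / 4) ^ d * s ^ d) \<le> (s / 2) ^ d"
proof -
  have "(1/2::real) ^ d \<le> (1/2) ^ 1" using d by (intro power_decreasing) auto
  then have "2 * (1/2::real) ^ d * ((1/2) ^ d * s ^ d) \<le> 1 * ((1/2) ^ d * s ^ d)"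
    using s by (intro mult_right_mono) auto
  moreover have "(1/4::real) ^ d = (1/2) ^ d * (1/2) ^ d" using power_mult_distrib[of "1/2::real" "1/2" d] by simp
  ultimately show ?thesis by (simp add: power_divide mult_ac)
qed

text \<open>
  The exponent 35 is composed of 11 and 6, for \<open>2048 = 2\<^sup>1\<^sup>1\<close> and \<open>64 = 2\<^sup>6\<close>, each of them for both
  functions, and 1 for the factor 2.
\<close>

lemma constant_collect:
  fixes a1 a2 :: real
  assumes "1 \<le> d" and a: "0 \<le> a1" "0 \<le> a2"
  shows "2 * (2048 ^ d * (64 ^ d * a1) * (2048 ^ d * (64 ^ d * a2))) \<le> 2 powr (35 * real d) * (a1 * a2)"
proof -
  have "(2::real) powr (35 * real d) = (2 ^ 35) ^ d"
    by (simp add: powr_powr[symmetric] powr_realpow[symmetric])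
  also have "\<dots> = 2 ^ d * (2048 ^ d * 64 ^ d * (2048 ^ d * 64 ^ d))"
    by (simp flip: power_mult_distrib)
  finally have e: "(2::real) powr (35 * real d) = 2 ^ d * (2048 ^ d * 64 ^ d * (2048 ^ d * 64 ^ d))" .
  have "(2::real) ^ 1 \<le> 2 ^ d" using assms by (intro power_increasing) auto
  then have "2 * (2048 ^ d * 64 ^ d * (2048 ^ d * 64 ^ d) * (a1 * a2)) \<le> 2 ^ d * (2048 ^ d * 64 ^ d * (2048 ^ d * 64 ^ d) * (a1 * a2))"
    using a by (intro mult_right_mono) auto
  then show ?thesis unfolding e by (simp add: mult_ac)
qed

text \<open>
  The induction step of the sparse bound: up to the contribution of \<open>3Q\<close> to the sparse form, the
  form localized to \<open>Q\<close> passes to forms localized to finitely many much smaller cubes, which cover at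
  most half of \<open>Q\<close>. If one of the averages over \<open>3Q\<close> vanishes, so does the form.
\<close>

lemma one_step:
  assumes d1: "1 \<le> d" and K: "single_scale d q K Ks" and q: "1 < q" and r: "1 < r"
    and p: "1 \<le> p1" "1 \<le> p2" and CL: "0 < CL" and loc: "localized_estimates d Ks p1 p2 CL"
    and fm: "f1 \<in> borel_measurable (leb d)" "f2 \<in> borel_measurable (leb d)"
    and bd: "\<And>x. cmod (f1 x) \<le> B" "\<And>x. cmod (f2 x) \<le> B"
    and Qg: "Q \<in> dgrid d c"
  shows "\<exists>ch. finite ch \<and> ch \<subseteq> dgrid d c \<and> disjoint_family_on (cset d) ch \<and>
    (\<forall>L\<in>ch. cset d L \<subseteq> cset d Q \<and> side L < side Q) \<and>
    emeasure (leb d) (\<Union>L\<in>ch. cset d L) \<le> ennreal (1 / 2) * vol d Q \<and>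
    ennreal (cmod (loc_form d Ks Q \<mu> \<nu> f1 f2)) \<le>
      ennreal (2 powr (35 * real d)) * (trunc_const d r Ks + ennreal CL) *
        (vol d (dil d 3 Q) * avg d (ennreal p1) f1 (dil d 3 Q) * avg d (ennreal p2) f2 (dil d 3 Q)) +
      (\<Sum>L\<in>ch. ennreal (cmod (loc_form d Ks L \<mu> \<nu> f1 f2)))"
proof -
  have sQ: "0 < side Q" using Qg dgrid_is_cube by (auto simp: is_cube_def)
  let ?R = "dil d 3 Q"
  have sR: "0 < side ?R" using sQ by simp
  have QR: "cset d Q \<subseteq> cset d ?R" using sQ by (intro cset_subset_dil) auto
  define a1 where "a1 = enn2real (avg d (ennreal p1) f1 ?R)"
  define a2 where "a2 = enn2real (avg d (ennreal p2) f2 ?R)"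
  have av: "avg d (ennreal p1) f1 ?R = ennreal a1" "avg d (ennreal p2) f2 ?R = ennreal a2"
    using avg_bounded_finite[OF p(1) fm(1) bd(1) sR] avg_bounded_finite[OF p(2) fm(2) bd(2) sR]
    by (simp_all add: a1_def a2_def)
  have a: "0 \<le> a1" "0 \<le> a2" by (simp_all add: a1_def a2_def)
  show ?thesis
  proof (cases "a1 = 0 \<or> a2 = 0")
    case True
    have c: "cut (cset d Q) f1 \<in> borel_measurable (leb d)" "cut (cset d ?R) f2 \<in> borel_measurable (leb d)"
      using fm by (auto intro: cut_borel_leb)
    have "loc_form d Ks Q \<mu> \<nu> f1 f2 = 0"
    proof (cases "a1 = 0")
      case True
      then have "AE x in leb d. cut (cset d ?R) f1 x = 0"
        using avg_zero_imp[OF p(1) fm(1) sR] av by simp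
      then have "AE x in leb d. cut (cset d Q) f1 x = 0"
        by eventually_elim (use QR in \<open>auto simp: cut_def split: if_splits\<close>)
      then have "loc_form d Ks Q \<mu> \<nu> f1 f2 = trunc_form d Ks \<mu> (min \<lfloor>scale Q\<rfloor> \<nu>) (\<lambda>_. 0) (cut (cset d ?R) f2)"
        unfolding loc_form_cut[OF K sQ] using c by (intro trunc_form_cong_AE[OF K]) auto
      also have "\<dots> = 0" by (simp add: trunc_form_def trunc_integrand_eq)
      finally show ?thesis .
    next
      case False
      then have "AE x in leb d. cut (cset d ?R) f2 x = 0"
        using avg_zero_imp[OF p(2) fm(2) sR] av \<open>a1 = 0 \<or> a2 = 0\<close> by simp
      then have "loc_form d Ks Q \<mu> \<nu> f1 f2 = trunc_form d Ks \<mu> (min \<lfloor>scale Q\<rfloor> \<nu>) (cut (cset d Q) f1) (\<lambda>_. 0)"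
        unfolding loc_form_cut[OF K sQ] using c by (intro trunc_form_cong_AE[OF K]) auto
      also have "\<dots> = 0" by (simp add: trunc_form_def trunc_integrand_eq)
      finally show ?thesis .
    qed
    then show ?thesis by (intro exI[of _ "{}"]) (simp add: disjoint_family_on_def)
  next
    case False
    then have a0: "0 < a1" "0 < a2" using a by auto
    define h1 where "h1 = cut (cset d ?R) f1"
    define h2 where "h2 = cut (cset d ?R) f2"
    \<comment> \<open>with these thresholds both heavy sets together have measure at most \<open>2\<^sup>-\<^sup>d|Q|\<close>\<close>
    define t1 where "t1 = 64 ^ d * a1"
    define t2 where "t2 = 64 ^ d * a2"
    have t: "0 < t1" "0 < t2" using a0 by (simp_all add: t1_def t2_def)
    have B: "0 \<le> B" using bd(1) norm_ge_zero order_trans by blast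
    have hm: "h1 \<in> borel_measurable (leb d)" "h2 \<in> borel_measurable (leb d)"
      unfolding h1_def h2_def using fm by (auto intro: cut_borel_leb)
    have hb: "cmod (h1 x) \<le> B" "cmod (h2 x) \<le> B" for x
      using bd[of x] B by (auto simp: h1_def h2_def cut_def)
    have h0: "\<forall>x. x \<notin> cset d ?R \<longrightarrow> h1 x = 0" "\<forall>x. x \<notin> cset d ?R \<longrightarrow> h2 x = 0"
      by (auto simp: h1_def h2_def cut_def)
    define H1 where "H1 = heavy_set d c (pw p1 h1) (t1 powr p1)"
    define H2 where "H2 = heavy_set d c (pw p2 h2) (t2 powr p2)"
    define E where "E = H1 \<union> H2"
    have Hop: "rd_open d H1" "rd_open d H2" by (simp_all add: H1_def H2_def rd_open_heavy_set)
    have Eop: "rd_open d E" unfolding E_def using Hop by (rule rd_open_Un)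
    have Hsm: "emeasure (leb d) H1 \<le> ennreal ((1 / 4) ^ d * side Q ^ d)"
      "emeasure (leb d) H2 \<le> ennreal ((1 / 4) ^ d * side Q ^ d)"
      using heavy_set_small[OF p(1) a0(1) fm(1) sQ, of c] heavy_set_small[OF p(2) a0(2) fm(2) sQ, of c] av
      unfolding H1_def H2_def h1_def h2_def t1_def t2_def by simp_all
    have Esm: "emeasure (leb d) E \<le> ennreal ((side Q / 2) ^ d)"
    proof -
      have "emeasure (leb d) E \<le> emeasure (leb d) H1 + emeasure (leb d) H2"
        unfolding E_def using Hop by (intro emeasure_subadditive rd_open_leb)
      also have "\<dots> \<le> ennreal ((1 / 4) ^ d * side Q ^ d) + ennreal ((1 / 4) ^ d * side Q ^ d)"
        using Hsm by (rule add_mono)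
      also have "\<dots> = ennreal (2 * ((1 / 4) ^ d * side Q ^ d))"
        using sQ by (simp flip: ennreal_plus)
      also have "\<dots> \<le> ennreal ((side Q / 2) ^ d)" by (intro ennreal_leI quarter_power_le sQ d1)
      finally show ?thesis .
    qed
    obtain \<Q> where stop: "stopping_collection d (dgrid d c) Q \<Q>"
      and sh: "shadow d \<Q> = E \<inter> cset d ?R"
      and touch: "\<And>L. L \<in> \<Q> \<Longrightarrow> \<not> cset d (dil d (2 ^ 5) L) \<subseteq> E"
      and tiny: "\<And>L. L \<in> \<Q> \<Longrightarrow> 9 * side L \<le> side Q / 2"
      using Whitney_stopping_collection[OF d1 Qg Eop Esm] by metis
    have sub: "\<Q> \<subseteq> dgrid d c" and disj: "disjoint_family_on (cset d) \<Q>"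
      using stop by (auto simp: stopping_collection_def)
    interpret stopping_data d c Q \<Q> E
      by unfold_locales (fact d1 Qg sub disj sh touch)+
    have hH: "heavy_set d c (pw p1 h1) (t1 powr p1) \<subseteq> E" "heavy_set d c (pw p2 h2) (t2 powr p2) \<subseteq> E"
      by (auto simp: E_def H1_def H2_def)
    note hyp1 = p(1) t(1) hm(1) hb(1) h0(1) hH(1)
    note hyp2 = p(2) t(2) hm(2) hb(2) h0(2) hH(2)
    define g1 where "g1 = good h1"
    define b1 where "b1 = bad h1"
    define g2 where "g2 = good h2"
    define b2 where "b2 = bad h2"
    have gbm: "g1 \<in> borel_measurable (leb d)" "b1 \<in> borel_measurable (leb d)"
      "g2 \<in> borel_measurable (leb d)" "b2 \<in> borel_measurable (leb d)"
      unfolding g1_def b1_def g2_def b2_def using hm by (simp_all add: good_measurable bad_measurable)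
    define B' where "B' = B + 384 ^ d * t1 + 384 ^ d * t2"
    have B'1: "B + 384 ^ d * t1 \<le> B'" "B + 384 ^ d * t2 \<le> B'" "B \<le> B'"
      using t by (simp_all add: B'_def)
    have gbb: "cmod (g1 x) \<le> B'" "cmod (b1 x) \<le> B'" "cmod (g2 x) \<le> B'" "cmod (b2 x) \<le> B'" for x
      unfolding g1_def b1_def g2_def b2_def
      using good_bounded[OF hyp1, of x] bad_bounded[OF hyp1, of x] good_bounded[OF hyp2, of x] bad_bounded[OF hyp2, of x] B'1
      by auto
    have hb': "cmod (h2 x) \<le> B'" for x using hb(2)[of x] B'1(3) by linarith
    have g20: "g2 x = 0" if "x \<in> Rd d" "x \<notin> cset d ?R" for x
      unfolding g2_def by (rule good_supp[OF hyp2 that])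
    have b20: "b2 x = 0" if "x \<in> Rd d" "x \<notin> cset d ?R" for x
      unfolding b2_def by (rule bad_supp[OF hyp2 that])
    have gb: "g1 x + b1 x = h1 x" "g2 x + b2 x = h2 x" for x
      by (simp_all add: g1_def b1_def g2_def b2_def good_plus_bad)
    \<comment> \<open>all other stopping cubes contribute nothing to the form\<close>
    define F where "F = {L\<in>\<Q>. cset d L \<subseteq> cset d Q \<and> \<mu> < \<lfloor>scale L\<rfloor>}"
    have finF: "finite F" unfolding F_def by (rule finite_large_cubes[OF sQ sub disj])
    have FQ: "F \<subseteq> \<Q>" by (auto simp: F_def)
    let ?loc = "\<lambda>L u v. loc_form d Ks L \<mu> \<nu> u v"
    let ?coll = "\<lambda>u v. coll_form d Ks Q \<Q> \<mu> \<nu> u v"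
    have coll: "?coll u v = ?loc Q u v - (\<Sum>L\<in>F. ?loc L u v)" for u v
      unfolding F_def by (rule coll_form_finite) (use finF F_def in simp)
    have split: "?loc L h1 h2 = ?loc L b1 h2 + ?loc L g1 b2 + ?loc L g1 g2" for L
      by (rule loc_form_split[OF K q gbm gbb gb sR g20 b20])
    have csplit: "?coll h1 h2 = ?coll b1 h2 + ?coll g1 b2 + ?coll g1 g2"
      unfolding coll split by (simp add: sum.distrib)
    let ?T = "trunc_const d r Ks" and ?V = "vol d ?R"
    let ?A = "2048 ^ d * t1 * (2048 ^ d * t2) :: real"
    have VQ: "vol d Q \<le> ?V" unfolding vol_def using QR by (intro emeasure_mono) auto
    have Y1: "Ynorm d (ennreal p1) \<Q> b1 \<le> ennreal (2048 ^ d * t1)"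
      "Ynorm d (ennreal p2) \<Q> b2 \<le> ennreal (2048 ^ d * t2)"
      unfolding b1_def b2_def using Ynorm_bad[OF hyp1] Ynorm_bad[OF hyp2] .
    have Yh: "Ynorm d (ennreal p2) \<Q> h2 \<le> ennreal (2048 ^ d * t2)"
    proof -
      have "(12::real) ^ d \<le> 2048 ^ d" by (intro power_mono) auto
      then have "ennreal (12 ^ d * t2) \<le> ennreal (2048 ^ d * t2)" using t by (intro ennreal_leI) simp
      then show ?thesis using Ynorm_h[OF hyp2] by (rule order_trans[rotated])
    qed
    have G: "(384::real) ^ d \<le> 2048 ^ d" by (intro power_mono) auto
    have Yg: "Ynorm d top \<Q> g1 \<le> ennreal (2048 ^ d * t1)"
    proof -
      have "ennreal (384 ^ d * t1) \<le> ennreal (2048 ^ d * t1)" using t G by (intro ennreal_leI) simp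
      then show ?thesis unfolding g1_def using Ynorm_good[OF hyp1] by (rule order_trans[rotated])
    qed
    have AA: "ennreal (2048 ^ d * t1) * ennreal (2048 ^ d * t2) = ennreal ?A"
      using t by (simp add: ennreal_mult)
    have e1: "ennreal (cmod (?coll b1 h2)) \<le> ennreal CL * ?V * ennreal ?A"
    proof -
      have "b1 \<in> Xdot d (ennreal p1) Q \<Q>" unfolding b1_def by (rule Xdot_bad[OF hyp1])
      moreover have "h2 \<in> Yspace d (ennreal p2) Q \<Q>" by (rule Yspace_h[OF hyp2])
      moreover have "coll_converges d Ks Q \<Q> \<mu> \<nu> b1 h2"
        by (rule coll_converges_bounded[OF K q gbm(2) hm(2) gbb(2) hb' sR]) (use h0(2) in simp)
      ultimately have "ennreal (cmod (?coll b1 h2)) \<le> ennreal CL * vol d Q * Ynorm d (ennreal p1) \<Q> b1 * Ynorm d (ennreal p2) \<Q> h2"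
        using loc dyadic_lattice_dgrid Qg stop unfolding localized_estimates_def by blast
      also have "\<dots> \<le> ennreal CL * ?V * ennreal (2048 ^ d * t1) * ennreal (2048 ^ d * t2)"
        using VQ Y1 Yh by (intro mult_mono) auto
      finally show ?thesis by (simp only: AA mult.assoc)
    qed
    have e2: "ennreal (cmod (?coll g1 b2)) \<le> ennreal CL * ?V * ennreal ?A"
    proof -
      have "b2 \<in> Xdot d (ennreal p2) Q \<Q>" unfolding b2_def by (rule Xdot_bad[OF hyp2])
      moreover have "g1 \<in> Yspace d top Q \<Q>" unfolding g1_def by (rule Yspace_good[OF hyp1])
      moreover have "coll_converges d Ks Q \<Q> \<mu> \<nu> g1 b2"
        by (rule coll_converges_bounded[OF K q gbm(1) gbm(4) gbb(1) gbb(4) sR b20])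
      ultimately have "ennreal (cmod (?coll g1 b2)) \<le> ennreal CL * vol d Q * Ynorm d top \<Q> g1 * Ynorm d (ennreal p2) \<Q> b2"
        using loc dyadic_lattice_dgrid Qg stop unfolding localized_estimates_def by blast
      also have "\<dots> \<le> ennreal CL * ?V * ennreal (2048 ^ d * t1) * ennreal (2048 ^ d * t2)"
        using VQ Y1 Yg by (intro mult_mono) auto
      finally show ?thesis by (simp only: AA mult.assoc)
    qed
    have single: "ennreal (cmod (?loc L g1 g2)) \<le> ?T * ennreal ?A * vol d (dil d 3 L)" if L: "0 < side L" for L
    proof (rule loc_form_bound[OF K r L gbm(1) gbm(3)])
      have "384 ^ d * t1 \<le> 2048 ^ d * t1" "384 ^ d * t2 \<le> 2048 ^ d * t2" using t G by simp_all
      note le = this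
      show "AE x in leb d. cmod (g1 x) \<le> 2048 ^ d * t1"
        unfolding g1_def using AE_good_bound[OF hyp1] by eventually_elim (use le(1) in linarith)
      show "AE x in leb d. cmod (g2 x) \<le> 2048 ^ d * t2"
        unfolding g2_def using AE_good_bound[OF hyp2] by eventually_elim (use le(2) in linarith)
    qed (use t in auto)
    have vol3: "vol d (dil d 3 L) = ennreal (3 ^ d) * vol d L" if "0 < side L" for L
      using that by (simp add: vol_eq power_mult_distrib ennreal_mult)
    have Fpos: "0 < side L" if "L \<in> F" for L using that FQ side_pos by auto
    have e3: "ennreal (cmod (?coll g1 g2)) \<le> ?T * ennreal ?A * ?V + ?T * ennreal ?A * ?V"
    proof -
      have "cmod (?coll g1 g2) \<le> cmod (?loc Q g1 g2) + (\<Sum>L\<in>F. cmod (?loc L g1 g2))"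
        unfolding coll by (rule order_trans[OF norm_triangle_ineq4 add_left_mono[OF norm_sum]])
      then have "ennreal (cmod (?coll g1 g2)) \<le> ennreal (cmod (?loc Q g1 g2) + (\<Sum>L\<in>F. cmod (?loc L g1 g2)))"
        by (rule ennreal_leI)
      also have "\<dots> = ennreal (cmod (?loc Q g1 g2)) + (\<Sum>L\<in>F. ennreal (cmod (?loc L g1 g2)))"
        by (simp add: ennreal_plus sum_nonneg)
      also have "\<dots> \<le> ?T * ennreal ?A * ?V + (\<Sum>L\<in>F. ?T * ennreal ?A * vol d (dil d 3 L))"
        using single[OF sQ] single Fpos by (intro add_mono sum_mono) auto
      also have "(\<Sum>L\<in>F. ?T * ennreal ?A * vol d (dil d 3 L)) = ?T * ennreal ?A * (ennreal (3 ^ d) * (\<Sum>L\<in>F. vol d L))"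
        using Fpos by (simp add: vol3 sum_distrib_left)
      also have "\<dots> \<le> ?T * ennreal ?A * (ennreal (3 ^ d) * vol d Q)"
      proof (intro mult_left_mono)
        show "(\<Sum>L\<in>F. vol d L) \<le> vol d Q"
        proof (rule sum_vol_le[OF finF])
          show "F \<subseteq> dgrid d c" using FQ sub by auto
          show "disjoint_family_on (cset d) F" using disjoint_family_on_mono[OF FQ disj] .
        qed (auto simp: F_def)
      qed auto
      also have "ennreal (3 ^ d) * vol d Q = ?V" using vol3[OF sQ] by simp
      finally show ?thesis by (simp add: add_left_mono)
    qed
    have main: "ennreal (cmod (?coll h1 h2)) \<le> ennreal (2 powr (35 * real d)) * (?T + ennreal CL) * (?V * ennreal a1 * ennreal a2)"
    proof -
      have "cmod (?coll h1 h2) \<le> cmod (?coll b1 h2) + cmod (?coll g1 b2) + cmod (?coll g1 g2)"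
        unfolding csplit by (rule order_trans[OF norm_triangle_ineq add_right_mono[OF norm_triangle_ineq]])
      then have "ennreal (cmod (?coll h1 h2)) \<le> ennreal (cmod (?coll b1 h2) + cmod (?coll g1 b2) + cmod (?coll g1 g2))"
        by (rule ennreal_leI)
      also have "\<dots> = ennreal (cmod (?coll b1 h2)) + ennreal (cmod (?coll g1 b2)) + ennreal (cmod (?coll g1 g2))"
        by (simp add: ennreal_plus)
      also have "\<dots> \<le> ennreal CL * ?V * ennreal ?A + ennreal CL * ?V * ennreal ?A + (?T * ennreal ?A * ?V + ?T * ennreal ?A * ?V)"
        using e1 e2 e3 by (intro add_mono)
      also have "\<dots> = (?T + ennreal CL) * ?V * (2 * ennreal ?A)"
        by (simp add: algebra_simps mult_2_right mult_2)
      also have "2 * ennreal ?A = ennreal (2 * ?A)" using t by (simp add: ennreal_mult)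
      also have "(?T + ennreal CL) * ?V * ennreal (2 * ?A) \<le> (?T + ennreal CL) * ?V * ennreal (2 powr (35 * real d) * (a1 * a2))"
        unfolding t1_def t2_def using constant_collect[OF d1 a] by (intro mult_left_mono ennreal_leI) auto
      also have "\<dots> = ennreal (2 powr (35 * real d)) * (?T + ennreal CL) * (?V * ennreal a1 * ennreal a2)"
        using a by (simp add: ennreal_mult mult_ac)
      finally show ?thesis .
    qed
    have fh: "?loc L f1 f2 = ?loc L h1 h2" if "L \<in> F \<or> L = Q" for L
    proof (rule loc_form_local[OF K])
      show s: "0 < side L" using that Fpos sQ by auto
      have LQ: "cset d L \<subseteq> cset d Q" using that by (auto simp: F_def)
      show "f1 x = h1 x" if "x \<in> cset d L" for x
        using that LQ QR by (auto simp: h1_def cut_def)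
      have "cset d (dil d 3 L) \<subseteq> cset d ?R"
      proof (cases "L = Q")
        case False
        then have LF: "L \<in> F" using that by simp
        then have small: "9 * side L \<le> side Q / 2" using tiny FQ by auto
        have "L \<in> dgrid d c" using LF FQ sub by auto
        then obtain z where z: "z \<in> cset d L" using dgrid_nonempty by blast
        then have zQ: "z \<in> cset d Q" using LQ by auto
        show ?thesis
        proof
          fix w assume w: "w \<in> cset d (dil d 3 L)"
          have "corner Q i - side Q \<le> w i \<and> w i < corner Q i + 2 * side Q" if i: "i < d" for i
          proof -
            have "corner L i - side L \<le> w i" "w i < corner L i + 2 * side L"
              using w i unfolding cset_dil by auto
            moreover have "corner L i \<le> z i" "z i < corner L i + side L" using z i by (auto simp: cset_def)
            moreover have "corner Q i \<le> z i" "z i < corner Q i + side Q" using zQ i by (auto simp: cset_def)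
            ultimately show ?thesis using small s by linarith
          qed
          then show "w \<in> cset d ?R" using w cset_subset_Rd unfolding cset_dil[of d 3 Q] by auto
        qed
      qed simp
      then show "f2 x = h2 x" if "x \<in> cset d (dil d 3 L)" for x
        using that by (auto simp: h2_def cut_def)
    qed
    show ?thesis
    proof (intro exI[of _ F] conjI ballI)
      show "finite F" by (rule finF)
      show "F \<subseteq> dgrid d c" using FQ sub by auto
      show "disjoint_family_on (cset d) F" using disjoint_family_on_mono[OF FQ disj] .
      show "cset d L \<subseteq> cset d Q" if "L \<in> F" for L using that by (simp add: F_def)
      show "side L < side Q" if "L \<in> F" for L
      proof -
        have "9 * side L \<le> side Q / 2" using that FQ tiny by auto
        then show ?thesis using Fpos[OF that] by linarith
      qed
      show "emeasure (leb d) (\<Union>L\<in>F. cset d L) \<le> ennreal (1 / 2) * vol d Q"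
      proof -
        have "(\<Union>L\<in>F. cset d L) \<subseteq> E" using FQ sh by (auto simp: shadow_def)
        then have "emeasure (leb d) (\<Union>L\<in>F. cset d L) \<le> emeasure (leb d) E"
          using rd_open_leb[OF Eop] by (rule emeasure_mono)
        also have "\<dots> \<le> ennreal ((side Q / 2) ^ d)" by (rule Esm)
        also have "\<dots> \<le> ennreal (1 / 2 * side Q ^ d)"
        proof (rule ennreal_leI)
          have "(1/2::real) ^ d \<le> (1/2) ^ 1" using d1 by (intro power_decreasing) auto
          then have "(1/2) ^ d * side Q ^ d \<le> 1 / 2 * side Q ^ d" using sQ by (intro mult_right_mono) auto
          then show "(side Q / 2) ^ d \<le> 1 / 2 * side Q ^ d" by (simp add: power_divide)
        qed
        also have "\<dots> = ennreal (1 / 2) * vol d Q" using sQ by (simp only: vol_eq less_imp_le) (rule ennreal_mult; simp)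
        finally show ?thesis .
      qed
      have "?loc Q f1 f2 = ?coll h1 h2 + (\<Sum>L\<in>F. ?loc L f1 f2)"
        using fh unfolding coll by simp
      then have "cmod (?loc Q f1 f2) = cmod (?coll h1 h2 + (\<Sum>L\<in>F. ?loc L f1 f2))"
        by (rule arg_cong)
      also have "\<dots> \<le> cmod (?coll h1 h2) + (\<Sum>L\<in>F. cmod (?loc L f1 f2))"
        by (rule order_trans[OF norm_triangle_ineq add_left_mono[OF norm_sum]])
      finally have "cmod (?loc Q f1 f2) \<le> cmod (?coll h1 h2) + (\<Sum>L\<in>F. cmod (?loc L f1 f2))" .
      then have "ennreal (cmod (?loc Q f1 f2)) \<le> ennreal (cmod (?coll h1 h2) + (\<Sum>L\<in>F. cmod (?loc L f1 f2)))"
        by (rule ennreal_leI)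
      also have "\<dots> = ennreal (cmod (?coll h1 h2)) + (\<Sum>L\<in>F. ennreal (cmod (?loc L f1 f2)))"
        by (simp add: ennreal_plus sum_nonneg)
      also have "\<dots> \<le> ennreal (2 powr (35 * real d)) * (?T + ennreal CL) * (?V * ennreal a1 * ennreal a2) +
          (\<Sum>L\<in>F. ennreal (cmod (?loc L f1 f2)))"
        using main by (rule add_right_mono)
      finally show "ennreal (cmod (?loc Q f1 f2)) \<le> ennreal (2 powr (35 * real d)) * (?T + ennreal CL) *
          (?V * avg d (ennreal p1) f1 ?R * avg d (ennreal p2) f2 ?R) + (\<Sum>L\<in>F. ennreal (cmod (?loc L f1 f2)))"
        unfolding av .
    qed
  qed
qed

section \<open>Iteration over scales\<close>

text \<open>
  Applying the step estimate to a cube, to its children, to their children and so on adds up the terms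
  \<open>\<Phi>\<close> over a tree of cubes. Each step lowers the scale, and the form vanishes at small scales, so
  induction over the scale suffices. Cubes in different branches are disjoint, and a cube without its
  children is disjoint from everything below it; the parts so obtained will witness sparseness.
\<close>

lemma stopping_tree:
  fixes v \<Phi> :: "cube \<Rightarrow> ennreal" and C :: ennreal
  assumes d1: "1 \<le> d"
    and fin: "\<And>Q. Q \<in> dgrid d c \<Longrightarrow> finite (ch Q)"
    and sub: "\<And>Q. Q \<in> dgrid d c \<Longrightarrow> ch Q \<subseteq> dgrid d c"
    and disj: "\<And>Q. Q \<in> dgrid d c \<Longrightarrow> disjoint_family_on (cset d) (ch Q)"
    and inside: "\<And>Q L. Q \<in> dgrid d c \<Longrightarrow> L \<in> ch Q \<Longrightarrow> cset d L \<subseteq> cset d Q"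
    and smaller: "\<And>Q L. Q \<in> dgrid d c \<Longrightarrow> L \<in> ch Q \<Longrightarrow> side L < side Q"
    and step: "\<And>Q. Q \<in> dgrid d c \<Longrightarrow> v Q \<le> C * \<Phi> Q + (\<Sum>L\<in>ch Q. v L)"
    and base: "\<And>Q. Q \<in> dgrid d c \<Longrightarrow> side Q \<le> 2 powi \<mu> \<Longrightarrow> v Q = 0"
  assumes "Q \<in> dgrid d c" "side Q \<le> 2 powi (\<mu> + int n)"
  shows "\<exists>S. finite S \<and> S \<subseteq> dgrid d c \<and> (\<forall>I\<in>S. cset d I \<subseteq> cset d Q) \<and>
    disjoint_family_on (\<lambda>I. cset d I - (\<Union>L\<in>ch I. cset d L)) S \<and> v Q \<le> C * (\<Sum>I\<in>S. \<Phi> I)"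
  using assms(9,10)
proof (induction n arbitrary: Q)
  case 0
  then show ?case using base by (intro exI[of _ "{}"]) (simp add: disjoint_family_on_def)
next
  case (Suc n)
  note Q = Suc.prems(1)
  let ?E = "\<lambda>I. cset d I - (\<Union>L\<in>ch I. cset d L)"
  have small: "side L \<le> 2 powi (\<mu> + int n)" if L: "L \<in> ch Q" for L
  proof -
    obtain k x k' x' where "L = dcube d c k x" "Q = dcube d c k' x'"
      using L sub[OF Q] Q unfolding dgrid_def by blast
    moreover have "side L < side Q" by (rule smaller[OF Q L])
    moreover have "side Q \<le> 2 powi (\<mu> + int (Suc n))" by (rule Suc.prems(2))
    ultimately show ?thesis by simp
  qed
  have "\<forall>L\<in>ch Q. \<exists>S. finite S \<and> S \<subseteq> dgrid d c \<and> (\<forall>I\<in>S. cset d I \<subseteq> cset d L) \<and>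
      disjoint_family_on ?E S \<and> v L \<le> C * (\<Sum>I\<in>S. \<Phi> I)"
  proof (rule ballI)
    fix L assume L: "L \<in> ch Q"
    then have "L \<in> dgrid d c" using sub[OF Q] by auto
    then show "\<exists>S. finite S \<and> S \<subseteq> dgrid d c \<and> (\<forall>I\<in>S. cset d I \<subseteq> cset d L) \<and>
      disjoint_family_on ?E S \<and> v L \<le> C * (\<Sum>I\<in>S. \<Phi> I)"
      using small[OF L] by (rule Suc.IH)
  qed
  from bchoice[OF this] obtain S where S0: "\<forall>L\<in>ch Q. finite (S L) \<and> S L \<subseteq> dgrid d c \<and>
      (\<forall>I\<in>S L. cset d I \<subseteq> cset d L) \<and> disjoint_family_on ?E (S L) \<and> v L \<le> C * (\<Sum>I\<in>S L. \<Phi> I)"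
    by (elim exE)
  have S: "\<And>L. L \<in> ch Q \<Longrightarrow> finite (S L)" "\<And>L. L \<in> ch Q \<Longrightarrow> S L \<subseteq> dgrid d c"
    "\<And>L I. L \<in> ch Q \<Longrightarrow> I \<in> S L \<Longrightarrow> cset d I \<subseteq> cset d L" "\<And>L. L \<in> ch Q \<Longrightarrow> disjoint_family_on ?E (S L)"
    "\<And>L. L \<in> ch Q \<Longrightarrow> v L \<le> C * (\<Sum>I\<in>S L. \<Phi> I)"
    using S0 by simp_all
  define U where "U = (\<Union>L\<in>ch Q. S L)"
  have apart: "cset d L \<inter> cset d L' = {}" if "L \<in> ch Q" "L' \<in> ch Q" "L \<noteq> L'" for L L'
    using disj[OF Q] that by (auto simp: disjoint_family_on_def)
  have QU: "Q \<notin> U"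
  proof
    assume "Q \<in> U"
    then obtain L where L: "L \<in> ch Q" "cset d Q \<subseteq> cset d L" using S(3) by (auto simp: U_def)
    have pos: "0 < side Q" "0 < side L" using Q L sub[OF Q] dgrid_is_cube by (auto simp: is_cube_def)
    have "vol d Q \<le> vol d L" unfolding vol_def using L(2) by (rule emeasure_mono) simp
    then have "side Q ^ d \<le> side L ^ d" using pos by (simp add: vol_eq ennreal_le_iff)
    then have "side Q \<le> side L" using pos d1 by (subst (asm) power_mono_iff) auto
    then show False using smaller[OF Q L(1)] by simp
  qed
  have finU: "finite U" using fin[OF Q] S(1) by (auto simp: U_def)
  have sumU: "(\<Sum>I\<in>U. \<Phi> I) = (\<Sum>L\<in>ch Q. \<Sum>I\<in>S L. \<Phi> I)"
    unfolding U_def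
  proof (rule sum.UNION_disjoint[OF fin[OF Q]])
    show "\<forall>L\<in>ch Q. finite (S L)" using S(1) by blast
    show "\<forall>L\<in>ch Q. \<forall>L'\<in>ch Q. L \<noteq> L' \<longrightarrow> S L \<inter> S L' = {}"
    proof (intro ballI impI, rule ccontr)
      fix L L' assume L: "L \<in> ch Q" "L' \<in> ch Q" "L \<noteq> L'" and ne: "S L \<inter> S L' \<noteq> {}"
      then obtain I where I: "I \<in> S L" "I \<in> S L'" by auto
      then have "cset d I \<subseteq> {}" using S(3)[OF L(1) I(1)] S(3)[OF L(2) I(2)] apart[OF L] by blast
      moreover have "cset d I \<noteq> {}" using S(2)[OF L(1)] I(1) dgrid_nonempty by blast
      ultimately show False by simp
    qed
  qed
  have "v Q \<le> C * \<Phi> Q + (\<Sum>L\<in>ch Q. C * (\<Sum>I\<in>S L. \<Phi> I))"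
    by (rule order_trans[OF step[OF Q] add_left_mono[OF sum_mono[OF S(5)]]])
  also have "\<dots> = C * (\<Sum>I\<in>insert Q U. \<Phi> I)"
    using finU QU by (simp add: sumU sum_distrib_left distrib_left)
  finally have vQ: "v Q \<le> C * (\<Sum>I\<in>insert Q U. \<Phi> I)" .
  have "disjoint_family_on ?E (insert Q U)"
  proof -
    have 1: "?E Q \<inter> ?E I = {}" if IU: "I \<in> U" for I
    proof -
      obtain L where L: "L \<in> ch Q" "I \<in> S L" using IU unfolding U_def by blast
      then have "cset d I \<subseteq> (\<Union>L\<in>ch Q. cset d L)" using S(3)[OF L] by blast
      then show ?thesis by blast
    qed
    have 2: "?E I \<inter> ?E I' = {}" if II: "I \<in> U" "I' \<in> U" "I \<noteq> I'" for I I'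
    proof -
      obtain L L' where L: "L \<in> ch Q" "I \<in> S L" "L' \<in> ch Q" "I' \<in> S L'"
        using II(1,2) unfolding U_def by blast
      show ?thesis
      proof (cases "L = L'")
        case True
        then show ?thesis using S(4)[OF L(1)] L II(3) unfolding disjoint_family_on_def by blast
      next
        case False
        then show ?thesis using apart[OF L(1,3)] S(3)[OF L(1,2)] S(3)[OF L(3,4)] by blast
      qed
    qed
    show ?thesis
      unfolding disjoint_family_on_def
    proof (intro ballI impI)
      fix I I' assume "I \<in> insert Q U" "I' \<in> insert Q U" "I \<noteq> I'"
      then consider "I = Q" "I' \<in> U" | "I' = Q" "I \<in> U" | "I \<in> U" "I' \<in> U" by auto
      then show "?E I \<inter> ?E I' = {}"
        using 1[of I] 1[of I'] 2[of I I'] \<open>I \<noteq> I'\<close> by cases (simp_all add: Int_commute)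
    qed
  qed
  moreover have "insert Q U \<subseteq> dgrid d c" using Q S(2) by (auto simp: U_def)
  moreover have "\<forall>I\<in>insert Q U. cset d I \<subseteq> cset d Q"
  proof (rule ballI)
    fix I assume "I \<in> insert Q U"
    then consider "I = Q" | L where "L \<in> ch Q" "I \<in> S L" by (auto simp: U_def)
    then show "cset d I \<subseteq> cset d Q"
    proof cases
      case (2 L)
      show ?thesis using S(3)[OF 2] inside[OF Q 2(1)] by (rule order_trans)
    qed simp
  qed
  ultimately show ?case using finU vQ by (intro exI[of _ "insert Q U"]) simp
qed

lemma PSF_tripled:
  assumes "finite S" "S \<subseteq> dgrid d c"
  shows "PSF d p1 p2 (dil d 3 ` S) f1 f2 =
    (\<Sum>I\<in>S. vol d (dil d 3 I) * avg d (ennreal p1) f1 (dil d 3 I) * avg d (ennreal p2) f2 (dil d 3 I))"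
proof -
  have inj: "inj_on (dil d 3) S"
    using assms(2) dgrid_is_cube by (intro inj_onI) (rule dil_dil_inject[of 3 d], auto)
  show ?thesis
    unfolding PSF_def using assms(1) by (simp add: infsum_finite sum.reindex[OF inj])
qed

text \<open>
  The part of a tree cube outside its children has at least half its volume; tripling multiplies the
  volume by \<open>3\<^sup>d\<close>.
\<close>

lemma tripled_sparse:
  assumes S: "finite S" "S \<subseteq> dgrid d c"
    and disj: "disjoint_family_on (\<lambda>I. cset d I - (\<Union>L\<in>ch I. cset d L)) S"
    and fin: "\<And>I. I \<in> S \<Longrightarrow> finite (ch I)"
    and half: "\<And>I. I \<in> S \<Longrightarrow> emeasure (leb d) (\<Union>L\<in>ch I. cset d L) \<le> ennreal (1 / 2) * vol d I"
  shows "sparse_collection d ((1 / 3) ^ d / 2) (dil d 3 ` S)"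
proof -
  let ?E = "\<lambda>I. cset d I - (\<Union>L\<in>ch I. cset d L)"
  have inj: "inj_on (dil d 3) S"
    using S(2) dgrid_is_cube by (intro inj_onI) (rule dil_dil_inject[of 3 d], auto)
  define E where "E = (\<lambda>J. ?E (the_inv_into S (dil d 3) J))"
  have E: "E (dil d 3 I) = ?E I" if "I \<in> S" for I
    using the_inv_into_f_f[OF inj that] by (simp add: E_def)
  have pos: "0 < side I" if "I \<in> S" for I using that S(2) dgrid_is_cube by (auto simp: is_cube_def)
  have Um: "(\<Union>L\<in>ch I. cset d L) \<in> sets (leb d)" if "I \<in> S" for I
    using fin[OF that] by (intro sets.finite_UN) auto
  have big: "ennreal ((1 / 3) ^ d / 2) * vol d (dil d 3 I) \<le> emeasure (leb d) (?E I)" if I: "I \<in> S" for I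
  proof -
    define s where "s = side I ^ d"
    have s: "0 < s" using pos[OF I] by (simp add: s_def)
    have "cset d I \<subseteq> ?E I \<union> (\<Union>L\<in>ch I. cset d L)" by blast
    then have "vol d I \<le> emeasure (leb d) (?E I \<union> (\<Union>L\<in>ch I. cset d L))"
      unfolding vol_def using Um[OF I] by (intro emeasure_mono) auto
    also have "\<dots> \<le> emeasure (leb d) (?E I) + emeasure (leb d) (\<Union>L\<in>ch I. cset d L)"
      using Um[OF I] by (intro emeasure_subadditive) auto
    also have "\<dots> \<le> emeasure (leb d) (?E I) + ennreal (1 / 2) * vol d I"
      using half[OF I] by (rule add_left_mono)
    also have "ennreal (1 / 2) * vol d I = ennreal (s / 2)"
    proof -
      have "vol d I = ennreal s" using pos[OF I] by (simp add: vol_eq s_def)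
      moreover have "ennreal (1 / 2 * s) = ennreal (1 / 2) * ennreal s" using s by (intro ennreal_mult) auto
      ultimately show ?thesis by (metis mult.left_neutral times_divide_eq_left)
    qed
    finally have le: "ennreal s \<le> emeasure (leb d) (?E I) + ennreal (s / 2)"
      using pos[OF I] by (simp add: vol_eq s_def)
    have "ennreal (s / 2) \<le> emeasure (leb d) (?E I)"
    proof (cases "emeasure (leb d) (?E I)")
      case (real e)
      then have "ennreal s \<le> ennreal (e + s / 2)" using le s by (simp add: ennreal_plus)
      then have "s \<le> e + s / 2" using real(1) s by (subst (asm) ennreal_le_iff) auto
      then show ?thesis using real by (auto intro: ennreal_leI)
    qed simp
    moreover have "ennreal ((1 / 3) ^ d / 2) * vol d (dil d 3 I) = ennreal (s / 2)"
    proof -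
      have "(1 / 3 :: real) ^ d * 3 ^ d = 1" by (simp add: power_one_over)
      then have "(1 / 3) ^ d / 2 * (3 * side I) ^ d = s / 2" by (simp add: s_def power_mult_distrib)
      then show ?thesis using pos[OF I] by (simp add: vol_eq flip: ennreal_mult)
    qed
    ultimately show ?thesis by simp
  qed
  show ?thesis
    unfolding sparse_collection_def
  proof (intro conjI exI[of _ E])
    show "countable (dil d 3 ` S)" using S(1) by (simp add: countable_finite)
    show "\<forall>J\<in>dil d 3 ` S. is_cube d J"
      using pos by (auto simp: is_cube_def dil_def Rd_def)
    show "disjoint_family_on E (dil d 3 ` S)"
      unfolding disjoint_family_on_def
    proof (intro ballI impI)
      fix J J' assume "J \<in> dil d 3 ` S" "J' \<in> dil d 3 ` S" "J \<noteq> J'"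
      then obtain I I' where I: "I \<in> S" "I' \<in> S" "J = dil d 3 I" "J' = dil d 3 I'" "I \<noteq> I'" by auto
      show "E J \<inter> E J' = {}"
        unfolding I(3,4) E[OF I(1)] E[OF I(2)] using disj I by (auto simp only: disjoint_family_on_def)
    qed
    show "\<forall>J\<in>dil d 3 ` S. E J \<in> sets (leb d) \<and> E J \<subseteq> cset d J \<and> ennreal ((1 / 3) ^ d / 2) * vol d J \<le> emeasure (leb d) (E J)"
    proof
      fix J assume "J \<in> dil d 3 ` S"
      then obtain I where I: "I \<in> S" "J = dil d 3 I" by auto
      have "?E I \<in> sets (leb d)" using Um[OF I(1)] by (intro sets.Diff) auto
      moreover have "?E I \<subseteq> cset d J" unfolding I(2) using cset_subset_dil[of 3 I d] pos[OF I(1)] by auto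
      ultimately show "E J \<in> sets (leb d) \<and> E J \<subseteq> cset d J \<and> ennreal ((1 / 3) ^ d / 2) * vol d J \<le> emeasure (leb d) (E J)"
        using big[OF I(1)] unfolding I(2) E[OF I(1)] by simp
    qed
  qed
qed

section \<open>Sparse domination\<close>

lemma compact_coordinates_bounded:
  fixes A :: "pt set"
  assumes "compact A"
  obtains M where "0 \<le> M" "\<And>x i. x \<in> A \<Longrightarrow> i < d \<Longrightarrow> \<bar>x i\<bar> \<le> M"
proof -
  have "\<exists>M. \<forall>x\<in>A. \<bar>x i\<bar> \<le> M" for i
  proof -
    have "compact ((\<lambda>x. x i) ` A)"
      using assms continuous_on_subset[OF continuous_on_product_coordinates, of A]
      by (intro compact_continuous_image) auto
    then have "bounded ((\<lambda>x. x i) ` A)" by (rule compact_imp_bounded)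
    then show ?thesis by (auto simp: bounded_iff)
  qed
  then obtain M where M: "\<And>i x. x \<in> A \<Longrightarrow> \<bar>x i\<bar> \<le> M i" by metis
  show thesis
  proof (rule that[of "\<Sum>i<d. \<bar>M i\<bar>"])
    fix x i assume x: "x \<in> A" "i < d"
    have "\<bar>x i\<bar> \<le> \<bar>M i\<bar>" using M[OF x(1), of i] by linarith
    also have "\<dots> \<le> (\<Sum>i<d. \<bar>M i\<bar>)" using x(2) by (intro member_le_sum) auto
    finally show "\<bar>x i\<bar> \<le> (\<Sum>i<d. \<bar>M i\<bar>)" .
  qed (simp add: sum_nonneg)
qed

text \<open>
  Shifting the dyadic grid by a power of two makes a large cube centred at the origin dyadic.
\<close>

lemma big_dyadic_cube:
  assumes "0 \<le> M"
  obtains c Q where "Q \<in> dgrid d c" "\<And>x. x \<in> Rd d \<Longrightarrow> (\<And>i. i < d \<Longrightarrow> \<bar>x i\<bar> \<le> M) \<Longrightarrow> x \<in> cset d Q"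
    "\<nu> \<le> \<lfloor>scale Q\<rfloor>"
proof -
  obtain m where m: "M < 2 ^ m" using real_arch_pow[of 2 M] by auto
  \<comment> \<open>the cube has lower corner \<open>-2\<^sup>N\<close> in every coordinate, and sidelength \<open>2\<^sup>N\<^sup>+\<^sup>1\<close>\<close>
  define N where "N = max \<nu> (int m)"
  have "(2::real) ^ m = 2 powi (int m)" by simp
  also have "\<dots> \<le> 2 powi N" by (simp only: two_powi_le_iff) (simp add: N_def)
  finally have MN: "M < 2 powi N" using m by linarith
  define c :: real where "c = - (2 powi N)"
  define o0 where "o0 = (\<lambda>i\<in>{..<d}. 0 :: real)"
  define Q where "Q = dcube d c (N + 1) o0"
  have o0: "o0 \<in> Rd d" by (simp add: o0_def Rd_def)
  have s: "(2::real) powi (N + 1) = 2 * 2 powi N" by (simp add: power_int_add)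
  have g: "gix c (N + 1) o0 i = 0" if "i < d" for i
    using that by (simp add: gix_def o0_def c_def s)
  show thesis
  proof (rule that[of Q c])
    show "Q \<in> dgrid d c" unfolding Q_def dgrid_def using o0 by blast
    show "\<nu> \<le> \<lfloor>scale Q\<rfloor>" by (simp add: Q_def N_def)
    fix x assume x: "x \<in> Rd d" "\<And>i. i < d \<Longrightarrow> \<bar>x i\<bar> \<le> M"
    show "x \<in> cset d Q"
      unfolding cset_def
    proof (intro CollectI conjI allI impI x(1))
      fix i assume i: "i < d"
      have "corner Q i = - (2 powi N)" using i g by (simp add: Q_def corner_dcube c_def)
      moreover have "side Q = 2 * 2 powi N" by (simp add: Q_def s)
      moreover have "- (2 powi N) \<le> x i" "x i < 2 powi N" using x(2)[OF i] MN by linarith+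
      ultimately show "corner Q i \<le> x i" "x i < corner Q i + side Q" by simp_all
    qed
  qed
qed

lemma sparse_bound_bounded:
  assumes d1: "1 \<le> d" and K: "single_scale d q K Ks" and q: "1 < q" and r: "1 < r"
    and p: "1 \<le> p1" "1 \<le> p2" and CL: "0 < CL" and loc: "localized_estimates d Ks p1 p2 CL"
    and fm: "f1 \<in> borel_measurable (leb d)" "f2 \<in> borel_measurable (leb d)"
    and bd: "\<And>x. cmod (f1 x) \<le> B" "\<And>x. cmod (f2 x) \<le> B"
    and cs: "compactly_supported d f1" "compactly_supported d f2"
  shows "ennreal (cmod (trunc_form d Ks \<mu> \<nu> f1 f2)) \<le>
    ennreal (2 powr (35 * real d)) * (trunc_const d r Ks + ennreal CL) *
      (SUP \<S>\<in>{\<S>. sparse_collection d ((1 / 3) ^ d / 2) \<S>}. PSF d p1 p2 \<S> f1 f2)"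
proof -
  obtain A where A: "compact A" "A \<subseteq> Rd d" "supported_in d f1 A"
    using cs(1) unfolding compactly_supported_def by blast
  obtain M where M: "0 \<le> M" "\<And>x i. x \<in> A \<Longrightarrow> i < d \<Longrightarrow> \<bar>x i\<bar> \<le> M"
    using compact_coordinates_bounded[OF A(1), of d] by metis
  obtain c Q where Q: "Q \<in> dgrid d c" "\<And>x. x \<in> Rd d \<Longrightarrow> (\<And>i. i < d \<Longrightarrow> \<bar>x i\<bar> \<le> M) \<Longrightarrow> x \<in> cset d Q"
    "\<nu> \<le> \<lfloor>scale Q\<rfloor>"
    using big_dyadic_cube[OF M(1)] by metis
  have AQ: "A \<subseteq> cset d Q" using M(2) A(2) Q(2) by blast
  let ?v = "\<lambda>Q. ennreal (cmod (loc_form d Ks Q \<mu> \<nu> f1 f2))"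
  let ?\<Phi> = "\<lambda>Q. vol d (dil d 3 Q) * avg d (ennreal p1) f1 (dil d 3 Q) * avg d (ennreal p2) f2 (dil d 3 Q)"
  let ?C = "ennreal (2 powr (35 * real d)) * (trunc_const d r Ks + ennreal CL)"
  have top: "trunc_form d Ks \<mu> \<nu> f1 f2 = loc_form d Ks Q \<mu> \<nu> f1 f2"
  proof -
    have "AE x in leb d. f1 x = cut (cset d Q) f1 x"
      using A(3) unfolding supported_in_def by eventually_elim (use AQ in \<open>auto simp: cut_def\<close>)
    moreover have "min \<lfloor>scale Q\<rfloor> \<nu> = \<nu>" using Q(3) by simp
    moreover have "trunc_form d Ks \<mu> \<nu> f1 f2 = trunc_form d Ks \<mu> \<nu> (cut (cset d Q) f1) f2"
      using calculation(1) by (intro trunc_form_cong_AE[OF K fm(1) cut_borel_leb[OF fm(1) cset_leb] fm(2) fm(2)]) simp_all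
    ultimately show ?thesis unfolding loc_form_def by simp
  qed
  have "\<forall>Q\<in>dgrid d c. \<exists>ch. finite ch \<and> ch \<subseteq> dgrid d c \<and> disjoint_family_on (cset d) ch \<and>
    (\<forall>L\<in>ch. cset d L \<subseteq> cset d Q \<and> side L < side Q) \<and>
    emeasure (leb d) (\<Union>L\<in>ch. cset d L) \<le> ennreal (1 / 2) * vol d Q \<and> ?v Q \<le> ?C * ?\<Phi> Q + (\<Sum>L\<in>ch. ?v L)"
    by (rule ballI) (rule one_step[OF d1 K q r p CL loc fm bd])
  from bchoice[OF this] obtain ch where "\<forall>Q\<in>dgrid d c. finite (ch Q) \<and> ch Q \<subseteq> dgrid d c \<and>
    disjoint_family_on (cset d) (ch Q) \<and> (\<forall>L\<in>ch Q. cset d L \<subseteq> cset d Q \<and> side L < side Q) \<and>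
    emeasure (leb d) (\<Union>L\<in>ch Q. cset d L) \<le> ennreal (1 / 2) * vol d Q \<and> ?v Q \<le> ?C * ?\<Phi> Q + (\<Sum>L\<in>ch Q. ?v L)"
    by (elim exE)
  note all = bspec[OF this]
  have ch: "\<And>Q. Q \<in> dgrid d c \<Longrightarrow> finite (ch Q)"
    "\<And>Q. Q \<in> dgrid d c \<Longrightarrow> ch Q \<subseteq> dgrid d c" "\<And>Q. Q \<in> dgrid d c \<Longrightarrow> disjoint_family_on (cset d) (ch Q)"
    "\<And>Q L. Q \<in> dgrid d c \<Longrightarrow> L \<in> ch Q \<Longrightarrow> cset d L \<subseteq> cset d Q"
    "\<And>Q L. Q \<in> dgrid d c \<Longrightarrow> L \<in> ch Q \<Longrightarrow> side L < side Q"
    "\<And>Q. Q \<in> dgrid d c \<Longrightarrow> ?v Q \<le> ?C * ?\<Phi> Q + (\<Sum>L\<in>ch Q. ?v L)"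
    "\<And>Q. Q \<in> dgrid d c \<Longrightarrow> emeasure (leb d) (\<Union>L\<in>ch Q. cset d L) \<le> ennreal (1 / 2) * vol d Q"
    using all by blast+
  have base: "?v R = 0" if R: "R \<in> dgrid d c" "side R \<le> 2 powi \<mu>" for R
  proof -
    obtain k x where "R = dcube d c k x" using R(1) unfolding dgrid_def by blast
    then have "\<lfloor>scale R\<rfloor> \<le> \<mu>" using R(2) by simp
    then have "min \<lfloor>scale R\<rfloor> \<nu> \<le> \<mu>" by simp
    then show ?thesis unfolding loc_form_def by (simp add: trunc_form_trivial)
  qed
  obtain n where n: "side Q \<le> 2 powi (\<mu> + int n)"
  proof -
    obtain k x where "Q = dcube d c k x" using Q(1) unfolding dgrid_def by blast
    then have "side Q \<le> 2 powi (\<mu> + int (nat (k - \<mu>)))" by simp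
    then show ?thesis by (rule that)
  qed
  have "\<exists>S. finite S \<and> S \<subseteq> dgrid d c \<and> (\<forall>I\<in>S. cset d I \<subseteq> cset d Q) \<and>
    disjoint_family_on (\<lambda>I. cset d I - (\<Union>L\<in>ch I. cset d L)) S \<and> ?v Q \<le> ?C * (\<Sum>I\<in>S. ?\<Phi> I)"
    by (rule stopping_tree[where v = ?v and \<Phi> = ?\<Phi> and ch = ch and \<mu> = \<mu> and n = n])
      (fact d1 ch base Q(1) n)+
  then obtain S where S: "finite S" "S \<subseteq> dgrid d c" "disjoint_family_on (\<lambda>I. cset d I - (\<Union>L\<in>ch I. cset d L)) S"
    "?v Q \<le> ?C * (\<Sum>I\<in>S. ?\<Phi> I)"
    by (elim exE conjE)
  have "sparse_collection d ((1 / 3) ^ d / 2) (dil d 3 ` S)"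
  proof (rule tripled_sparse[OF S(1-3)])
    fix I assume "I \<in> S"
    then have "I \<in> dgrid d c" using S(2) by auto
    then show "finite (ch I)" "emeasure (leb d) (\<Union>L\<in>ch I. cset d L) \<le> ennreal (1 / 2) * vol d I"
      by (fact ch(1), fact ch(7))
  qed
  then have "PSF d p1 p2 (dil d 3 ` S) f1 f2 \<le> (SUP \<S>\<in>{\<S>. sparse_collection d ((1 / 3) ^ d / 2) \<S>}. PSF d p1 p2 \<S> f1 f2)"
    by (intro SUP_upper) simp
  then have "(\<Sum>I\<in>S. ?\<Phi> I) \<le> (SUP \<S>\<in>{\<S>. sparse_collection d ((1 / 3) ^ d / 2) \<S>}. PSF d p1 p2 \<S> f1 f2)"
    unfolding PSF_tripled[OF S(1,2)] .
  then have "?C * (\<Sum>I\<in>S. ?\<Phi> I) \<le> ?C * (SUP \<S>\<in>{\<S>. sparse_collection d ((1 / 3) ^ d / 2) \<S>}. PSF d p1 p2 \<S> f1 f2)"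
    by (rule mult_left_mono) simp
  then show ?thesis unfolding top by (rule order_trans[OF S(4)])
qed

lemma enn_powr_mono: "s \<le> t \<Longrightarrow> 0 \<le> a \<Longrightarrow> enn_powr s a \<le> enn_powr t a"
proof -
  assume st: "s \<le> t" and a: "0 \<le> a"
  show ?thesis
  proof (cases "t = top")
    case False
    then have "s \<noteq> top" "enn2real s \<le> enn2real t"
      using st by (auto simp: top_unique less_top intro: enn2real_mono)
    then show ?thesis
      using False a by (simp add: enn_powr_def ennreal_leI powr_mono2)
  qed (simp add: enn_powr_def)
qed

lemma avg_mono:
  assumes p: "1 \<le> p" and le: "\<And>x. cmod (f x) \<le> cmod (g x)"
  shows "avg d (ennreal p) f Q \<le> avg d (ennreal p) g Q"
proof -
  have "Lnorm d (ennreal p) (cut (cset d Q) f) \<le> Lnorm d (ennreal p) (cut (cset d Q) g)"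
  proof -
    have "pw p (cut (cset d Q) f) x \<le> pw p (cut (cset d Q) g) x" for x
      using p le[of x] by (simp add: cut_def ennreal_leI powr_mono2)
    then show ?thesis
      using p unfolding Lnorm_def by (simp add: enn_powr_mono nn_integral_mono)
  qed
  then show ?thesis unfolding avg_def by (intro mult_left_mono) auto
qed

lemma PSF_mono:
  assumes "1 \<le> p1" "1 \<le> p2" "\<And>x. cmod (f1 x) \<le> cmod (g1 x)" "\<And>x. cmod (f2 x) \<le> cmod (g2 x)"
  shows "PSF d p1 p2 \<S> f1 f2 \<le> PSF d p1 p2 \<S> g1 g2"
  unfolding PSF_def
proof (rule infsum_mono)
  show "vol d Q * avg d (ennreal p1) f1 Q * avg d (ennreal p2) f2 Q \<le> vol d Q * avg d (ennreal p1) g1 Q * avg d (ennreal p2) g2 Q" for Q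
    using avg_mono[OF assms(1,3)] avg_mono[OF assms(2,4)] by (simp add: mult_mono)
qed (simp_all add: nonneg_summable_on_complete)

text \<open>
  Truncating the values of the functions reduces the sparse bound to bounded functions: the sparse
  forms only decrease, and the form converges by dominated convergence. If the integral defining the
  form does not converge absolutely, the form vanishes.
\<close>

lemma sparse_bound:
  assumes d1: "1 \<le> d" and K: "single_scale d q K Ks" and q: "1 < q" and r: "1 < r"
    and p: "1 \<le> p1" "1 \<le> p2" and CL: "0 < CL" and loc: "localized_estimates d Ks p1 p2 CL"
    and fm: "f1 \<in> borel_measurable (leb d)" "f2 \<in> borel_measurable (leb d)"
    and cs: "compactly_supported d f1" "compactly_supported d f2"
  shows "ennreal (cmod (trunc_form d Ks \<mu> \<nu> f1 f2)) \<le>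
    ennreal (2 powr (35 * real d)) * (trunc_const d r Ks + ennreal CL) *
      (SUP \<S>\<in>{\<S>. sparse_collection d ((1 / 3) ^ d / 2) \<S>}. PSF d p1 p2 \<S> f1 f2)"
proof (cases "integrable (leb2 d) (trunc_integrand Ks \<mu> \<nu> f1 f2)")
  case False
  then show ?thesis by (simp add: trunc_form_def not_integrable_integral_eq)
next
  case True
  let ?C = "ennreal (2 powr (35 * real d)) * (trunc_const d r Ks + ennreal CL)"
  let ?S = "{\<S>. sparse_collection d ((1 / 3) ^ d / 2) \<S>}"
  define F where "F f n = cut {x. cmod (f x) \<le> real n} f" for f :: cfun and n :: nat
  have Fm: "F f n \<in> borel_measurable (leb d)" if [measurable]: "f \<in> borel_measurable (leb d)" for f n
  proof -
    have "{x \<in> space (leb d). cmod (f x) \<le> real n} \<in> sets (leb d)" by measurable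
    then show ?thesis
      unfolding F_def using that by (intro cut_measurable) (simp_all add: Collect_conj_eq Int_commute)
  qed
  have Fb: "cmod (F f n x) \<le> real n" for f n x by (simp add: F_def cut_def)
  have Fle: "cmod (F f n x) \<le> cmod (f x)" for f n x by (simp add: F_def cut_def)
  have Fcs: "compactly_supported d (F f n)" if f: "compactly_supported d f" for f n
  proof -
    obtain A where A: "compact A" "A \<subseteq> Rd d" "supported_in d f A"
      using f unfolding compactly_supported_def by blast
    have "supported_in d (F f n) A"
      using A(3) unfolding supported_in_def by eventually_elim (simp add: F_def cut_def)
    then show ?thesis using A unfolding compactly_supported_def by blast
  qed
  have Fev: "eventually (\<lambda>n. F f n x = f x) sequentially" for f x
  proof -
    obtain m :: nat where m: "cmod (f x) \<le> real m" using real_arch_simple by blast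
    have "F f n x = f x" if "m \<le> n" for n
    proof -
      have "cmod (f x) \<le> real n" using m that by linarith
      then show ?thesis by (simp add: F_def cut_def)
    qed
    then show ?thesis by (rule eventually_sequentiallyI)
  qed
  have lim: "(\<lambda>n. trunc_form d Ks \<mu> \<nu> (F f1 n) (F f2 n)) \<longlonglongrightarrow> trunc_form d Ks \<mu> \<nu> f1 f2"
    unfolding trunc_form_def
  proof (rule integral_dominated_convergence[where w = "\<lambda>z. norm (trunc_integrand Ks \<mu> \<nu> f1 f2 z)"])
    show "trunc_integrand Ks \<mu> \<nu> f1 f2 \<in> borel_measurable (leb2 d)"
      by (rule trunc_integrand_measurable[OF K fm])
    show "trunc_integrand Ks \<mu> \<nu> (F f1 n) (F f2 n) \<in> borel_measurable (leb2 d)" for n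
      by (rule trunc_integrand_measurable[OF K Fm[OF fm(1)] Fm[OF fm(2)]])
    show "integrable (leb2 d) (\<lambda>z. norm (trunc_integrand Ks \<mu> \<nu> f1 f2 z))" using True by (rule integrable_norm)
    show "AE z in leb2 d. (\<lambda>n. trunc_integrand Ks \<mu> \<nu> (F f1 n) (F f2 n) z) \<longlonglongrightarrow> trunc_integrand Ks \<mu> \<nu> f1 f2 z"
    proof (rule AE_I2)
      fix z
      have "eventually (\<lambda>n. trunc_integrand Ks \<mu> \<nu> (F f1 n) (F f2 n) z = trunc_integrand Ks \<mu> \<nu> f1 f2 z) sequentially"
        using Fev[of f1 "snd z"] Fev[of f2 "fst z"] by eventually_elim (simp add: trunc_integrand_eq)
      then show "(\<lambda>n. trunc_integrand Ks \<mu> \<nu> (F f1 n) (F f2 n) z) \<longlonglongrightarrow> trunc_integrand Ks \<mu> \<nu> f1 f2 z"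
        by (rule tendsto_eventually)
    qed
    show "AE z in leb2 d. norm (trunc_integrand Ks \<mu> \<nu> (F f1 n) (F f2 n) z) \<le> norm (trunc_integrand Ks \<mu> \<nu> f1 f2 z)" for n
    proof (rule AE_I2)
      fix z
      show "norm (trunc_integrand Ks \<mu> \<nu> (F f1 n) (F f2 n) z) \<le> norm (trunc_integrand Ks \<mu> \<nu> f1 f2 z)"
        unfolding trunc_integrand_eq norm_mult by (intro mult_mono Fle) auto
    qed
  qed
  have bound: "ennreal (cmod (trunc_form d Ks \<mu> \<nu> (F f1 n) (F f2 n))) \<le> ?C * (SUP \<S>\<in>?S. PSF d p1 p2 \<S> f1 f2)" for n
  proof -
    have "ennreal (cmod (trunc_form d Ks \<mu> \<nu> (F f1 n) (F f2 n))) \<le> ?C * (SUP \<S>\<in>?S. PSF d p1 p2 \<S> (F f1 n) (F f2 n))"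
      by (rule sparse_bound_bounded[OF d1 K q r p CL loc Fm[OF fm(1)] Fm[OF fm(2)] Fb Fb Fcs[OF cs(1)] Fcs[OF cs(2)]])
    also have "\<dots> \<le> ?C * (SUP \<S>\<in>?S. PSF d p1 p2 \<S> f1 f2)"
      by (intro mult_left_mono SUP_subset_mono PSF_mono p Fle) auto
    finally show ?thesis .
  qed
  have "(\<lambda>n. ennreal (cmod (trunc_form d Ks \<mu> \<nu> (F f1 n) (F f2 n)))) \<longlonglongrightarrow> ennreal (cmod (trunc_form d Ks \<mu> \<nu> f1 f2))"
    using lim by (intro tendsto_ennrealI tendsto_norm)
  then show ?thesis by (rule LIMSEQ_le_const2) (use bound in blast)
qed

theorem theorem3:
  "\<exists>\<Theta>::real. \<Theta> > 0 \<and> (\<forall>d::nat. d \<ge> 1 \<longrightarrow> (\<exists>\<eta>::real. 0 < \<eta> \<and> \<eta> \<le> 1 \<and>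
     (\<forall>(r::real) (\<Lambda> :: cfun \<Rightarrow> cfun \<Rightarrow> complex) (K :: kern) (Ks :: int \<Rightarrow> kern) (q::ennreal)
       (p1::real) (p2::real) (CL::real).
        1 < r \<and> bounded_bilinear_form d r \<Lambda> \<and> has_kernel d r \<Lambda> K \<and>
        1 < q \<and> single_scale d q K Ks \<and> trunc_const d r Ks < top \<and>
        1 \<le> p1 \<and> 1 \<le> p2 \<and> 0 < CL \<and> localized_estimates d Ks p1 p2 CL \<longrightarrow>
        (\<forall>f1\<in>Lspace d (ennreal p1). \<forall>f2\<in>Lspace d (ennreal p2).
           compactly_supported d f1 \<and> compactly_supported d f2 \<longrightarrow>
           (SUP (\<mu>, \<nu>)\<in>UNIV. ennreal (cmod (trunc_form d Ks \<mu> \<nu> f1 f2)))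
             \<le> ennreal (2 powr (\<Theta> * real d)) * (trunc_const d r Ks + ennreal CL) *
                (SUP \<S>\<in>{\<S>. sparse_collection d \<eta> \<S>}. PSF d p1 p2 \<S> f1 f2)))))"
proof (rule exI[of _ "35::real"], rule conjI, simp, intro allI impI)
  fix d :: nat assume d: "1 \<le> d"
  have "(1 / 3 :: real) ^ d \<le> 1" by (intro power_le_one) auto
  then have eta: "0 < (1 / 3 :: real) ^ d / 2" "(1 / 3 :: real) ^ d / 2 \<le> 1" by simp_all
  show "\<exists>\<eta>::real. 0 < \<eta> \<and> \<eta> \<le> 1 \<and>
     (\<forall>(r::real) (\<Lambda> :: cfun \<Rightarrow> cfun \<Rightarrow> complex) (K :: kern) (Ks :: int \<Rightarrow> kern) (q::ennreal)
       (p1::real) (p2::real) (CL::real).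
        1 < r \<and> bounded_bilinear_form d r \<Lambda> \<and> has_kernel d r \<Lambda> K \<and>
        1 < q \<and> single_scale d q K Ks \<and> trunc_const d r Ks < top \<and>
        1 \<le> p1 \<and> 1 \<le> p2 \<and> 0 < CL \<and> localized_estimates d Ks p1 p2 CL \<longrightarrow>
        (\<forall>f1\<in>Lspace d (ennreal p1). \<forall>f2\<in>Lspace d (ennreal p2).
           compactly_supported d f1 \<and> compactly_supported d f2 \<longrightarrow>
           (SUP (\<mu>, \<nu>)\<in>UNIV. ennreal (cmod (trunc_form d Ks \<mu> \<nu> f1 f2)))
             \<le> ennreal (2 powr (35 * real d)) * (trunc_const d r Ks + ennreal CL) *
                (SUP \<S>\<in>{\<S>. sparse_collection d \<eta> \<S>}. PSF d p1 p2 \<S> f1 f2)))"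
  proof (intro exI[of _ "(1 / 3) ^ d / 2"] conjI eta allI impI ballI)
    fix r :: real and \<Lambda> :: "cfun \<Rightarrow> cfun \<Rightarrow> complex" and K Ks q and p1 p2 CL :: real and f1 f2
    assume H: "1 < r \<and> bounded_bilinear_form d r \<Lambda> \<and> has_kernel d r \<Lambda> K \<and>
        1 < q \<and> single_scale d q K Ks \<and> trunc_const d r Ks < top \<and>
        1 \<le> p1 \<and> 1 \<le> p2 \<and> 0 < CL \<and> localized_estimates d Ks p1 p2 CL"
      and f: "f1 \<in> Lspace d (ennreal p1)" "f2 \<in> Lspace d (ennreal p2)"
        "compactly_supported d f1 \<and> compactly_supported d f2"
    have fm: "f1 \<in> borel_measurable (leb d)" "f2 \<in> borel_measurable (leb d)" using f by (simp_all add: Lspace_def)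
    have "ennreal (cmod (trunc_form d Ks \<mu> \<nu> f1 f2)) \<le>
        ennreal (2 powr (35 * real d)) * (trunc_const d r Ks + ennreal CL) *
        (SUP \<S>\<in>{\<S>. sparse_collection d ((1 / 3) ^ d / 2) \<S>}. PSF d p1 p2 \<S> f1 f2)" for \<mu> \<nu>
      using H f(3) by (intro sparse_bound[OF d _ _ _ _ _ _ _ fm]) auto
    then show "(SUP (\<mu>, \<nu>)\<in>UNIV. ennreal (cmod (trunc_form d Ks \<mu> \<nu> f1 f2))) \<le>
        ennreal (2 powr (35 * real d)) * (trunc_const d r Ks + ennreal CL) *
        (SUP \<S>\<in>{\<S>. sparse_collection d ((1 / 3) ^ d / 2) \<S>}. PSF d p1 p2 \<S> f1 f2)"
      by (intro SUP_least) auto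
  qed
qed



end
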